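(* Let $([\mathbf G,\mathbf o],S)$ be a proper extension of a unimodular network. Assume $T:\mathcal G_{**}\to\mathbb R^{\ge0}$ is a measurable function such that $T_{\mathbf G}$ is almost surely a Markovian transport kernel from $V(\mathbf G)$ to $S_{\mathbf G}$; i.e. almost surely, for all $v\in V(\mathbf G)$, $T_{\mathbf G}^+(v)=1$ and $T_{\mathbf G}(v,\cdot)\equiv 0$ on $V(\mathbf G)\setminus S_{\mathbf G}$. Let $M:=M([\mathbf G,\mathbf o]):=T_{\mathbf G}^-(\mathbf o)$. Then: (i) $[\mathbf G]$ can be unimodularized if and only if $\mathbb E[M\mid I]<\infty$ a.s. (ii) If $\mathbb E[M]<\infty$, then the following probability measure gives a weak unimodularization of $[\mathbf G]$: $$\mathcal P_T[A]:=\frac1{\mathbb E[M]}\,\mathbb E\Big[\sum_{v\in V(\mathbf G)}T_{\mathbf G}(v,\mathbf o)\,1_A[\mathbf G,v]\Big].$$ (iii) If $\mathbb E[M\mid I]<\infty$ a.s., then the following probability measure gives the unique strong unimodularization of $[\mathbf G]$: $$\mathcal P'_T[A]:=\mathbb E\Big[\frac1{\mathbb E[M\mid I]}\sum_{v\in V(\mathbf G)}T_{\mathbf G}(v,\mathbf o)\,1_A[\mathbf G,v]\Big].$$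
   Context: Networks. Fix a complete separable metric space $\Xi$ (the mark space). A network is a connected, locally finite (every vertex has finite degree) multigraph $G$ with vertex set $V(G)$, together with a mark in $\Xi$ for each vertex $v$ and for each pair $(v,e)$ with $e$ an edge incident to $v$. A rooted network $(G,o)$ is a network with a distinguished vertex $o$; a doubly-rooted network $(G,o,v)$ has an ordered pair of distinguished vertices. Isomorphisms preserve marks and distinguished vertices. $\mathcal G$, $\mathcal G_*$ and $\mathcal G_{**}$ are the sets of isomorphism classes $[G]$, $[G,o]$ and $[G,o,v]$ of networks, rooted networks and doubly-rooted networks. $\mathcal G_*$ and $\mathcal G_{**}$ carry the Borel sigma-fields of the (Polish) local topologies: $[G_n,o_n]\to[G,o]$ iff for all $r\in\mathbb N$ and $\varepsilon>0$, for all large $n$ there is a graph isomorphism between the balls of radius $r$ about the roots that maps root to root and for which corresponding marks are at distance less than $\varepsilon$; for $\mathcal G_{**}$ one uses balls about the first root, with $r$ at least the distance of the two roots in the limit, and isomorphisms must also map second root to second root. For a function $f$ we write $f[G,o]$ for $f([G,o])$, etc. $\pi:\mathcal G_*\to\mathcal G$ is $\pi[G,o]=[G]$, and $J=\{B\subseteq\mathcal G:\pi^{-1}(B)\text{ is measurable}\}$. A random rooted network $[\mathbf G,\mathbf o]$ is a random element of $\mathcal G_*$ (probability measures on $\mathcal G_*$ are identified with random rooted networks); $[\mathbf G]$ is its image under $\pi$, a random element of $(\mathcal G,J)$. For measurable $T:\mathcal G_{**}\to\mathbb R^{\ge0}$: $T_G(u,v)=T[G,u,v]$, $T_G^+(o)=\sum_{v\in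 V(G)}T_G(o,v)$, $T_G^-(o)=\sum_{v\in V(G)}T_G(v,o)$. Unimodular: $[\mathbf G,\mathbf o]$ is unimodular (a "unimodular network") if $\mathbb E[g_{\mathbf G}^+(\mathbf o)]=\mathbb E[g_{\mathbf G}^-(\mathbf o)]$ for all measurable $g:\mathcal G_{**}\to\mathbb R^{\ge0}$ (both sides may be infinite). Invariant sigma-field $I$: the family of measurable $A\subseteq\mathcal G_*$ such that $[G,o]\in A$ and $v\in V(G)$ imply $[G,v]\in A$. $\mathbb E[\,\cdot\mid I]$ is conditional expectation given the events $\{[\mathbf G,\mathbf o]\in A\}$, $A\in I$. Covariant subset: a map $S$ associating to each network $G$ a set $S_G\subseteq V(G)$ such that $[G,o]\mapsto 1_{\{o\in S_G\}}$ is well defined and measurable on $\mathcal G_*$. The same symbol $S_G$ denotes the subnetwork of $G$ induced by $S_G$; $S$ is then called a covariant subnetwork. Extension: an extension of a unimodular network $[\mathbf G_0,\mathbf o_0]$ is a pair $([\mathbf G,\mathbf o],S)$ where $[\mathbf G,\mathbf o]$ is a (not necessarily unimodular) random rooted network (possibly with a larger mark space) and $S$ is a covariant subnetwork such that $\mathbf o\in S_{\mathbf G}$ a.s., $S_{\mathbf G}$ is connected a.s., and $[S_{\mathbf G},\mathbf o]$ has the same distribution as $[\mathbf G_0,\mathbf o_0]$. It is proper if $\mathbb E\big[\sum_{v\in S_{\mathbf G}}g[\mathbf G,\mathbf o,v]\big]=\mathbb E\big[\sum_{v\in S_{\mathbf G}}g[\mathbf G,v,\mathbf o]\big]$ for all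 measurable $g:\mathcal G_{**}\to\mathbb R^{\ge0}$. Unimodularization: a unimodular network $[\mathbf G',\mathbf o']$ is a strong unimodularization of $[\mathbf G]$ if $[\mathbf G']$ and $[\mathbf G]$ have the same distribution on $(\mathcal G,J)$, and a weak unimodularization of $[\mathbf G]$ if these distributions are mutually absolutely continuous. $[\mathbf G]$ can be unimodularized if it has a (weak or strong) unimodularization. Uniqueness is in the sense of distributions. *)

theory Defs
  imports "HOL-Probability.Probability"
begin

section \<open>Networks\<close>

text \<open>
  A connected, locally finite multigraph has countably many vertices and edges, so every
  isomorphism class of networks has a representative whose vertices and edges are natural numbers.
  Edges are named objects, so parallel edges are possible; \<open>ends G e\<close> is the set of
  end vertices of \<open>e\<close>, a singleton if \<open>e\<close> is a loop.  The mark of the pair \<open>(v, e)\<close> is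
  \<open>emark G v e\<close>.  Values of \<open>ends\<close>, \<open>vmark\<close>, \<open>emark\<close> outside the graph are irrelevant: the
  isomorphisms below do not look at them.
\<close>

record 'x network =
  verts :: "nat set"
  edges :: "nat set"
  ends :: "nat \<Rightarrow> nat set"
  vmark :: "nat \<Rightarrow> 'x"
  emark :: "nat \<Rightarrow> nat \<Rightarrow> 'x"

definition multigraph :: "'x network \<Rightarrow> bool" where
  "multigraph G \<longleftrightarrow> (\<forall>e\<in>edges G. ends G e \<subseteq> verts G \<and> card (ends G e) \<in> {1, 2})"

definition locally_finite :: "'x network \<Rightarrow> bool" where
  "locally_finite G \<longleftrightarrow> (\<forall>v\<in>verts G. finite {e \<in> edges G. v \<in> ends G e})"

definition adjacent :: "'x network \<Rightarrow> (nat \<times> nat) set" where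
  "adjacent G = {(u, v). \<exists>e\<in>edges G. ends G e = {u, v}}"

definition connected_graph :: "'x network \<Rightarrow> bool" where
  "connected_graph G \<longleftrightarrow> (\<forall>u\<in>verts G. \<forall>v\<in>verts G. (u, v) \<in> (adjacent G)\<^sup>*)"

definition network :: "'x network \<Rightarrow> bool" where
  "network G \<longleftrightarrow> verts G \<noteq> {} \<and> multigraph G \<and> locally_finite G \<and> connected_graph G"

definition induced :: "'x network \<Rightarrow> nat set \<Rightarrow> 'x network" where
  "induced G W = G\<lparr>verts := verts G \<inter> W, edges := {e \<in> edges G. ends G e \<subseteq> W}\<rparr>"

definition gball :: "'x network \<Rightarrow> nat \<Rightarrow> nat \<Rightarrow> nat set" where
  "gball G u n = {v. \<exists>k\<le>n. (u, v) \<in> adjacent G ^^ k}"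

abbreviation ball_network :: "'x network \<Rightarrow> nat \<Rightarrow> nat \<Rightarrow> 'x network" where
  "ball_network G u n \<equiv> induced G (gball G u n)"

definition map_marks :: "('x \<Rightarrow> 'y) \<Rightarrow> 'x network \<Rightarrow> 'y network" where
  "map_marks p G = \<lparr>verts = verts G, edges = edges G, ends = ends G,
     vmark = (\<lambda>v. p (vmark G v)), emark = (\<lambda>v e. p (emark G v e))\<rparr>"

text \<open>
  A graph isomorphism, given by a vertex map \<open>f\<close> and an edge map \<open>h\<close>, under which corresponding
  marks are related by \<open>R\<close>.
\<close>

definition iso_via ::
  "('x \<Rightarrow> 'x \<Rightarrow> bool) \<Rightarrow> (nat \<Rightarrow> nat) \<Rightarrow> (nat \<Rightarrow> nat) \<Rightarrow> 'x network \<Rightarrow> 'x network \<Rightarrow> bool" where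
  "iso_via R f h G H \<longleftrightarrow>
     bij_betw f (verts G) (verts H) \<and> bij_betw h (edges G) (edges H) \<and>
     (\<forall>e\<in>edges G. ends H (h e) = f ` ends G e) \<and>
     (\<forall>v\<in>verts G. R (vmark G v) (vmark H (f v))) \<and>
     (\<forall>e\<in>edges G. \<forall>v\<in>ends G e. R (emark G v e) (emark H (f v) (h e)))"

lemma iso_via_refl: "(\<And>a. R a a) \<Longrightarrow> iso_via R (\<lambda>v. v) (\<lambda>e. e) G G"
  by (simp add: iso_via_def bij_betw_def inj_on_def)

lemma iso_via_sym:
  assumes "iso_via R f h G H" "multigraph G"
  shows "iso_via (\<lambda>a b. R b a) (inv_into (verts G) f) (inv_into (edges G) h) H G"
proof -
  let ?f = "inv_into (verts G) f" and ?h = "inv_into (edges G) h"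
  have f: "bij_betw f (verts G) (verts H)" and h: "bij_betw h (edges G) (edges H)"
    and e: "\<And>e. e \<in> edges G \<Longrightarrow> ends H (h e) = f ` ends G e"
    and v: "\<And>v. v \<in> verts G \<Longrightarrow> R (vmark G v) (vmark H (f v))"
    and m: "\<And>e v. e \<in> edges G \<Longrightarrow> v \<in> ends G e \<Longrightarrow> R (emark G v e) (emark H (f v) (h e))"
    using assms(1) by (auto simp: iso_via_def)
  have sub: "ends G e \<subseteq> verts G" if "e \<in> edges G" for e
    using assms(2) that by (auto simp: multigraph_def)
  have fi: "?f (f w) = w" if "w \<in> verts G" for w
    using f that by (simp add: bij_betw_inv_into_left)
  have hi: "?h (h d) = d" if "d \<in> edges G" for d
    using h that by (simp add: bij_betw_inv_into_left)
  have V: "verts H = f ` verts G" and E: "edges H = h ` edges G"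
    using f h by (auto simp: bij_betw_def)
  have im: "?f ` (f ` ends G d) = ends G d" if "d \<in> edges G" for d
    using fi sub[OF that] by (force simp: image_image)
  show ?thesis
    unfolding iso_via_def
  proof (intro conjI ballI)
    show "bij_betw ?f (verts H) (verts G)" "bij_betw ?h (edges H) (edges G)"
      using f h by (auto intro: bij_betw_inv_into)
  next
    fix d assume "d \<in> edges H"
    then show "ends G (?h d) = ?f ` ends H d"
      unfolding E using e im hi by (metis imageE)
  next
    fix w assume "w \<in> verts H"
    then show "R (vmark G (?f w)) (vmark H w)"
      unfolding V using v fi by auto
  next
    fix d w assume d: "d \<in> edges H" and w: "w \<in> ends H d"
    from d obtain d' where d': "d' \<in> edges G" "d = h d'" unfolding E by auto
    from w obtain w' where w': "w' \<in> ends G d'" "w = f w'" using d' e by auto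
    have "w' \<in> verts G" using sub d' w' by auto
    then show "R (emark G (?f w) (?h d)) (emark H w d)"
      using m[OF d'(1) w'(1)] d' w' fi hi by auto
  qed
qed

lemma iso_via_trans:
  assumes "iso_via R f h G H" "iso_via Q f' h' H K" "multigraph G"
    and RQ: "\<And>a b c. R a b \<Longrightarrow> Q b c \<Longrightarrow> P a c"
  shows "iso_via P (f' \<circ> f) (h' \<circ> h) G K"
proof -
  have V: "f w \<in> verts H" if "w \<in> verts G" for w
    using assms(1) that by (auto simp: iso_via_def bij_betw_def)
  have E: "h d \<in> edges H" if "d \<in> edges G" for d
    using assms(1) that by (auto simp: iso_via_def bij_betw_def)
  show ?thesis
    unfolding iso_via_def
  proof (intro conjI ballI)
    show "bij_betw (f' \<circ> f) (verts G) (verts K)" "bij_betw (h' \<circ> h) (edges G) (edges K)"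
      using assms(1,2) by (auto simp: iso_via_def intro: bij_betw_trans)
  next
    fix d assume "d \<in> edges G"
    then show "ends K ((h' \<circ> h) d) = (f' \<circ> f) ` ends G d"
      using assms(1,2) E by (simp add: iso_via_def image_comp)
  next
    fix w assume "w \<in> verts G"
    then show "P (vmark G w) (vmark K ((f' \<circ> f) w))"
      using assms(1,2) V RQ unfolding iso_via_def by (metis comp_apply)
  next
    fix d w assume "d \<in> edges G" "w \<in> ends G d"
    then show "P (emark G w d) (emark K ((f' \<circ> f) w) ((h' \<circ> h) d))"
      using assms(1,2) E RQ unfolding iso_via_def by (metis comp_apply image_eqI)
  qed
qed

lemma multigraph_induced: "multigraph G \<Longrightarrow> multigraph (induced G W)"
  by (auto simp: multigraph_def induced_def)


section \<open>Isomorphism classes of networks with zero, one or two roots\<close>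

definition net_iso :: "'x network \<Rightarrow> 'x network \<Rightarrow> bool" where
  "net_iso G H \<longleftrightarrow> network G \<and> network H \<and> (\<exists>f h. iso_via (=) f h G H)"

definition rooted_iso :: "'x network \<times> nat \<Rightarrow> 'x network \<times> nat \<Rightarrow> bool" where
  "rooted_iso = (\<lambda>(G, u) (H, v). network G \<and> network H \<and> u \<in> verts G \<and> v \<in> verts H \<and>
     (\<exists>f h. iso_via (=) f h G H \<and> f u = v))"

definition birooted_iso :: "'x network \<times> nat \<times> nat \<Rightarrow> 'x network \<times> nat \<times> nat \<Rightarrow> bool" where
  "birooted_iso = (\<lambda>(G, u, u') (H, v, v'). network G \<and> network H \<and>
     u \<in> verts G \<and> u' \<in> verts G \<and> v \<in> verts H \<and> v' \<in> verts H \<and>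
     (\<exists>f h. iso_via (=) f h G H \<and> f u = v \<and> f u' = v'))"

lemma network_exists: "\<exists>G :: 'x network. network G \<and> 0 \<in> verts G"
proof -
  let ?G = "\<lparr>verts = {0}, edges = {}, ends = \<lambda>_. {}, vmark = undefined, emark = undefined\<rparr>"
  have "network ?G"
    by (auto simp: network_def multigraph_def locally_finite_def connected_graph_def)
  then show ?thesis by (intro exI[of _ ?G]) simp
qed

lemma network_multigraph: "network G \<Longrightarrow> multigraph G"
  by (simp add: network_def)

lemma iso_eq_refl: "\<exists>f h. iso_via (=) f h G G \<and> f u = u \<and> f v = v"
  using iso_via_refl[of "(=)" G] by auto

lemma iso_eq_sym:
  assumes "iso_via (=) f h G H" "network G" "u \<in> verts G" "u' \<in> verts G"
  shows "\<exists>f' h'. iso_via (=) f' h' H G \<and> f' (f u) = u \<and> f' (f u') = u'"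
proof -
  have "iso_via (=) (inv_into (verts G) f) (inv_into (edges G) h) H G"
    using iso_via_sym[OF assms(1)] assms(2) by (simp add: network_def eq_commute)
  moreover have "inj_on f (verts G)"
    using assms(1) by (auto simp: iso_via_def bij_betw_def)
  ultimately show ?thesis
    using assms(3,4) by (metis inv_into_f_f)
qed

lemma iso_eq_trans:
  assumes "iso_via (=) f h G H" "iso_via (=) f' h' H K" "network G"
  shows "iso_via (=) (f' \<circ> f) (h' \<circ> h) G K"
  by (rule iso_via_trans[OF assms(1,2)]) (use assms(3) in \<open>auto simp: network_def\<close>)

quotient_type 'x net = "'x network" / partial: net_iso
proof (rule part_equivpI)
  show "\<exists>G :: 'x network. net_iso G G"
    using network_exists iso_eq_refl unfolding net_iso_def by blast
  show "symp (net_iso :: 'x network \<Rightarrow> _)"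
  proof (rule sympI)
    fix G H :: "'x network"
    assume "net_iso G H"
    then show "net_iso H G"
      using iso_eq_sym unfolding net_iso_def network_def by blast
  qed
  show "transp (net_iso :: 'x network \<Rightarrow> _)"
    unfolding transp_def net_iso_def using iso_eq_trans by blast
qed

quotient_type 'x rooted_net = "'x network \<times> nat" / partial: rooted_iso
proof (rule part_equivpI)
  show "\<exists>a :: 'x network \<times> nat. rooted_iso a a"
    using network_exists iso_eq_refl unfolding rooted_iso_def by fast
  show "symp (rooted_iso :: 'x network \<times> nat \<Rightarrow> _)"
  proof (rule sympI)
    fix a b :: "'x network \<times> nat"
    assume ab: "rooted_iso a b"
    obtain G u H v where "a = (G, u)" "b = (H, v)" by (cases a, cases b)
    then show "rooted_iso b a"
      using ab iso_eq_sym[of _ _ G H u u] by (auto simp: rooted_iso_def)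
  qed
  show "transp (rooted_iso :: 'x network \<times> nat \<Rightarrow> _)"
  proof (rule transpI)
    fix a b c :: "'x network \<times> nat"
    assume abc: "rooted_iso a b" "rooted_iso b c"
    obtain G u H v K w where [simp]: "a = (G, u)" "b = (H, v)" "c = (K, w)"
      by (cases a, cases b, cases c)
    from abc obtain f h f' h' where 1: "iso_via (=) f h G H" "f u = v"
      and 2: "iso_via (=) f' h' H K" "f' v = w"
      by (auto simp: rooted_iso_def)
    have "(f' \<circ> f) u = w" using 1 2 by simp
    then have "\<exists>f h. iso_via (=) f h G K \<and> f u = w"
      using iso_eq_trans[OF 1(1) 2(1)] abc(1) by (auto simp: rooted_iso_def)
    then show "rooted_iso a c"
      using abc by (auto simp: rooted_iso_def)
  qed
qed

quotient_type 'x birooted_net = "'x network \<times> nat \<times> nat" / partial: birooted_iso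
proof (rule part_equivpI)
  show "\<exists>a :: 'x network \<times> nat \<times> nat. birooted_iso a a"
    using network_exists iso_eq_refl unfolding birooted_iso_def by fast
  show "symp (birooted_iso :: 'x network \<times> nat \<times> nat \<Rightarrow> _)"
  proof (rule sympI)
    fix a b :: "'x network \<times> nat \<times> nat"
    assume ab: "birooted_iso a b"
    obtain G u u' H v v' where "a = (G, u, u')" "b = (H, v, v')" by (cases a, cases b)
    then show "birooted_iso b a"
      using ab iso_eq_sym[of _ _ G H u u'] by (auto simp: birooted_iso_def)
  qed
  show "transp (birooted_iso :: 'x network \<times> nat \<times> nat \<Rightarrow> _)"
  proof (rule transpI)
    fix a b c :: "'x network \<times> nat \<times> nat"
    assume abc: "birooted_iso a b" "birooted_iso b c"
    obtain G u u' H v v' K w w' where [simp]: "a = (G, u, u')" "b = (H, v, v')" "c = (K, w, w')"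
      by (cases a, cases b, cases c)
    from abc obtain f h f' h' where 1: "iso_via (=) f h G H" "f u = v" "f u' = v'"
      and 2: "iso_via (=) f' h' H K" "f' v = w" "f' v' = w'"
      by (auto simp: birooted_iso_def)
    have "(f' \<circ> f) u = w \<and> (f' \<circ> f) u' = w'" using 1 2 by simp
    then have "\<exists>f h. iso_via (=) f h G K \<and> f u = w \<and> f u' = w'"
      using iso_eq_trans[OF 1(1) 2(1)] abc(1) by (auto simp: birooted_iso_def)
    then show "birooted_iso a c"
      using abc by (auto simp: birooted_iso_def)
  qed
qed

text \<open>
  The classes \<open>[G]\<close>, \<open>[G, u]\<close>, \<open>[G, u, v]\<close>, and chosen representatives.  All uses of the
  representatives below are invariant under isomorphism.
\<close>

definition unet :: "'x network \<Rightarrow> 'x net" where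
  "unet G = abs_net G"

definition rnet :: "'x network \<Rightarrow> nat \<Rightarrow> 'x rooted_net" where
  "rnet G u = abs_rooted_net (G, u)"

definition bnet :: "'x network \<Rightarrow> nat \<Rightarrow> nat \<Rightarrow> 'x birooted_net" where
  "bnet G u v = abs_birooted_net (G, u, v)"

definition net_of :: "'x rooted_net \<Rightarrow> 'x network" where
  "net_of x = fst (rep_rooted_net x)"

definition root_of :: "'x rooted_net \<Rightarrow> nat" where
  "root_of x = snd (rep_rooted_net x)"

definition bi_net_of :: "'x birooted_net \<Rightarrow> 'x network" where
  "bi_net_of z = fst (rep_birooted_net z)"

definition root1_of :: "'x birooted_net \<Rightarrow> nat" where
  "root1_of z = fst (snd (rep_birooted_net z))"

definition root2_of :: "'x birooted_net \<Rightarrow> nat" where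
  "root2_of z = snd (snd (rep_birooted_net z))"

lemma rooted_iso_reps: "rooted_iso (net_of x, root_of x) (net_of x, root_of x)"
  using Quotient3_rep_reflp[OF Quotient3_rooted_net] by (simp add: net_of_def root_of_def)

lemma network_net_of: "network (net_of x)" and root_of_in: "root_of x \<in> verts (net_of x)"
  using rooted_iso_reps[of x] by (auto simp: rooted_iso_def)

lemma rnet_net_of [simp]: "rnet (net_of x) (root_of x) = x"
  using Quotient3_abs_rep[OF Quotient3_rooted_net]
  by (simp add: rnet_def net_of_def root_of_def)

lemma rnet_eq_iff:
  assumes "network G" "u \<in> verts G" "network H" "v \<in> verts H"
  shows "rnet G u = rnet H v \<longleftrightarrow> (\<exists>f h. iso_via (=) f h G H \<and> f u = v)"
proof -
  have "rooted_iso (G, u) (G, u)" "rooted_iso (H, v) (H, v)"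
    using assms iso_eq_refl unfolding rooted_iso_def by fast+
  then have "rnet G u = rnet H v \<longleftrightarrow> rooted_iso (G, u) (H, v)"
    using Quotient3_rel[OF Quotient3_rooted_net, of "(G, u)" "(H, v)"] by (simp add: rnet_def)
  then show ?thesis using assms by (simp add: rooted_iso_def)
qed

lemma bnet_eq_iff:
  assumes "network G" "u \<in> verts G" "u' \<in> verts G" "network H" "v \<in> verts H" "v' \<in> verts H"
  shows "bnet G u u' = bnet H v v' \<longleftrightarrow> (\<exists>f h. iso_via (=) f h G H \<and> f u = v \<and> f u' = v')"
proof -
  have "birooted_iso (G, u, u') (G, u, u')" "birooted_iso (H, v, v') (H, v, v')"
    using assms iso_eq_refl unfolding birooted_iso_def by fast+
  then have "bnet G u u' = bnet H v v' \<longleftrightarrow> birooted_iso (G, u, u') (H, v, v')"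
    using Quotient3_rel[OF Quotient3_birooted_net, of "(G, u, u')" "(H, v, v')"]
    by (simp add: bnet_def)
  then show ?thesis using assms by (simp add: birooted_iso_def)
qed

lemma birooted_iso_reps:
  "birooted_iso (bi_net_of z, root1_of z, root2_of z) (bi_net_of z, root1_of z, root2_of z)"
  using Quotient3_rep_reflp[OF Quotient3_birooted_net]
  by (simp add: bi_net_of_def root1_of_def root2_of_def)

lemma network_bi_net_of: "network (bi_net_of z)"
  and root1_of_in: "root1_of z \<in> verts (bi_net_of z)"
  and root2_of_in: "root2_of z \<in> verts (bi_net_of z)"
  using birooted_iso_reps[of z] by (auto simp: birooted_iso_def)

lemma bnet_bi_net_of [simp]: "bnet (bi_net_of z) (root1_of z) (root2_of z) = z"
  using Quotient3_abs_rep[OF Quotient3_birooted_net]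
  by (simp add: bnet_def bi_net_of_def root1_of_def root2_of_def)

definition unroot :: "'x rooted_net \<Rightarrow> 'x net" where
  "unroot x = unet (net_of x)"

lemma unroot_rnet:
  assumes "network G" "u \<in> verts G"
  shows "unroot (rnet G u) = unet G"
proof -
  have "rnet (net_of (rnet G u)) (root_of (rnet G u)) = rnet G u" by simp
  then have "net_iso (net_of (rnet G u)) G"
    using assms network_net_of root_of_in
    by (subst (asm) rnet_eq_iff) (auto simp: net_iso_def)
  then show ?thesis
    using Quotient3_rel_abs[OF Quotient3_net] by (simp add: unroot_def unet_def)
qed


section \<open>The local topology\<close>

text \<open>
  \<open>close_rooted n \<epsilon> x y\<close>: the balls of radius \<open>n\<close> about the roots are isomorphic with corresponding
  marks at distance less than \<open>\<epsilon>\<close>.  For two roots the ball about the first root has to contain the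
  second one.
\<close>

definition close_rooted ::
  "nat \<Rightarrow> real \<Rightarrow> 'x::metric_space rooted_net \<Rightarrow> 'x rooted_net \<Rightarrow> bool" where
  "close_rooted n \<epsilon> x y \<longleftrightarrow>
     (\<exists>f h. iso_via (\<lambda>a b. dist a b < \<epsilon>) f h
              (ball_network (net_of x) (root_of x) n) (ball_network (net_of y) (root_of y) n) \<and>
            f (root_of x) = root_of y)"

definition close_birooted ::
  "nat \<Rightarrow> real \<Rightarrow> 'x::metric_space birooted_net \<Rightarrow> 'x birooted_net \<Rightarrow> bool" where
  "close_birooted n \<epsilon> z w \<longleftrightarrow>
     root2_of z \<in> gball (bi_net_of z) (root1_of z) n \<and>
     (\<exists>f h. iso_via (\<lambda>a b. dist a b < \<epsilon>) f h
              (ball_network (bi_net_of z) (root1_of z) n)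
              (ball_network (bi_net_of w) (root1_of w) n) \<and>
            f (root1_of z) = root1_of w \<and> f (root2_of z) = root2_of w)"

lemma iso_via_mono:
  assumes "iso_via R f h G H" "\<And>a b. R a b \<Longrightarrow> Q a b"
  shows "iso_via Q f h G H"
  using assms unfolding iso_via_def by blast

lemma relpow_verts:
  assumes "multigraph G" "u \<in> verts G" "(u, v) \<in> adjacent G ^^ k"
  shows "v \<in> verts G"
  using assms(3)
proof (induction k arbitrary: v)
  case 0
  then show ?case using assms by simp
next
  case (Suc k)
  then show ?case using assms(1) by (auto simp: adjacent_def multigraph_def)
qed

lemma gball_subset: "multigraph G \<Longrightarrow> u \<in> verts G \<Longrightarrow> gball G u n \<subseteq> verts G"
  by (auto simp: gball_def intro: relpow_verts)

lemma gball_mono: "m \<le> n \<Longrightarrow> gball G u m \<subseteq> gball G u n"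
  unfolding gball_def using order_trans by blast

lemma verts_ball_network:
  "network G \<Longrightarrow> u \<in> verts G \<Longrightarrow> verts (ball_network G u n) = gball G u n"
  using gball_subset[of G u n] by (auto simp: induced_def network_def)

lemma iso_ball_gball:
  assumes iso: "iso_via R f h (ball_network G u n) (ball_network H v n)" and "f u = v"
    and nw: "network G" "u \<in> verts G" and mn: "m \<le> n"
    and w: "w \<in> gball G u m"
  shows "f w \<in> gball H v m"
proof -
  have "(v, f w) \<in> adjacent H ^^ k" if "(u, w) \<in> adjacent G ^^ k" "k \<le> n" for k w
    using that
  proof (induction k arbitrary: w)
    case 0
    then show ?case using \<open>f u = v\<close> by auto
  next
    case (Suc k)
    then obtain w' where w': "(u, w') \<in> adjacent G ^^ k" "(w', w) \<in> adjacent G" by auto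
    then obtain e where e: "e \<in> edges G" "ends G e = {w', w}" by (auto simp: adjacent_def)
    have "w' \<in> gball G u n" "w \<in> gball G u n"
      using Suc.prems w'(1) unfolding gball_def
      by (blast intro: Suc_leD)+
    then have "e \<in> edges (ball_network G u n)"
      using e by (simp add: induced_def)
    then have "h e \<in> edges (ball_network H v n)"
      "ends (ball_network H v n) (h e) = f ` ends (ball_network G u n) e"
      using iso by (auto simp: iso_via_def bij_betw_def)
    then have "(f w', f w) \<in> adjacent H"
      using e by (auto simp: adjacent_def induced_def)
    then show ?case using Suc w' by auto
  qed
  then show ?thesis using w mn unfolding gball_def by (blast intro: order_trans)
qed

lemma iso_ball_restrict:
  assumes iso: "iso_via R f h (ball_network G u n) (ball_network H v n)" and fu: "f u = v"
    and nw: "network G" "u \<in> verts G" "network H" "v \<in> verts H" and mn: "m \<le> n"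
  shows "iso_via R f h (ball_network G u m) (ball_network H v m)"
proof -
  let ?G = "ball_network G u n" and ?H = "ball_network H v n"
  have VG: "verts (ball_network G u k) = gball G u k" and VH: "verts (ball_network H v k) = gball H v k" for k
    using nw by (auto simp: verts_ball_network)
  have inj: "inj_on f (gball G u n)" and im: "f ` gball G u n = gball H v n"
    and hinj: "inj_on h (edges ?G)" and him: "h ` edges ?G = edges ?H"
    using iso by (auto simp: iso_via_def bij_betw_def VG VH)
  have ends: "ends H (h e) = f ` ends G e" if "e \<in> edges ?G" for e
    using iso that by (auto simp: iso_via_def induced_def)
  have sub: "gball G u m \<subseteq> gball G u n" "gball H v m \<subseteq> gball H v n"
    using mn by (auto dest: gball_mono)
  have u_in: "u \<in> gball G u n"
    unfolding gball_def by (simp, rule exI[of _ 0], simp)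
  let ?f = "inv_into (verts ?G) f"
  have inv: "iso_via (\<lambda>a b. R b a) ?f (inv_into (edges ?G) h) ?H ?G"
    by (rule iso_via_sym[OF iso]) (simp add: nw multigraph_induced network_multigraph)
  have fim: "f ` gball G u m = gball H v m"
  proof
    show "f ` gball G u m \<subseteq> gball H v m"
      using iso_ball_gball[OF iso fu nw(1,2) mn] by auto
    show "gball H v m \<subseteq> f ` gball G u m"
    proof
      fix w assume w: "w \<in> gball H v m"
      have "?f v = u" using fu u_in inj by (auto simp: VG)
      then have "?f w \<in> gball G u m"
        using iso_ball_gball[OF inv _ nw(3,4) mn w] by simp
      moreover have "w = f (?f w)"
        using w sub im by (auto simp: VG f_inv_into_f)
      ultimately show "w \<in> f ` gball G u m" by blast
    qed
  qed
  have Esub: "edges (ball_network G u m) \<subseteq> edges ?G" "edges (ball_network H v m) \<subseteq> edges ?H"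
    using sub by (auto simp: induced_def)
  have him': "h ` edges (ball_network G u m) = edges (ball_network H v m)"
  proof
    show "h ` edges (ball_network G u m) \<subseteq> edges (ball_network H v m)"
    proof
      fix d assume "d \<in> h ` edges (ball_network G u m)"
      then obtain e where e: "e \<in> edges (ball_network G u m)" "d = h e" by auto
      then have eG: "e \<in> edges ?G" using Esub by auto
      then have "d \<in> edges ?H" using him e by auto
      moreover have "ends H d \<subseteq> gball H v m"
        using e ends[OF eG] fim by (auto simp: induced_def)
      ultimately show "d \<in> edges (ball_network H v m)" by (auto simp: induced_def)
    qed
    show "edges (ball_network H v m) \<subseteq> h ` edges (ball_network G u m)"
    proof
      fix d assume d: "d \<in> edges (ball_network H v m)"
      then obtain e where e: "e \<in> edges ?G" "d = h e" using Esub him by blast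
      have "ends G e \<subseteq> gball G u m"
      proof
        fix w assume w: "w \<in> ends G e"
        then have "f w \<in> gball H v m" using d ends[OF e(1)] e(2) by (auto simp: induced_def)
        then obtain w' where w': "w' \<in> gball G u m" "f w' = f w" using fim by (metis imageE)
        have "w \<in> gball G u n" using w e(1) by (auto simp: induced_def)
        then have "w' = w" using w' inj sub by (meson inj_on_def subsetD)
        then show "w \<in> gball G u m" using w' by simp
      qed
      then have "e \<in> edges (ball_network G u m)" using e by (auto simp: induced_def)
      then show "d \<in> h ` edges (ball_network G u m)" using e by blast
    qed
  qed
  have "bij_betw f (gball G u m) (gball H v m)"
    unfolding bij_betw_def using fim inj sub by (auto intro: inj_on_subset)
  moreover have "bij_betw h (edges (ball_network G u m)) (edges (ball_network H v m))"
    unfolding bij_betw_def using him' hinj Esub by (auto intro: inj_on_subset)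
  moreover have "ends (ball_network H v m) (h e) = f ` ends (ball_network G u m) e"
    if "e \<in> edges (ball_network G u m)" for e
    using ends that Esub by (auto simp: induced_def)
  moreover have "R (vmark (ball_network G u m) w) (vmark (ball_network H v m) (f w))"
    if "w \<in> gball G u m" for w
  proof -
    have "w \<in> verts ?G" using that sub VG by auto
    then have "R (vmark ?G w) (vmark ?H (f w))" using iso unfolding iso_via_def by blast
    then show ?thesis by (simp add: induced_def)
  qed
  moreover have "R (emark (ball_network G u m) w e) (emark (ball_network H v m) (f w) (h e))"
    if "e \<in> edges (ball_network G u m)" "w \<in> ends (ball_network G u m) e" for e w
  proof -
    have "e \<in> edges ?G" "w \<in> ends ?G e" using that Esub by (auto simp: induced_def)
    then have "R (emark ?G w e) (emark ?H (f w) (h e))" using iso unfolding iso_via_def by blast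
    then show ?thesis by (simp add: induced_def)
  qed
  ultimately show ?thesis
    unfolding iso_via_def VG VH by blast
qed

lemma dist_less_add: "dist a b < \<delta> \<Longrightarrow> dist b c < \<epsilon> \<Longrightarrow> dist a c < \<delta> + \<epsilon>"
  for a b c :: "'x::metric_space"
  using dist_triangle[of a c b] by linarith

lemma close_rooted_refl: "\<epsilon> > 0 \<Longrightarrow> close_rooted n \<epsilon> x x"
  unfolding close_rooted_def
  by (rule exI[of _ "\<lambda>v. v"], rule exI[of _ "\<lambda>e. e"]) (simp add: iso_via_refl)

lemma close_rooted_trans:
  assumes "close_rooted n \<delta> x y" "close_rooted n \<epsilon> y z"
  shows "close_rooted n (\<delta> + \<epsilon>) x z"
proof -
  obtain f h where f: "iso_via (\<lambda>a b. dist a b < \<delta>) f h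
      (ball_network (net_of x) (root_of x) n) (ball_network (net_of y) (root_of y) n)"
    "f (root_of x) = root_of y" using assms(1) by (auto simp: close_rooted_def)
  obtain f' h' where f': "iso_via (\<lambda>a b. dist a b < \<epsilon>) f' h'
      (ball_network (net_of y) (root_of y) n) (ball_network (net_of z) (root_of z) n)"
    "f' (root_of y) = root_of z" using assms(2) by (auto simp: close_rooted_def)
  have "iso_via (\<lambda>a b. dist a b < \<delta> + \<epsilon>) (f' \<circ> f) (h' \<circ> h)
      (ball_network (net_of x) (root_of x) n) (ball_network (net_of z) (root_of z) n)"
    by (rule iso_via_trans[OF f(1) f'(1)])
       (auto intro: multigraph_induced network_multigraph network_net_of dist_less_add)
  then show ?thesis
    using f f' unfolding close_rooted_def by (metis comp_apply)
qed

lemma close_birooted_refl: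
  assumes "\<epsilon> > 0" "root2_of z \<in> gball (bi_net_of z) (root1_of z) n"
  shows "close_birooted n \<epsilon> z z"
  unfolding close_birooted_def
  by (rule conjI[OF assms(2)], rule exI[of _ "\<lambda>v. v"], rule exI[of _ "\<lambda>e. e"])
     (simp add: iso_via_refl assms(1))

lemma close_birooted_trans:
  assumes "close_birooted n \<delta> x y" "close_birooted n \<epsilon> y z"
  shows "close_birooted n (\<delta> + \<epsilon>) x z"
proof -
  obtain f h where f: "iso_via (\<lambda>a b. dist a b < \<delta>) f h
      (ball_network (bi_net_of x) (root1_of x) n) (ball_network (bi_net_of y) (root1_of y) n)"
    "f (root1_of x) = root1_of y" "f (root2_of x) = root2_of y"
    using assms(1) by (auto simp: close_birooted_def)
  obtain f' h' where f': "iso_via (\<lambda>a b. dist a b < \<epsilon>) f' h'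
      (ball_network (bi_net_of y) (root1_of y) n) (ball_network (bi_net_of z) (root1_of z) n)"
    "f' (root1_of y) = root1_of z" "f' (root2_of y) = root2_of z"
    using assms(2) by (auto simp: close_birooted_def)
  have "iso_via (\<lambda>a b. dist a b < \<delta> + \<epsilon>) (f' \<circ> f) (h' \<circ> h)
      (ball_network (bi_net_of x) (root1_of x) n) (ball_network (bi_net_of z) (root1_of z) n)"
    by (rule iso_via_trans[OF f(1) f'(1)])
       (auto intro: multigraph_induced network_multigraph network_bi_net_of dist_less_add)
  then show ?thesis
    using f f' assms(1) unfolding close_birooted_def by (metis comp_apply)
qed


lemma close_rooted_mono:
  assumes "close_rooted n \<delta> x y" "m \<le> n" "\<delta> \<le> \<epsilon>"
  shows "close_rooted m \<epsilon> x y"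
proof -
  obtain f h where f: "iso_via (\<lambda>a b. dist a b < \<delta>) f h
      (ball_network (net_of x) (root_of x) n) (ball_network (net_of y) (root_of y) n)"
    "f (root_of x) = root_of y" using assms(1) by (auto simp: close_rooted_def)
  have "iso_via (\<lambda>a b. dist a b < \<delta>) f h
      (ball_network (net_of x) (root_of x) m) (ball_network (net_of y) (root_of y) m)"
    by (rule iso_ball_restrict[OF f network_net_of root_of_in network_net_of root_of_in assms(2)])
  then have "iso_via (\<lambda>a b. dist a b < \<epsilon>) f h
      (ball_network (net_of x) (root_of x) m) (ball_network (net_of y) (root_of y) m)"
    by (rule iso_via_mono) (use assms(3) in linarith)
  then show ?thesis
    using f(2)  unfolding close_rooted_def by blast
qed

lemma close_birooted_mono:
  assumes "close_birooted n \<delta> x y" "m \<le> n" "\<delta> \<le> \<epsilon>"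
    and "root2_of x \<in> gball (bi_net_of x) (root1_of x) m"
  shows "close_birooted m \<epsilon> x y"
proof -
  obtain f h where f: "iso_via (\<lambda>a b. dist a b < \<delta>) f h
      (ball_network (bi_net_of x) (root1_of x) n) (ball_network (bi_net_of y) (root1_of y) n)"
    "f (root1_of x) = root1_of y" and f2: "f (root2_of x) = root2_of y"
    using assms(1) by (auto simp: close_birooted_def)
  have "iso_via (\<lambda>a b. dist a b < \<delta>) f h
      (ball_network (bi_net_of x) (root1_of x) m) (ball_network (bi_net_of y) (root1_of y) m)"
    by (rule iso_ball_restrict[OF f network_bi_net_of root1_of_in network_bi_net_of root1_of_in
          assms(2)])
  then have "iso_via (\<lambda>a b. dist a b < \<epsilon>) f h
      (ball_network (bi_net_of x) (root1_of x) m) (ball_network (bi_net_of y) (root1_of y) m)"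
    by (rule iso_via_mono) (use assms(3) in linarith)
  then show ?thesis
    using f(2) f2 assms(4) unfolding close_birooted_def by blast
qed

lemma root2_in_gball: "\<exists>n. root2_of z \<in> gball (bi_net_of z) (root1_of z) n"
proof -
  have "(root1_of z, root2_of z) \<in> (adjacent (bi_net_of z))\<^sup>*"
    using network_bi_net_of root1_of_in root2_of_in
    unfolding network_def connected_graph_def by blast
  then show ?thesis
    unfolding gball_def by (auto simp: rtrancl_power)
qed

instantiation rooted_net :: (metric_space) topological_space
begin

definition open_rooted_net :: "'a rooted_net set \<Rightarrow> bool" where
  "open_rooted_net U \<longleftrightarrow> (\<forall>x\<in>U. \<exists>n. \<exists>\<epsilon>>0. {y. close_rooted n \<epsilon> x y} \<subseteq> U)"

instance
proof
  show "open (UNIV :: 'a rooted_net set)"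
    unfolding open_rooted_net_def using zero_less_one by blast
next
  fix U V :: "'a rooted_net set"
  assume U: "open U" and V: "open V"
  show "open (U \<inter> V)"
    unfolding open_rooted_net_def
  proof
    fix x assume x: "x \<in> U \<inter> V"
    obtain n \<epsilon> where 1: "\<epsilon> > 0" "{y. close_rooted n \<epsilon> x y} \<subseteq> U"
      using U x unfolding open_rooted_net_def by blast
    obtain m \<delta> where 2: "\<delta> > 0" "{y. close_rooted m \<delta> x y} \<subseteq> V"
      using V x unfolding open_rooted_net_def by blast
    have "{y. close_rooted (max n m) (min \<epsilon> \<delta>) x y} \<subseteq> U \<inter> V"
    proof
      fix y assume "y \<in> {y. close_rooted (max n m) (min \<epsilon> \<delta>) x y}"
      then have "close_rooted n \<epsilon> x y" "close_rooted m \<delta> x y"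
        by (auto intro: close_rooted_mono)
      then show "y \<in> U \<inter> V" using 1 2 by auto
    qed
    moreover have "min \<epsilon> \<delta> > 0" using 1 2 by simp
    ultimately show "\<exists>n. \<exists>\<epsilon>>0. {y. close_rooted n \<epsilon> x y} \<subseteq> U \<inter> V" by blast
  qed
next
  fix K :: "'a rooted_net set set"
  assume "\<forall>S\<in>K. open S"
  then show "open (\<Union>K)"
    unfolding open_rooted_net_def by (meson Union_iff Union_upper order_trans)
qed

end

instantiation birooted_net :: (metric_space) topological_space
begin

definition open_birooted_net :: "'a birooted_net set \<Rightarrow> bool" where
  "open_birooted_net U \<longleftrightarrow>
     (\<forall>z\<in>U. \<exists>n. root2_of z \<in> gball (bi_net_of z) (root1_of z) n \<and>
        (\<exists>\<epsilon>>0. {w. close_birooted n \<epsilon> z w} \<subseteq> U))"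

instance
proof
  show "open (UNIV :: 'a birooted_net set)"
    unfolding open_birooted_net_def using zero_less_one root2_in_gball by blast
next
  fix U V :: "'a birooted_net set"
  assume U: "open U" and V: "open V"
  show "open (U \<inter> V)"
    unfolding open_birooted_net_def
  proof
    fix x assume x: "x \<in> U \<inter> V"
    let ?B = "gball (bi_net_of x) (root1_of x)"
    obtain n \<epsilon> where 1: "root2_of x \<in> ?B n" "\<epsilon> > 0" "{y. close_birooted n \<epsilon> x y} \<subseteq> U"
      using U x unfolding open_birooted_net_def by blast
    obtain m \<delta> where 2: "root2_of x \<in> ?B m" "\<delta> > 0" "{y. close_birooted m \<delta> x y} \<subseteq> V"
      using V x unfolding open_birooted_net_def by blast
    have "{y. close_birooted (max n m) (min \<epsilon> \<delta>) x y} \<subseteq> U \<inter> V"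
    proof
      fix y assume "y \<in> {y. close_birooted (max n m) (min \<epsilon> \<delta>) x y}"
      then have "close_birooted n \<epsilon> x y" "close_birooted m \<delta> x y"
        using 1 2 by (auto intro: close_birooted_mono)
      then show "y \<in> U \<inter> V" using 1 2 by auto
    qed
    moreover have "min \<epsilon> \<delta> > 0" using 1 2 by simp
    moreover have "root2_of x \<in> ?B (max n m)"
      using 1(1) gball_mono[of n "max n m"] by auto
    ultimately show "\<exists>n. root2_of x \<in> ?B n \<and> (\<exists>\<epsilon>>0. {y. close_birooted n \<epsilon> x y} \<subseteq> U \<inter> V)"
      by blast
  qed
next
  fix K :: "'a birooted_net set set"
  assume "\<forall>S\<in>K. open S"
  then show "open (\<Union>K)"
    unfolding open_birooted_net_def by (meson Union_iff Union_upper order_trans)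
qed

end

lemma close_rooted_nhd:
  assumes "\<epsilon> > 0"
  shows "\<exists>U. open U \<and> x \<in> U \<and> U \<subseteq> {y. close_rooted n \<epsilon> x y}"
proof -
  let ?N = "\<lambda>n \<epsilon> x. {y. close_rooted n \<epsilon> x y}"
  let ?U = "{y. \<exists>m. \<exists>\<delta>>0. ?N m \<delta> y \<subseteq> ?N n \<epsilon> x}"
  have "open ?U"
    unfolding open_rooted_net_def
  proof
    fix y assume "y \<in> ?U"
    then obtain m \<delta> where d: "\<delta> > 0" "?N m \<delta> y \<subseteq> ?N n \<epsilon> x" by blast
    have "?N m (\<delta>/2) y \<subseteq> ?U"
    proof
      fix z assume "z \<in> ?N m (\<delta>/2) y"
      then have "?N m (\<delta>/2) z \<subseteq> ?N m \<delta> y"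
        using close_rooted_trans[of m "\<delta>/2" y z "\<delta>/2"] by auto
      moreover have "\<delta>/2 > 0" using d by simp
      ultimately show "z \<in> ?U" using d(2) by blast
    qed
    moreover have "\<delta>/2 > 0" using d by simp
    ultimately show "\<exists>m. \<exists>\<delta>>0. ?N m \<delta> y \<subseteq> ?U" by blast
  qed
  moreover have "x \<in> ?U" using assms by blast
  moreover have "?U \<subseteq> ?N n \<epsilon> x" using close_rooted_refl by blast
  ultimately show ?thesis by blast
qed

lemma close_birooted_nhd:
  assumes "\<epsilon> > 0" "root2_of x \<in> gball (bi_net_of x) (root1_of x) n"
  shows "\<exists>U. open U \<and> x \<in> U \<and> U \<subseteq> {y. close_birooted n \<epsilon> x y}"
proof -
  let ?N = "\<lambda>n \<epsilon> x. {y. close_birooted n \<epsilon> x y}"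
  let ?R = "\<lambda>n x. root2_of x \<in> gball (bi_net_of x) (root1_of x) n"
  let ?U = "{y. \<exists>m. ?R m y \<and> (\<exists>\<delta>>0. ?N m \<delta> y \<subseteq> ?N n \<epsilon> x)}"
  have "open ?U"
    unfolding open_birooted_net_def
  proof
    fix y assume "y \<in> ?U"
    then obtain m \<delta> where d: "?R m y" "\<delta> > 0" "?N m \<delta> y \<subseteq> ?N n \<epsilon> x" by blast
    have "?N m (\<delta>/2) y \<subseteq> ?U"
    proof
      fix z assume z: "z \<in> ?N m (\<delta>/2) y"
      then have "?N m (\<delta>/2) z \<subseteq> ?N m \<delta> y"
        using close_birooted_trans[of m "\<delta>/2" y z "\<delta>/2"] by auto
      moreover have "\<delta>/2 > 0" using d by simp
      moreover have "?R m z"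
      proof -
        obtain f h where f: "iso_via (\<lambda>a b. dist a b < \<delta>/2) f h
            (ball_network (bi_net_of y) (root1_of y) m) (ball_network (bi_net_of z) (root1_of z) m)"
          "f (root1_of y) = root1_of z" "f (root2_of y) = root2_of z"
          using z by (auto simp: close_birooted_def)
        show ?thesis
          using iso_ball_gball[OF f(1,2) network_bi_net_of root1_of_in order_refl d(1)] f(3) by simp
      qed
      ultimately show "z \<in> ?U" using d(3) by blast
    qed
    moreover have "\<delta>/2 > 0" using d by simp
    ultimately show "\<exists>m. ?R m y \<and> (\<exists>\<delta>>0. ?N m \<delta> y \<subseteq> ?U)" using d(1) by blast
  qed
  moreover have "x \<in> ?U" using assms by blast
  moreover have "?U \<subseteq> ?N n \<epsilon> x" using close_birooted_refl by blast
  ultimately show ?thesis by blast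
qed

lemma tendsto_rooted_net_iff:
  "(X \<longlongrightarrow> x) F \<longleftrightarrow> (\<forall>n. \<forall>\<epsilon>>0. eventually (\<lambda>i. close_rooted n \<epsilon> x (X i)) F)"
proof
  assume lim: "(X \<longlongrightarrow> x) F"
  show "\<forall>n. \<forall>\<epsilon>>0. eventually (\<lambda>i. close_rooted n \<epsilon> x (X i)) F"
  proof (intro allI impI)
    fix n and \<epsilon> :: real assume "\<epsilon> > 0"
    then obtain U where U: "open U" "x \<in> U" "U \<subseteq> {y. close_rooted n \<epsilon> x y}"
      using close_rooted_nhd by blast
    show "eventually (\<lambda>i. close_rooted n \<epsilon> x (X i)) F"
      using topological_tendstoD[OF lim U(1,2)] by eventually_elim (use U in auto)
  qed
next
  assume *: "\<forall>n. \<forall>\<epsilon>>0. eventually (\<lambda>i. close_rooted n \<epsilon> x (X i)) F"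
  show "(X \<longlongrightarrow> x) F"
  proof (rule topological_tendstoI)
    fix U assume "open U" "x \<in> U"
    then obtain n \<epsilon> where U: "\<epsilon> > 0" "{y. close_rooted n \<epsilon> x y} \<subseteq> U"
      unfolding open_rooted_net_def by blast
    from * U(1) have "eventually (\<lambda>i. close_rooted n \<epsilon> x (X i)) F" by blast
    then show "eventually (\<lambda>i. X i \<in> U) F"
      by eventually_elim (use U in auto)
  qed
qed

lemma tendsto_birooted_net_iff:
  "(Z \<longlongrightarrow> z) F \<longleftrightarrow>
     (\<forall>n. root2_of z \<in> gball (bi_net_of z) (root1_of z) n \<longrightarrow>
        (\<forall>\<epsilon>>0. eventually (\<lambda>i. close_birooted n \<epsilon> z (Z i)) F))"
proof
  assume lim: "(Z \<longlongrightarrow> z) F"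
  show "\<forall>n. root2_of z \<in> gball (bi_net_of z) (root1_of z) n \<longrightarrow>
        (\<forall>\<epsilon>>0. eventually (\<lambda>i. close_birooted n \<epsilon> z (Z i)) F)"
  proof (intro allI impI)
    fix n and \<epsilon> :: real
    assume "root2_of z \<in> gball (bi_net_of z) (root1_of z) n" "\<epsilon> > 0"
    then obtain U where U: "open U" "z \<in> U" "U \<subseteq> {w. close_birooted n \<epsilon> z w}"
      using close_birooted_nhd by blast
    show "eventually (\<lambda>i. close_birooted n \<epsilon> z (Z i)) F"
      using topological_tendstoD[OF lim U(1,2)] by eventually_elim (use U in auto)
  qed
next
  assume *: "\<forall>n. root2_of z \<in> gball (bi_net_of z) (root1_of z) n \<longrightarrow>
        (\<forall>\<epsilon>>0. eventually (\<lambda>i. close_birooted n \<epsilon> z (Z i)) F)"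
  show "(Z \<longlongrightarrow> z) F"
  proof (rule topological_tendstoI)
    fix U assume "open U" "z \<in> U"
    then obtain n \<epsilon> where U: "root2_of z \<in> gball (bi_net_of z) (root1_of z) n" "\<epsilon> > 0"
      "{w. close_birooted n \<epsilon> z w} \<subseteq> U"
      unfolding open_birooted_net_def by blast
    from * U(1,2) have "eventually (\<lambda>i. close_birooted n \<epsilon> z (Z i)) F" by blast
    then show "eventually (\<lambda>i. Z i \<in> U) F"
      by eventually_elim (use U in auto)
  qed
qed


section \<open>Random rooted networks and unimodularity\<close>

definition random_rooted_net :: "'x::polish_space rooted_net measure \<Rightarrow> bool" where
  "random_rooted_net P \<longleftrightarrow> prob_space P \<and> sets P = sets borel"

text \<open>
  The mass sent from \<open>u\<close> to the vertices in \<open>W\<close>, and received by \<open>u\<close> from the vertices in \<open>W\<close>;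
  these are \<open>g\<^sub>G\<^sup>+(u)\<close> and \<open>g\<^sub>G\<^sup>-(u)\<close> for \<open>W = verts G\<close>.
\<close>

definition mass_out :: "('x birooted_net \<Rightarrow> real) \<Rightarrow> 'x network \<Rightarrow> nat \<Rightarrow> nat set \<Rightarrow> ennreal" where
  "mass_out g G u W = (\<integral>\<^sup>+v. ennreal (g (bnet G u v)) \<partial>count_space W)"

definition mass_in :: "('x birooted_net \<Rightarrow> real) \<Rightarrow> 'x network \<Rightarrow> nat \<Rightarrow> nat set \<Rightarrow> ennreal" where
  "mass_in g G u W = (\<integral>\<^sup>+v. ennreal (g (bnet G v u)) \<partial>count_space W)"

definition root_mass_in :: "('x birooted_net \<Rightarrow> real) \<Rightarrow> 'x rooted_net \<Rightarrow> ennreal" where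
  "root_mass_in g x = mass_in g (net_of x) (root_of x) (verts (net_of x))"

definition root_mass_out :: "('x birooted_net \<Rightarrow> real) \<Rightarrow> 'x rooted_net \<Rightarrow> ennreal" where
  "root_mass_out g x = mass_out g (net_of x) (root_of x) (verts (net_of x))"

definition unimodular :: "'x::polish_space rooted_net measure \<Rightarrow> bool" where
  "unimodular P \<longleftrightarrow> random_rooted_net P \<and>
     (\<forall>g\<in>borel_measurable borel. (\<forall>z. 0 \<le> g z) \<longrightarrow>
        (\<integral>\<^sup>+x. root_mass_out g x \<partial>P) = (\<integral>\<^sup>+x. root_mass_in g x \<partial>P))"

lemma bnet_iso:
  assumes "iso_via (=) f h G H" "network G" "network H" "u \<in> verts G" "v \<in> verts G"
  shows "bnet H (f u) (f v) = bnet G u v"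
proof -
  have "f u \<in> verts H" "f v \<in> verts H"
    using assms by (auto simp: iso_via_def bij_betw_def)
  then show ?thesis
    using bnet_eq_iff[of G u v H "f u" "f v"] assms by metis
qed

lemma mass_iso:
  assumes iso: "iso_via (=) f h G H" and nw: "network G" "network H"
    and u: "u \<in> verts G" and W: "W \<subseteq> verts G"
  shows "mass_out g H (f u) (f ` W) = mass_out g G u W"
    and "mass_in g H (f u) (f ` W) = mass_in g G u W"
proof -
  have "inj_on f (verts G)" using iso by (auto simp: iso_via_def bij_betw_def)
  then have bij: "bij_betw f W (f ` W)"
    using W by (auto intro: inj_on_subset simp: bij_betw_def)
  have "mass_out g H (f u) (f ` W) = (\<integral>\<^sup>+v. ennreal (g (bnet H (f u) (f v))) \<partial>count_space W)"
    unfolding mass_out_def by (rule nn_integral_bij_count_space[OF bij, symmetric])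
  also have "\<dots> = mass_out g G u W"
    unfolding mass_out_def
    by (rule nn_integral_cong) (use bnet_iso[OF iso nw u] W in auto)
  finally show "mass_out g H (f u) (f ` W) = mass_out g G u W" .
  have "mass_in g H (f u) (f ` W) = (\<integral>\<^sup>+v. ennreal (g (bnet H (f v) (f u))) \<partial>count_space W)"
    unfolding mass_in_def by (rule nn_integral_bij_count_space[OF bij, symmetric])
  also have "\<dots> = mass_in g G u W"
    unfolding mass_in_def
    by (rule nn_integral_cong) (use bnet_iso[OF iso nw _ u] W in auto)
  finally show "mass_in g H (f u) (f ` W) = mass_in g G u W" .
qed

lemma root_mass_rnet:
  assumes "network G" "u \<in> verts G"
  shows "root_mass_out g (rnet G u) = mass_out g G u (verts G)"
    and "root_mass_in g (rnet G u) = mass_in g G u (verts G)"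
proof -
  let ?H = "net_of (rnet G u)" and ?v = "root_of (rnet G u)"
  have "rnet G u = rnet ?H ?v" by simp
  then obtain f h where f: "iso_via (=) f h G ?H" "f u = ?v"
    using assms network_net_of root_of_in by (subst (asm) rnet_eq_iff) auto
  have im: "f ` verts G = verts ?H" using f by (auto simp: iso_via_def bij_betw_def)
  note m = mass_iso[OF f(1) assms(1) network_net_of assms(2) order_refl, unfolded im f(2)]
  show "root_mass_out g (rnet G u) = mass_out g G u (verts G)"
    unfolding root_mass_out_def by (rule m)
  show "root_mass_in g (rnet G u) = mass_in g G u (verts G)"
    unfolding root_mass_in_def by (rule m)
qed


section \<open>Unrooted and invariant events\<close>

definition unrooted_algebra :: "'x::polish_space net measure" where
  "unrooted_algebra = sigma UNIV {B. unroot -` B \<in> sets borel}"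

lemma sets_unrooted_algebra: "sets unrooted_algebra = {B. unroot -` B \<in> sets borel}"
proof -
  have "sigma_algebra UNIV {B :: 'a net set. unroot -` B \<in> sets borel}"
  proof (rule sigma_algebra_iff2[THEN iffD2], intro conjI ballI allI impI)
    fix A :: "'a net set" assume "A \<in> {B. unroot -` B \<in> sets borel}"
    then have "- (unroot -` A) \<in> sets borel" by (simp add: borel_comp)
    moreover have "unroot -` (UNIV - A) = - (unroot -` A)" by blast
    ultimately show "UNIV - A \<in> {B. unroot -` B \<in> sets borel}" by simp
  next
    fix A :: "nat \<Rightarrow> 'a net set" assume "range A \<subseteq> {B. unroot -` B \<in> sets borel}"
    then show "(\<Union>i. A i) \<in> {B. unroot -` B \<in> sets borel}"
      by (auto simp: vimage_UN)
  qed auto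
  then show ?thesis
    unfolding unrooted_algebra_def by (rule sigma_algebra.sets_measure_of_eq)
qed

definition unrooted_law :: "'x::polish_space rooted_net measure \<Rightarrow> 'x net measure" where
  "unrooted_law P = distr P unrooted_algebra unroot"

definition invariant_event :: "'x rooted_net set \<Rightarrow> bool" where
  "invariant_event A \<longleftrightarrow>
     (\<forall>G u v. network G \<and> u \<in> verts G \<and> v \<in> verts G \<and> rnet G u \<in> A \<longrightarrow> rnet G v \<in> A)"

definition invariant_algebra :: "'x::polish_space rooted_net measure" where
  "invariant_algebra = sigma UNIV {A \<in> sets borel. invariant_event A}"

lemma sets_invariant_algebra:
  "sets invariant_algebra = {A \<in> sets borel. invariant_event A}"
proof -
  have "sigma_algebra UNIV {A :: 'a rooted_net set. A \<in> sets borel \<and> invariant_event A}"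
  proof (rule sigma_algebra_iff2[THEN iffD2], intro conjI ballI allI impI)
    fix A :: "'a rooted_net set" assume A: "A \<in> {A. A \<in> sets borel \<and> invariant_event A}"
    then have "UNIV - A \<in> sets borel"
      using sets.compl_sets[of A borel] unfolding space_borel by blast
    moreover have "invariant_event (UNIV - A)"
      using A unfolding invariant_event_def by blast
    ultimately show "UNIV - A \<in> {A. A \<in> sets borel \<and> invariant_event A}" by simp
  next
    fix A :: "nat \<Rightarrow> 'a rooted_net set"
    assume A: "range A \<subseteq> {A. A \<in> sets borel \<and> invariant_event A}"
    then have "(\<Union>i. A i) \<in> sets borel" by (intro sets.countable_UN) blast
    moreover have "invariant_event (\<Union>i. A i)"
      unfolding invariant_event_def
    proof (intro allI impI, elim conjE)
      fix G u v
      assume G: "network G" "u \<in> verts G" "v \<in> verts G" and U: "rnet G u \<in> (\<Union>i. A i)"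
      from U obtain i where i: "rnet G u \<in> A i" by (rule UN_E)
      have "invariant_event (A i)" using A by blast
      then have "rnet G v \<in> A i" using G i unfolding invariant_event_def by iprover
      then show "rnet G v \<in> (\<Union>i. A i)" by (rule UN_I[OF UNIV_I])
    qed
    ultimately show "(\<Union>i. A i) \<in> {A. A \<in> sets borel \<and> invariant_event A}" by simp
  qed (auto simp: invariant_event_def)
  then show ?thesis
    unfolding invariant_algebra_def by (rule sigma_algebra.sets_measure_of_eq)
qed

lemma subalgebra_invariant:
  "random_rooted_net P \<Longrightarrow> subalgebra P invariant_algebra"
  using sets_eq_imp_space_eq[of P borel]
  by (auto simp: subalgebra_def random_rooted_net_def sets_invariant_algebra)
     (simp add: invariant_algebra_def space_measure_of_conv)


section \<open>Extensions and unimodularizations\<close>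

definition covariant_subset :: "('x::polish_space network \<Rightarrow> nat set) \<Rightarrow> bool" where
  "covariant_subset S \<longleftrightarrow>
     (\<forall>G. network G \<longrightarrow> S G \<subseteq> verts G) \<and>
     (\<forall>G u H v. rooted_iso (G, u) (H, v) \<longrightarrow> (u \<in> S G \<longleftrightarrow> v \<in> S H)) \<and>
     {x. root_of x \<in> S (net_of x)} \<in> sets borel"

text \<open>
  The extending network may have a larger mark space \<open>'x\<close> than the extended one: the surjective Borel
  map \<open>p\<close> reads off the mark in \<open>'y\<close> from a mark in \<open>'x\<close>.  It is the identity when the mark spaces
  agree, a projection when \<open>'x\<close> adds components to the marks, and a retraction
  onto \<open>'y\<close> when \<open>'y\<close> is a closed subspace of \<open>'x\<close>.  The value of \<open>rnet\<close> at a disconnected subnetwork, or at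
  one that does not contain the root, is an irrelevant constant, since this has probability zero.
\<close>

definition extension ::
  "('x::polish_space \<Rightarrow> 'y::polish_space) \<Rightarrow> 'y rooted_net measure \<Rightarrow>
   'x rooted_net measure \<Rightarrow> ('x network \<Rightarrow> nat set) \<Rightarrow> bool" where
  "extension p P0 P S \<longleftrightarrow>
     p \<in> borel_measurable borel \<and> surj p \<and>
     unimodular P0 \<and> random_rooted_net P \<and> covariant_subset S \<and>
     (AE x in P. root_of x \<in> S (net_of x)) \<and>
     (AE x in P. connected_graph (induced (net_of x) (S (net_of x)))) \<and>
     distr P borel (\<lambda>x. rnet (map_marks p (induced (net_of x) (S (net_of x)))) (root_of x)) = P0"

definition proper_extension ::
  "('x::polish_space \<Rightarrow> 'y::polish_space) \<Rightarrow> 'y rooted_net measure \<Rightarrow>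
   'x rooted_net measure \<Rightarrow> ('x network \<Rightarrow> nat set) \<Rightarrow> bool" where
  "proper_extension p P0 P S \<longleftrightarrow> extension p P0 P S \<and>
     (\<forall>g\<in>borel_measurable borel. (\<forall>z. 0 \<le> g z) \<longrightarrow>
        (\<integral>\<^sup>+x. mass_out g (net_of x) (root_of x) (S (net_of x)) \<partial>P) =
        (\<integral>\<^sup>+x. mass_in g (net_of x) (root_of x) (S (net_of x)) \<partial>P))"

definition markovian_to ::
  "('x birooted_net \<Rightarrow> real) \<Rightarrow> ('x network \<Rightarrow> nat set) \<Rightarrow> 'x network \<Rightarrow> bool" where
  "markovian_to T S G \<longleftrightarrow>
     (\<forall>v\<in>verts G. mass_out T G v (verts G) = 1 \<and> (\<forall>w\<in>verts G - S G. T (bnet G v w) = 0))"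

definition strong_unimodularization ::
  "'x::polish_space rooted_net measure \<Rightarrow> 'x rooted_net measure \<Rightarrow> bool" where
  "strong_unimodularization P Q \<longleftrightarrow> unimodular Q \<and> unrooted_law Q = unrooted_law P"

definition weak_unimodularization ::
  "'x::polish_space rooted_net measure \<Rightarrow> 'x rooted_net measure \<Rightarrow> bool" where
  "weak_unimodularization P Q \<longleftrightarrow> unimodular Q \<and>
     absolutely_continuous (unrooted_law P) (unrooted_law Q) \<and>
     absolutely_continuous (unrooted_law Q) (unrooted_law P)"

definition can_be_unimodularized :: "'x::polish_space rooted_net measure \<Rightarrow> bool" where
  "can_be_unimodularized P \<longleftrightarrow>
     (\<exists>Q. weak_unimodularization P Q \<or> strong_unimodularization P Q)"

definition mass_in_from ::
  "('x birooted_net \<Rightarrow> real) \<Rightarrow> 'x rooted_net set \<Rightarrow> 'x rooted_net \<Rightarrow> ennreal" where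
  "mass_in_from T A x = (\<integral>\<^sup>+v. ennreal (T (bnet (net_of x) v (root_of x))) *
     indicator A (rnet (net_of x) v) \<partial>count_space (verts (net_of x)))"

text \<open>
  \<open>measure_of\<close> yields the null measure if the given set function is not countably additive; so a
  probability measure of this form is given by the displayed formula.
\<close>

definition weak_reroot ::
  "('x::polish_space birooted_net \<Rightarrow> real) \<Rightarrow> 'x rooted_net measure \<Rightarrow> 'x rooted_net measure" where
  "weak_reroot T P = measure_of UNIV (sets borel)
     (\<lambda>A. 1 / (\<integral>\<^sup>+x. root_mass_in T x \<partial>P) * (\<integral>\<^sup>+x. mass_in_from T A x \<partial>P))"

definition strong_reroot ::
  "('x::polish_space birooted_net \<Rightarrow> real) \<Rightarrow> 'x rooted_net measure \<Rightarrow> 'x rooted_net measure" where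
  "strong_reroot T P = measure_of UNIV (sets borel)
     (\<lambda>A. \<integral>\<^sup>+x. 1 / nn_cond_exp P invariant_algebra (root_mass_in T) x * mass_in_from T A x \<partial>P)"

end

theory Submission
  imports Defs
begin

text \<open>
  Functions of birooted networks are treated as kernels, that is, as matrices indexed by the vertices
  of a network.  The product of two kernels and the row sums of a kernel are again Borel functions
  (\<open>measurable_kernel_product\<close>, \<open>measurable_row_sum\<close>), so that the transport identities can be
  applied to every kernel built by matrix algebra.

  Call a finite measure \<open>balanced\<close> on a Borel set \<open>A\<close> of rooted networks if it lives on \<open>A\<close> and obeys
  the mass transport principle for mass exchanged between vertices \<open>v\<close> with \<open>[G, v] \<in> A\<close>.
  Unimodularity is balance on the set of all rooted networks, and a proper extension is balanced on the
  vertices of \<open>S\<close>.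

  \<^emph>\<open>Rerooting.\<close>  Move the root \<open>o\<close> to \<open>v\<close> with intensity \<open>T(v, o)\<close>, weighted by an invariant \<open>h\<close>.  Let \<open>g\<close>
  be any kernel, and send the mass \<open>h(o)\<close> times the \<open>(o, u)\<close> entry of the matrix \<open>T\<^sup>t g T\<close>
  from \<open>o\<close> to \<open>u\<close>.  Since the rows of \<open>T\<close> sum to 1 and \<open>T\<close> only charges vertices of \<open>S\<close>, balance on \<open>S\<close>
  for this mass says exactly that the rerooted measure is balanced for \<open>g\<close> (\<open>balanced_reroot\<close>).  On invariant
  events the rerooted measure has density \<open>h E[M | I]\<close>.  Moreover \<open>E[M | I] > 0\<close> almost surely, because
  the root sends mass 1 into \<open>S\<close> (\<open>mean_mass_positive\<close>).  So a constant \<open>h\<close> gives a weak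
  unimodularization if \<open>E[M] < \<infinity>\<close>, and \<open>h = 1 / E[M | I]\<close> gives a strong one if \<open>E[M | I] < \<infinity>\<close>.

  \<^emph>\<open>Comparison.\<close>  Two measures that are balanced on the same set have a Hahn decomposition into
  \<^emph>\<open>invariant\<close> sets (\<open>balanced_Hahn_decomposition\<close>): on the networks having vertices on both sides of an
  arbitrary Hahn decomposition, mass sent from one side to the other shows that the two measures agree.
  It follows that a unimodular measure is determined by its values on invariant events
  (\<open>unimodular_eqI\<close>), which is uniqueness.

  \<^emph>\<open>Necessity.\<close>  Let \<open>Q\<close> be a weak unimodularization.  Compare \<open>P\<close> with \<open>n\<close> times the restriction of \<open>Q\<close>
  to roots in \<open>S\<close>; the latter is balanced on \<open>S\<close> as well.  On the invariant set where \<open>P\<close> is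
  the smaller one, the mean of \<open>M\<close> is at most \<open>n E\<^sub>Q[M] = n\<close>, hence \<open>E[M | I] < \<infinity>\<close> there.  The set left over
  for all \<open>n\<close> is null for the restriction of \<open>Q\<close>, hence for \<open>Q\<close>, hence for \<open>P\<close> (\<open>mean_mass_finite\<close>).
\<close>

section \<open>Restricting approximate isomorphisms of balls\<close>

lemma iso_induced_gball:
  assumes iso: "iso_via R f h (induced G X) (induced H Y)"
    and sub: "gball G w m \<subseteq> X" and v: "v \<in> gball G w m"
  shows "f v \<in> gball H (f w) m"
proof -
  have "(f w, f v) \<in> adjacent H ^^ k" if "(w, v) \<in> adjacent G ^^ k" "k \<le> m" for k v
    using that
  proof (induction k arbitrary: v)
    case 0
    then show ?case by auto
  next
    case (Suc k)
    then obtain v' where v': "(w, v') \<in> adjacent G ^^ k" "(v', v) \<in> adjacent G" by auto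
    then obtain e where e: "e \<in> edges G" "ends G e = {v', v}" by (auto simp: adjacent_def)
    have "v' \<in> X" "v \<in> X"
      using Suc.prems v'(1) sub unfolding gball_def by (blast intro: Suc_leD)+
    then have "e \<in> edges (induced G X)" using e by (simp add: induced_def)
    then have "h e \<in> edges (induced H Y)"
      "ends (induced H Y) (h e) = f ` ends (induced G X) e"
      using iso by (auto simp: iso_via_def bij_betw_def)
    then have "(f v', f v) \<in> adjacent H"
      using e by (auto simp: adjacent_def induced_def)
    then show ?case using Suc v' by auto
  qed
  then show ?thesis using v unfolding gball_def by blast
qed

lemma iso_induced_restrict:
  assumes iso: "iso_via R f h (induced G X) (induced H Y)"
    and X: "X \<subseteq> verts G" and Y: "Y \<subseteq> verts H" and W: "W \<subseteq> X" and im: "f ` W = W'"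
  shows "iso_via R f h (induced G W) (induced H W')"
proof -
  have f: "bij_betw f X Y"
    using iso X Y by (simp add: iso_via_def induced_def Int_absorb1)
  have h: "bij_betw h {e \<in> edges G. ends G e \<subseteq> X} {e \<in> edges H. ends H e \<subseteq> Y}"
    using iso by (simp add: iso_via_def induced_def)
  have ends: "ends H (h e) = f ` ends G e" if "e \<in> edges G" "ends G e \<subseteq> X" for e
    using iso that by (auto simp: iso_via_def induced_def)
  have W': "W' \<subseteq> Y" using f W im by (auto simp: bij_betw_def)
  have reflect: "ends G e \<subseteq> W" if "e \<in> edges G" "ends G e \<subseteq> X" "ends H (h e) \<subseteq> W'" for e
  proof
    fix v assume v: "v \<in> ends G e"
    then have "f v \<in> f ` W" using that ends im by auto
    then show "v \<in> W"
      using f W v that(2) by (auto simp: bij_betw_def inj_on_def subset_iff)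
  qed
  have "bij_betw f (verts (induced G W)) (verts (induced H W'))"
  proof -
    have "verts G \<inter> W = W" "verts H \<inter> W' = W'" using X Y W W' by auto
    then show ?thesis using f W im by (auto simp: induced_def bij_betw_def intro: inj_on_subset)
  qed
  moreover have "bij_betw h (edges (induced G W)) (edges (induced H W'))"
  proof -
    have "edges (induced G W) \<subseteq> {e \<in> edges G. ends G e \<subseteq> X}" using W by (auto simp: induced_def)
    then have "inj_on h (edges (induced G W))"
      using h by (auto simp: bij_betw_def intro: inj_on_subset)
    moreover have "h ` edges (induced G W) = edges (induced H W')"
    proof (intro equalityI subsetI)
      fix d assume "d \<in> h ` edges (induced G W)"
      then obtain e where e: "e \<in> edges G" "ends G e \<subseteq> W" "d = h e" by (auto simp: induced_def)
      then have "h e \<in> edges H" using h W by (auto simp: bij_betw_def)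
      moreover have "ends H (h e) \<subseteq> W'" using ends[of e] e W im by auto
      ultimately show "d \<in> edges (induced H W')" using e by (auto simp: induced_def)
    next
      fix d assume d: "d \<in> edges (induced H W')"
      then have "d \<in> {e \<in> edges H. ends H e \<subseteq> Y}" using W' by (auto simp: induced_def)
      then obtain e where e: "e \<in> edges G" "ends G e \<subseteq> X" "d = h e"
        using h unfolding bij_betw_def by blast
      then have "ends G e \<subseteq> W" using reflect[of e] d by (auto simp: induced_def)
      then show "d \<in> h ` edges (induced G W)" using e by (auto simp: induced_def)
    qed
    ultimately show ?thesis by (simp add: bij_betw_def)
  qed
  ultimately show ?thesis
    using iso W unfolding iso_via_def by (auto simp: induced_def)
qed

lemma gball_trans: "v \<in> gball G u k \<Longrightarrow> w \<in> gball G v m \<Longrightarrow> w \<in> gball G u (k + m)"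
  unfolding gball_def mem_Collect_eq
  by (metis add_mono relpow_add relcomp.relcompI)

lemma gball_centre: "u \<in> gball G u n"
  unfolding gball_def by (auto intro!: exI[of _ 0])

lemma iso_induced_ball:
  assumes iso: "iso_via R f h (induced G X) (induced H Y)"
    and X: "X \<subseteq> verts G" and Y: "Y \<subseteq> verts H" and G: "multigraph G"
    and bX: "gball G w m \<subseteq> X" and bY: "gball H (f w) m \<subseteq> Y"
  shows "iso_via R f h (ball_network G w m) (ball_network H (f w) m)"
proof (rule iso_induced_restrict[OF iso X Y bX])
  have VX: "verts (induced G X) = X" using X by (auto simp: induced_def)
  have VY: "verts (induced H Y) = Y" using Y by (auto simp: induced_def)
  have f: "bij_betw f X Y" using iso by (simp add: iso_via_def VX VY)
  let ?f = "inv_into X f"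
  have inv: "iso_via (\<lambda>a b. R b a) ?f (inv_into (edges (induced G X)) h) (induced H Y) (induced G X)"
    using iso_via_sym[OF iso multigraph_induced[OF G]] unfolding VX .
  have w: "w \<in> X" using bX gball_centre by auto
  then have fw: "?f (f w) = w" using f by (simp add: bij_betw_inv_into_left)
  show "f ` gball G w m = gball H (f w) m"
  proof (intro equalityI subsetI)
    fix v assume "v \<in> f ` gball G w m"
    then show "v \<in> gball H (f w) m" using iso_induced_gball[OF iso bX] by auto
  next
    fix v assume v: "v \<in> gball H (f w) m"
    then have "?f v \<in> gball G w m" using iso_induced_gball[OF inv bY v] fw by simp
    moreover have "f (?f v) = v" using v bY f by (auto simp: bij_betw_inv_into_right)
    ultimately show "v \<in> f ` gball G w m" by force
  qed
qed

text \<open>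
  The topology on birooted networks uses balls about the first root only.  This lemma gives access to balls with
  other centres, as far as the triangle inequality keeps them inside, and so it is the source of all
  continuity statements below.
\<close>
lemma iso_ball_recentre:
  assumes iso: "iso_via R f h (ball_network G u n) (ball_network H u' n)" and fu: "f u = u'"
    and nw: "network G" "u \<in> verts G" "network H" "u' \<in> verts H"
    and w: "w \<in> gball G u k" and n: "k + m \<le> n"
  shows "iso_via R f h (ball_network G w m) (ball_network H (f w) m)"
proof (rule iso_induced_ball[OF iso])
  show "gball G u n \<subseteq> verts G" "gball H u' n \<subseteq> verts H" "multigraph G"
    using nw by (auto simp: gball_subset network_multigraph)
  have "gball G u k \<subseteq> gball G u n" using n by (intro gball_mono) simp
  then have "f w \<in> gball H u' k"
    using iso_ball_gball[OF iso fu nw(1,2) _ w] n by simp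
  then show "gball G w m \<subseteq> gball G u n" "gball H (f w) m \<subseteq> gball H u' n"
    using gball_trans[OF w] gball_trans[of "f w" H u' k] gball_mono[OF n] by blast+
qed

lemma induced_verts: "multigraph G \<Longrightarrow> induced G (verts G) = G"
  by (cases G) (auto simp: induced_def multigraph_def)

lemma iso_ball:
  assumes "iso_via R f h G H" "multigraph G" "multigraph H" "u \<in> verts G"
  shows "iso_via R f h (ball_network G u m) (ball_network H (f u) m)"
proof -
  have "f u \<in> verts H" using assms by (auto simp: iso_via_def bij_betw_def)
  then show ?thesis
    using iso_induced_ball[of R f h G "verts G" H "verts H" u m] assms
    by (simp add: induced_verts gball_subset)
qed

text \<open>
  Closeness is defined through chosen representatives of the classes; composing with isomorphisms to the
  representatives shows that any representatives will do.
\<close>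
lemma close_birooted_bnet:
  fixes G H :: "'x::metric_space network"
  assumes nw: "network G" "network H"
    and V: "u \<in> verts G" "v \<in> verts G" "u' \<in> verts H" "v' \<in> verts H"
    and v: "v \<in> gball G u n"
    and iso: "iso_via (\<lambda>a b. dist a b < \<epsilon>) f h (ball_network G u n) (ball_network H u' n)"
    and f: "f u = u'" "f v = v'"
  shows "close_birooted n \<epsilon> (bnet G u v) (bnet H u' v')"
proof -
  let ?z = "bnet G u v" and ?w = "bnet H u' v'"
  let ?G = "bi_net_of ?z" and ?H = "bi_net_of ?w"
  note r = network_bi_net_of root1_of_in root2_of_in
  have "bnet ?G (root1_of ?z) (root2_of ?z) = bnet G u v" by simp
  then obtain a b where a: "iso_via (=) a b ?G G" "a (root1_of ?z) = u" "a (root2_of ?z) = v"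
    using bnet_eq_iff[OF r nw(1) V(1,2)] by metis
  have "bnet H u' v' = bnet ?H (root1_of ?w) (root2_of ?w)" by simp
  then obtain c d where c: "iso_via (=) c d H ?H" "c u' = root1_of ?w" "c v' = root2_of ?w"
    using bnet_eq_iff[OF nw(2) V(3,4) r] by metis
  note m = network_multigraph[OF network_bi_net_of] network_multigraph[OF nw(1)]
    network_multigraph[OF nw(2)]
  have 1: "iso_via (=) a b (ball_network ?G (root1_of ?z) n) (ball_network G u n)"
    using iso_ball[OF a(1) m(1,2) root1_of_in, of n] a by simp
  have 2: "iso_via (=) c d (ball_network H u' n) (ball_network ?H (root1_of ?w) n)"
    using iso_ball[OF c(1) m(3,1) V(3), of n] c by simp
  have 12: "iso_via (\<lambda>a b. dist a b < \<epsilon>) (f \<circ> a) (h \<circ> b)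
      (ball_network ?G (root1_of ?z) n) (ball_network H u' n)"
    by (rule iso_via_trans[OF 1 iso]) (auto intro: multigraph_induced m)
  have 3: "iso_via (\<lambda>a b. dist a b < \<epsilon>) (c \<circ> (f \<circ> a)) (d \<circ> (h \<circ> b))
      (ball_network ?G (root1_of ?z) n) (ball_network ?H (root1_of ?w) n)"
    by (rule iso_via_trans[OF 12 2]) (auto intro: multigraph_induced m)
  have "root2_of ?z \<in> gball ?G (root1_of ?z) n"
  proof -
    have "bnet G u v = bnet ?G (root1_of ?z) (root2_of ?z)" by simp
    then obtain a' b' where a': "iso_via (=) a' b' G ?G" "a' u = root1_of ?z" "a' v = root2_of ?z"
      using bnet_eq_iff[OF nw(1) V(1,2) r] by metis
    have "iso_via (=) a' b' (induced G (verts G)) (induced ?G (verts ?G))"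
      using a'(1) by (simp add: induced_verts network_multigraph network_bi_net_of nw)
    from iso_induced_gball[OF this _ v] show ?thesis
      using a' nw V by (simp add: gball_subset network_multigraph)
  qed
  then show ?thesis
    unfolding close_birooted_def using 3 a c f by (metis comp_apply)
qed

lemma close_rooted_rnet:
  fixes G H :: "'x::metric_space network"
  assumes nw: "network G" "network H" and V: "u \<in> verts G" "u' \<in> verts H"
    and iso: "iso_via (\<lambda>a b. dist a b < \<epsilon>) f h (ball_network G u n) (ball_network H u' n)"
    and f: "f u = u'"
  shows "close_rooted n \<epsilon> (rnet G u) (rnet H u')"
proof -
  let ?z = "rnet G u" and ?w = "rnet H u'"
  let ?G = "net_of ?z" and ?H = "net_of ?w"
  note r = network_net_of root_of_in
  have "rnet ?G (root_of ?z) = rnet G u" by simp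
  then obtain a b where a: "iso_via (=) a b ?G G" "a (root_of ?z) = u"
    using rnet_eq_iff[OF r nw(1) V(1)] by metis
  have "rnet H u' = rnet ?H (root_of ?w)" by simp
  then obtain c d where c: "iso_via (=) c d H ?H" "c u' = root_of ?w"
    using rnet_eq_iff[OF nw(2) V(2) r] by metis
  note m = network_multigraph[OF network_net_of] network_multigraph[OF nw(1)]
    network_multigraph[OF nw(2)]
  have 1: "iso_via (=) a b (ball_network ?G (root_of ?z) n) (ball_network G u n)"
    using iso_ball[OF a(1) m(1,2) root_of_in, of n] a by simp
  have 2: "iso_via (=) c d (ball_network H u' n) (ball_network ?H (root_of ?w) n)"
    using iso_ball[OF c(1) m(3,1) V(2), of n] c by simp
  have 12: "iso_via (\<lambda>a b. dist a b < \<epsilon>) (f \<circ> a) (h \<circ> b)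
      (ball_network ?G (root_of ?z) n) (ball_network H u' n)"
    by (rule iso_via_trans[OF 1 iso]) (auto intro: multigraph_induced m)
  have 3: "iso_via (\<lambda>a b. dist a b < \<epsilon>) (c \<circ> (f \<circ> a)) (d \<circ> (h \<circ> b))
      (ball_network ?G (root_of ?z) n) (ball_network ?H (root_of ?w) n)"
    by (rule iso_via_trans[OF 12 2]) (auto intro: multigraph_induced m)
  then show ?thesis
    unfolding close_rooted_def using a c f by (metis comp_apply)
qed

text \<open>
  \<open>f\<close> carries the ball of radius \<open>m\<close> about \<open>u\<close> to a ball in \<open>H\<close> with marks moved by less than
  \<open>1 / (m + 1)\<close>.  Tying the precision to the radius leaves a single parameter, so that neighbourhoods
  become statements about eventually all \<open>m\<close>, which can be combined over finitely many vertices.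
\<close>
definition matches :: "nat \<Rightarrow> 'x::metric_space network \<Rightarrow> nat \<Rightarrow> 'x network \<Rightarrow> (nat \<Rightarrow> nat) \<Rightarrow> bool" where
  "matches m G u H f \<longleftrightarrow> network H \<and> f u \<in> verts H \<and>
     (\<exists>h. iso_via (\<lambda>a b. dist a b < 1 / real (Suc m)) f h (ball_network G u m) (ball_network H (f u) m))"

lemma gball_exists:
  assumes "network G" "u \<in> verts G" "v \<in> verts G"
  obtains n where "v \<in> gball G u n"
proof -
  have "(u, v) \<in> (adjacent G)\<^sup>*"
    using assms unfolding network_def connected_graph_def by blast
  then show ?thesis using that unfolding gball_def by (auto simp: rtrancl_power)
qed

lemma matches_restrict:
  assumes "matches m G u H f" "network G" "u \<in> verts G" "w \<in> gball G u k" "k + n \<le> m"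
    "1 / real (Suc m) \<le> \<epsilon>"
  obtains h where "iso_via (\<lambda>a b. dist a b < \<epsilon>) f h (ball_network G w n) (ball_network H (f w) n)"
    "f w \<in> verts H"
proof -
  obtain h where h: "network H" "f u \<in> verts H"
    "iso_via (\<lambda>a b. dist a b < 1 / real (Suc m)) f h (ball_network G u m) (ball_network H (f u) m)"
    using assms(1) by (auto simp: matches_def)
  have "iso_via (\<lambda>a b. dist a b < 1 / real (Suc m)) f h (ball_network G w n) (ball_network H (f w) n)"
    using iso_ball_recentre[OF h(3) refl assms(2,3) h(1,2) assms(4,5)] .
  then have "iso_via (\<lambda>a b. dist a b < \<epsilon>) f h (ball_network G w n) (ball_network H (f w) n)"
    by (rule iso_via_mono) (use assms(6) in linarith)
  moreover have "f w \<in> verts H"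
  proof -
    have "f w \<in> gball H (f u) k" 
      using iso_ball_gball[OF h(3) refl assms(2,3) _ assms(4)] assms(5) by simp
    then show ?thesis using gball_subset h(1,2) network_multigraph by blast
  qed
  ultimately show ?thesis using that by blast
qed

lemma eventually_matches_verts:
  assumes "network G" "u \<in> verts G" "w \<in> verts G"
  shows "\<forall>\<^sub>F m in sequentially. \<forall>H f. matches m G u H f \<longrightarrow> f w \<in> verts H"
proof -
  obtain k where k: "w \<in> gball G u k" using gball_exists assms by blast
  show ?thesis
    using eventually_ge_at_top[of k]
  proof eventually_elim
    case (elim m)
    then show ?case
      using matches_restrict[of m G u _ _ w k 0 "1 / real (Suc m)"] assms k by (metis add_0_right order_refl)
  qed
qed

lemma eventually_small: "\<epsilon> > 0 \<Longrightarrow> \<forall>\<^sub>F m in sequentially. 1 / real (Suc m) \<le> \<epsilon>"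
proof -
  assume "\<epsilon> > 0"
  then have "\<forall>\<^sub>F m in sequentially. 1 / real (Suc m) < \<epsilon>"
    using order_tendstoD(2)[OF lim_1_over_n[THEN LIMSEQ_Suc]] by simp
  then show ?thesis by eventually_elim simp
qed

text \<open>
  The two roots \<open>w\<close>, \<open>v\<close> may be any vertices, while the ball that is matched is centred at a third one:
  a large ball about \<open>u\<close> contains every prescribed ball about \<open>w\<close>.
\<close>
lemma eventually_matches_bnet:
  assumes "network G" "u \<in> verts G" "w \<in> verts G" "v \<in> verts G" and U: "open U" "bnet G w v \<in> U"
  shows "\<forall>\<^sub>F m in sequentially. \<forall>H f. matches m G u H f \<longrightarrow> bnet H (f w) (f v) \<in> U"
proof -
  let ?z = "bnet G w v"
  obtain n \<epsilon> where n: "root2_of ?z \<in> gball (bi_net_of ?z) (root1_of ?z) n" "\<epsilon> > 0"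
    "{y. close_birooted n \<epsilon> ?z y} \<subseteq> U"
    using U unfolding open_birooted_net_def by blast
  obtain k where k: "w \<in> gball G u k" using gball_exists assms by blast
  have v: "v \<in> gball G w n"
  proof -
    have "bnet (bi_net_of ?z) (root1_of ?z) (root2_of ?z) = bnet G w v" by simp
    then obtain a b where a: "iso_via (=) a b (bi_net_of ?z) G" "a (root1_of ?z) = w" "a (root2_of ?z) = v"
      using bnet_eq_iff[OF network_bi_net_of root1_of_in root2_of_in assms(1,3,4)] by metis
    have "iso_via (=) a b (induced (bi_net_of ?z) (verts (bi_net_of ?z))) (induced G (verts G))"
      using a(1) assms by (simp add: induced_verts network_multigraph network_bi_net_of)
    from iso_induced_gball[OF this _ n(1)] show ?thesis
      using a by (simp add: gball_subset network_multigraph network_bi_net_of root1_of_in)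
  qed
  show ?thesis
    using eventually_ge_at_top[of "k + n"] eventually_small[OF n(2)]
      eventually_matches_verts[OF assms(1,2,4)]
  proof eventually_elim
    case (elim m)
    show ?case
    proof (intro allI impI)
      fix H f assume m: "matches m G u H f"
      then obtain h where "iso_via (\<lambda>a b. dist a b < \<epsilon>) f h (ball_network G w n) (ball_network H (f w) n)"
        "f w \<in> verts H"
        using matches_restrict[OF m assms(1,2) k elim(1,2)] by blast
      then have "close_birooted n \<epsilon> ?z (bnet H (f w) (f v))"
        using assms m elim(3) v by (intro close_birooted_bnet) (auto simp: matches_def)
      then show "bnet H (f w) (f v) \<in> U" using n(3) by blast
    qed
  qed
qed

lemma eventually_matches_rnet:
  assumes "network G" "u \<in> verts G" "w \<in> verts G" and U: "open U" "rnet G w \<in> U"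
  shows "\<forall>\<^sub>F m in sequentially. \<forall>H f. matches m G u H f \<longrightarrow> rnet H (f w) \<in> U"
proof -
  let ?z = "rnet G w"
  obtain n \<epsilon> where n: "\<epsilon> > 0" "{y. close_rooted n \<epsilon> ?z y} \<subseteq> U"
    using U unfolding open_rooted_net_def by blast
  obtain k where k: "w \<in> gball G u k" using gball_exists assms by blast
  show ?thesis
    using eventually_ge_at_top[of "k + n"] eventually_small[OF n(1)]
  proof eventually_elim
    case (elim m)
    show ?case
    proof (intro allI impI)
      fix H f assume m: "matches m G u H f"
      then obtain h where "iso_via (\<lambda>a b. dist a b < \<epsilon>) f h (ball_network G w n) (ball_network H (f w) n)"
        "f w \<in> verts H"
        using matches_restrict[OF m assms(1,2) k elim(1,2)] by blast
      then have "close_rooted n \<epsilon> ?z (rnet H (f w))"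
        using assms m by (intro close_rooted_rnet) (auto simp: matches_def)
      then show "rnet H (f w) \<in> U" using n(2) by blast
    qed
  qed
qed

lemma open_birooted_netI:
  fixes U :: "'x::metric_space birooted_net set"
  assumes "\<And>G u v. network G \<Longrightarrow> u \<in> verts G \<Longrightarrow> v \<in> verts G \<Longrightarrow> bnet G u v \<in> U \<Longrightarrow>
    \<forall>\<^sub>F m in sequentially. \<forall>H f. matches m G u H f \<longrightarrow> f v \<in> verts H \<longrightarrow> bnet H (f u) (f v) \<in> U"
  shows "open U"
  unfolding open_birooted_net_def
proof
  fix z assume z: "z \<in> U"
  let ?G = "bi_net_of z" and ?u = "root1_of z" and ?v = "root2_of z"
  obtain k where k: "?v \<in> gball ?G ?u k" using root2_in_gball by blast
  have "\<forall>\<^sub>F m in sequentially. \<forall>H f. matches m ?G ?u H f \<longrightarrow> f ?v \<in> verts H \<longrightarrow> bnet H (f ?u) (f ?v) \<in> U"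
    using assms[of ?G ?u ?v] z network_bi_net_of root1_of_in root2_of_in by auto
  then have "\<forall>\<^sub>F m in sequentially. k \<le> m \<and>
     (\<forall>H f. matches m ?G ?u H f \<longrightarrow> f ?v \<in> verts H \<longrightarrow> bnet H (f ?u) (f ?v) \<in> U)"
    using eventually_ge_at_top[of k] by eventually_elim auto
  then obtain m where m: "k \<le> m"
    "\<And>H f. matches m ?G ?u H f \<Longrightarrow> f ?v \<in> verts H \<Longrightarrow> bnet H (f ?u) (f ?v) \<in> U"
    by (auto simp: eventually_sequentially)
  have "w \<in> U" if w: "close_birooted m (1 / real (Suc m)) z w" for w
  proof -
    obtain f h where f: "iso_via (\<lambda>a b. dist a b < 1 / real (Suc m)) f h
        (ball_network ?G ?u m) (ball_network (bi_net_of w) (root1_of w) m)"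
      "f ?u = root1_of w" "f ?v = root2_of w"
      using w by (auto simp: close_birooted_def)
    then have "matches m ?G ?u (bi_net_of w) f"
      by (auto simp: matches_def network_bi_net_of root1_of_in)
    then show ?thesis using m(2)[of "bi_net_of w" f] f root2_of_in by auto
  qed
  then show "\<exists>n. ?v \<in> gball ?G ?u n \<and> (\<exists>\<epsilon>>0. {w. close_birooted n \<epsilon> z w} \<subseteq> U)"
    using k m(1) gball_mono[OF m(1), of ?G ?u]
    by (intro exI[of _ m] conjI exI[of _ "1 / real (Suc m)"]) auto
qed

lemma open_rooted_netI:
  fixes U :: "'x::metric_space rooted_net set"
  assumes "\<And>G u. network G \<Longrightarrow> u \<in> verts G \<Longrightarrow> rnet G u \<in> U \<Longrightarrow>
    \<forall>\<^sub>F m in sequentially. \<forall>H f. matches m G u H f \<longrightarrow> rnet H (f u) \<in> U"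
  shows "open U"
  unfolding open_rooted_net_def
proof
  fix z assume z: "z \<in> U"
  let ?G = "net_of z" and ?u = "root_of z"
  have "\<forall>\<^sub>F m in sequentially. \<forall>H f. matches m ?G ?u H f \<longrightarrow> rnet H (f ?u) \<in> U"
    using assms[of ?G ?u] z network_net_of root_of_in by auto
  then obtain m where m: "\<And>H f. matches m ?G ?u H f \<Longrightarrow> rnet H (f ?u) \<in> U"
    by (auto simp: eventually_sequentially)
  have "w \<in> U" if w: "close_rooted m (1 / real (Suc m)) z w" for w
  proof -
    obtain f h where f: "iso_via (\<lambda>a b. dist a b < 1 / real (Suc m)) f h
        (ball_network ?G ?u m) (ball_network (net_of w) (root_of w) m)"
      "f ?u = root_of w"
      using w by (auto simp: close_rooted_def)
    then have "matches m ?G ?u (net_of w) f"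
      by (auto simp: matches_def network_net_of root_of_in)
    then show ?thesis using m[of "net_of w" f] f by auto
  qed
  then show "\<exists>n. \<exists>\<epsilon>>0. {w. close_rooted n \<epsilon> z w} \<subseteq> U"
    by (intro exI[of _ m] exI[of _ "1 / real (Suc m)"]) auto
qed

section \<open>Changing the roots\<close>

definition swap_roots :: "'x birooted_net \<Rightarrow> 'x birooted_net" where
  "swap_roots z = bnet (bi_net_of z) (root2_of z) (root1_of z)"

definition rooted_at_first :: "'x birooted_net \<Rightarrow> 'x rooted_net" where
  "rooted_at_first z = rnet (bi_net_of z) (root1_of z)"

definition rooted_at_second :: "'x birooted_net \<Rightarrow> 'x rooted_net" where
  "rooted_at_second z = rnet (bi_net_of z) (root2_of z)"

definition double_root :: "'x rooted_net \<Rightarrow> 'x birooted_net" where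
  "double_root x = bnet (net_of x) (root_of x) (root_of x)"

lemma bnet_representative:
  assumes "network G" "u \<in> verts G" "v \<in> verts G"
  obtains f h where "iso_via (=) f h G (bi_net_of (bnet G u v))"
    "f u = root1_of (bnet G u v)" "f v = root2_of (bnet G u v)"
proof -
  let ?z = "bnet G u v"
  have "bnet G u v = bnet (bi_net_of ?z) (root1_of ?z) (root2_of ?z)" by simp
  then show ?thesis
    using that bnet_eq_iff[OF assms network_bi_net_of root1_of_in root2_of_in] by metis
qed

lemma rnet_representative:
  assumes "network G" "u \<in> verts G"
  obtains f h where "iso_via (=) f h G (net_of (rnet G u))" "f u = root_of (rnet G u)"
proof -
  let ?z = "rnet G u"
  have "rnet G u = rnet (net_of ?z) (root_of ?z)" by simp
  then show ?thesis
    using that rnet_eq_iff[OF assms network_net_of root_of_in] by metis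
qed

lemma rnet_iso:
  assumes "iso_via (=) f h G H" "network G" "network H" "u \<in> verts G"
  shows "rnet H (f u) = rnet G u"
proof -
  have "f u \<in> verts H" using assms by (auto simp: iso_via_def bij_betw_def)
  then show ?thesis using rnet_eq_iff[of G u H "f u"] assms by metis
qed

context
  fixes G :: "'x network" and u v
  assumes nw: "network G" "u \<in> verts G" "v \<in> verts G"
begin

lemma swap_roots_bnet [simp]: "swap_roots (bnet G u v) = bnet G v u"
proof -
  obtain f h where f: "iso_via (=) f h G (bi_net_of (bnet G u v))"
    "f u = root1_of (bnet G u v)" "f v = root2_of (bnet G u v)"
    using bnet_representative[OF nw] .
  show ?thesis
    using bnet_iso[OF f(1) nw(1) network_bi_net_of] nw by (simp add: swap_roots_def flip: f)
qed

lemma first_bnet [simp]: "rooted_at_first (bnet G u v) = rnet G u"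
proof -
  obtain f h where f: "iso_via (=) f h G (bi_net_of (bnet G u v))"
    "f u = root1_of (bnet G u v)" "f v = root2_of (bnet G u v)"
    using bnet_representative[OF nw] .
  show ?thesis
    using rnet_iso[OF f(1) nw(1) network_bi_net_of] nw by (simp add: rooted_at_first_def flip: f)
qed

lemma second_bnet [simp]: "rooted_at_second (bnet G u v) = rnet G v"
proof -
  obtain f h where f: "iso_via (=) f h G (bi_net_of (bnet G u v))"
    "f u = root1_of (bnet G u v)" "f v = root2_of (bnet G u v)"
    using bnet_representative[OF nw] .
  show ?thesis
    using rnet_iso[OF f(1) nw(1) network_bi_net_of] nw by (simp add: rooted_at_second_def flip: f)
qed

end

lemma double_root_rnet [simp]:
  assumes "network G" "u \<in> verts G"
  shows "double_root (rnet G u) = bnet G u u"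
proof -
  obtain f h where f: "iso_via (=) f h G (net_of (rnet G u))" "f u = root_of (rnet G u)"
    using rnet_representative[OF assms] .
  show ?thesis
    using bnet_iso[OF f(1) assms(1) network_net_of] assms by (simp add: double_root_def flip: f)
qed

lemma rooted_net_cases:
  obtains G u where "x = rnet G u" "network G" "u \<in> verts G"
  using network_net_of root_of_in rnet_net_of by metis

lemma birooted_net_cases:
  obtains G u v where "z = bnet G u v" "network G" "u \<in> verts G" "v \<in> verts G"
  using network_bi_net_of root1_of_in root2_of_in bnet_bi_net_of by metis

lemma first_swap_roots [simp]: "rooted_at_first (swap_roots z) = rooted_at_second z" and second_swap_roots [simp]: "rooted_at_second (swap_roots z) = rooted_at_first z"
  by (rule birooted_net_cases[of z]; simp)+

lemma borel_measurable_open_vimage: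
  assumes "\<And>U. open U \<Longrightarrow> open (f -` U)"
  shows "f \<in> borel_measurable borel"
  by (rule borel_measurableI) (use assms in simp)

text \<open>
  Swapping the roots is continuous although the topology prefers the first root: a large ball about one root
  contains a ball about the other one that still contains both.
\<close>
lemma measurable_swap_roots [measurable]: "(swap_roots :: 'x::metric_space birooted_net \<Rightarrow> _) \<in> borel_measurable borel"
proof (rule borel_measurable_open_vimage, rule open_birooted_netI)
  fix U :: "'x birooted_net set" and G u v
  assume U: "open U" and G: "network G" "u \<in> verts G" "v \<in> verts G" and "bnet G u v \<in> swap_roots -` U"
  then have "bnet G v u \<in> U" by simp
  from eventually_matches_bnet[OF G(1,2,3,2) U this]
  show "\<forall>\<^sub>F m in sequentially. \<forall>H f. matches m G u H f \<longrightarrow> f v \<in> verts H \<longrightarrow> bnet H (f u) (f v) \<in> swap_roots -` U"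
    by eventually_elim (simp add: matches_def)
qed

lemma measurable_first [measurable]: "(rooted_at_first :: 'x::metric_space birooted_net \<Rightarrow> _) \<in> borel_measurable borel"
proof (rule borel_measurable_open_vimage, rule open_birooted_netI)
  fix U :: "'x rooted_net set" and G u v
  assume U: "open U" and G: "network G" "u \<in> verts G" "v \<in> verts G" and "bnet G u v \<in> rooted_at_first -` U"
  then have "rnet G u \<in> U" by simp
  from eventually_matches_rnet[OF G(1,2,2) U this]
  show "\<forall>\<^sub>F m in sequentially. \<forall>H f. matches m G u H f \<longrightarrow> f v \<in> verts H \<longrightarrow> bnet H (f u) (f v) \<in> rooted_at_first -` U"
    by eventually_elim (simp add: matches_def)
qed

lemma measurable_second [measurable]: "(rooted_at_second :: 'x::metric_space birooted_net \<Rightarrow> _) \<in> borel_measurable borel"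
proof -
  have "(\<lambda>z :: 'x birooted_net. rooted_at_first (swap_roots z)) \<in> borel_measurable borel" by measurable
  then show ?thesis by simp
qed

lemma measurable_double_root [measurable]: "(double_root :: 'x::metric_space rooted_net \<Rightarrow> _) \<in> borel_measurable borel"
proof (rule borel_measurable_open_vimage, rule open_rooted_netI)
  fix U :: "'x birooted_net set" and G u
  assume U: "open U" and G: "network G" "u \<in> verts G" and "rnet G u \<in> double_root -` U"
  then have "bnet G u u \<in> U" by simp
  from eventually_matches_bnet[OF G(1,2,2,2) U this]
  show "\<forall>\<^sub>F m in sequentially. \<forall>H f. matches m G u H f \<longrightarrow> rnet H (f u) \<in> double_root -` U"
    by eventually_elim (simp add: matches_def)
qed

definition kernel_product :: "('x birooted_net \<Rightarrow> ennreal) \<Rightarrow> ('x birooted_net \<Rightarrow> ennreal) \<Rightarrow> 'x birooted_net \<Rightarrow> ennreal" where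
  "kernel_product k l z = (\<integral>\<^sup>+w. k (bnet (bi_net_of z) (root1_of z) w) * l (bnet (bi_net_of z) w (root2_of z))
     \<partial>count_space (verts (bi_net_of z)))"

definition row_sum :: "('x birooted_net \<Rightarrow> ennreal) \<Rightarrow> 'x rooted_net \<Rightarrow> ennreal" where
  "row_sum k x = (\<integral>\<^sup>+v. k (bnet (net_of x) (root_of x) v) \<partial>count_space (verts (net_of x)))"

lemma kernel_product_bnet:
  assumes nw: "network G" "u \<in> verts G" "v \<in> verts G"
  shows "kernel_product k l (bnet G u v) = (\<integral>\<^sup>+w. k (bnet G u w) * l (bnet G w v) \<partial>count_space (verts G))"
proof -
  let ?z = "bnet G u v"
  obtain f h where f: "iso_via (=) f h G (bi_net_of ?z)" "f u = root1_of ?z" "f v = root2_of ?z"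
    using bnet_representative[OF nw] .
  then have "bij_betw f (verts G) (verts (bi_net_of ?z))" by (simp add: iso_via_def)
  note nn_integral_bij_count_space[OF this, symmetric]
  then have "kernel_product k l ?z = (\<integral>\<^sup>+w. k (bnet (bi_net_of ?z) (f u) (f w)) * l (bnet (bi_net_of ?z) (f w) (f v))
     \<partial>count_space (verts G))"
    by (simp add: kernel_product_def f)
  also have "\<dots> = (\<integral>\<^sup>+w. k (bnet G u w) * l (bnet G w v) \<partial>count_space (verts G))"
    by (rule nn_integral_cong) (simp add: bnet_iso[OF f(1)] network_bi_net_of nw)
  finally show ?thesis .
qed

lemma row_sum_rnet:
  assumes nw: "network G" "u \<in> verts G"
  shows "row_sum k (rnet G u) = (\<integral>\<^sup>+v. k (bnet G u v) \<partial>count_space (verts G))"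
proof -
  let ?z = "rnet G u"
  obtain f h where f: "iso_via (=) f h G (net_of ?z)" "f u = root_of ?z"
    using rnet_representative[OF nw] .
  then have "bij_betw f (verts G) (verts (net_of ?z))" by (simp add: iso_via_def)
  note nn_integral_bij_count_space[OF this, symmetric]
  then have "row_sum k ?z = (\<integral>\<^sup>+v. k (bnet (net_of ?z) (f u) (f v)) \<partial>count_space (verts G))"
    by (simp add: row_sum_def f)
  also have "\<dots> = (\<integral>\<^sup>+v. k (bnet G u v) \<partial>count_space (verts G))"
    by (rule nn_integral_cong) (simp add: bnet_iso[OF f(1)] network_net_of nw)
  finally show ?thesis .
qed

text \<open>
  Truncation at distance \<open>r\<close> makes all sums over vertices finite; these sets are open, so the
  truncation preserves measurability.
\<close>
definition near_pairs :: "nat \<Rightarrow> 'x birooted_net set" where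
  "near_pairs r = {z. root2_of z \<in> gball (bi_net_of z) (root1_of z) r}"

lemma gball_iso:
  assumes "iso_via R f h G H" "network G" "network H" "u \<in> verts G" "v \<in> gball G u r"
  shows "f v \<in> gball H (f u) r"
proof -
  have "iso_via R f h (induced G (verts G)) (induced H (verts H))"
    using assms by (simp add: induced_verts network_multigraph)
  from iso_induced_gball[OF this _ assms(5)] show ?thesis
    using assms by (simp add: gball_subset network_multigraph)
qed

lemma near_pairs_bnet:
  assumes nw: "network G" "u \<in> verts G" "v \<in> verts G"
  shows "bnet G u v \<in> near_pairs r \<longleftrightarrow> v \<in> gball G u r"
proof -
  let ?z = "bnet G u v"
  have eq: "bnet G u v = bnet (bi_net_of ?z) (root1_of ?z) (root2_of ?z)" by simp
  note r = network_bi_net_of root1_of_in root2_of_in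
  obtain f h where f: "iso_via (=) f h G (bi_net_of ?z)" "f u = root1_of ?z" "f v = root2_of ?z"
    using bnet_representative[OF nw] .
  obtain g k where g: "iso_via (=) g k (bi_net_of ?z) G" "g (root1_of ?z) = u" "g (root2_of ?z) = v"
    using iffD1[OF bnet_eq_iff[OF r nw] eq[symmetric]] by auto
  show ?thesis
    using gball_iso[OF f(1) nw(1) network_bi_net_of nw(2), of v r] 
      gball_iso[OF g(1) network_bi_net_of nw(1) root1_of_in, of "root2_of ?z" r] f g
    by (auto simp: near_pairs_def)
qed

lemma open_near_pairs: "open (near_pairs r :: 'x::metric_space birooted_net set)"
proof (rule open_birooted_netI)
  fix G :: "'x network" and u v
  assume G: "network G" "u \<in> verts G" "v \<in> verts G" and "bnet G u v \<in> near_pairs r"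
  then have v: "v \<in> gball G u r" by (simp add: near_pairs_bnet)
  show "\<forall>\<^sub>F m in sequentially. \<forall>H f. matches m G u H f \<longrightarrow> f v \<in> verts H \<longrightarrow> bnet H (f u) (f v) \<in> near_pairs r"
    using eventually_ge_at_top[of r]
  proof eventually_elim
    case (elim m)
    show ?case
    proof (intro allI impI)
      fix H f assume m: "matches m G u H f" "f v \<in> verts H"
      then obtain h where "iso_via (\<lambda>a b. dist a b < 1 / real (Suc m)) f h (ball_network G u m) (ball_network H (f u) m)"
        by (auto simp: matches_def)
      from iso_ball_gball[OF this refl G(1,2) elim v] m
      show "bnet H (f u) (f v) \<in> near_pairs r" by (auto simp: matches_def near_pairs_bnet)
    qed
  qed
qed

lemma finite_gball:
  assumes "network G" "u \<in> verts G"
  shows "finite (gball G u n)"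
proof (induction n)
  case 0
  have "gball G u 0 = {u}" by (auto simp: gball_def)
  then show ?case by simp
next
  case (Suc n)
  have "gball G u (Suc n) \<subseteq> gball G u n \<union> (\<Union>v\<in>gball G u n. \<Union>e\<in>{e \<in> edges G. v \<in> ends G e}. ends G e)"
  proof
    fix w assume "w \<in> gball G u (Suc n)"
    then obtain k where k: "k \<le> Suc n" "(u, w) \<in> adjacent G ^^ k" by (auto simp: gball_def)
    show "w \<in> gball G u n \<union> (\<Union>v\<in>gball G u n. \<Union>e\<in>{e \<in> edges G. v \<in> ends G e}. ends G e)"
    proof (cases "k = Suc n")
      case True
      then obtain v where v: "(u, v) \<in> adjacent G ^^ n" "(v, w) \<in> adjacent G" using k by auto
      then obtain e where "e \<in> edges G" "ends G e = {v, w}" by (auto simp: adjacent_def)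
      moreover have "v \<in> gball G u n" using v by (auto simp: gball_def)
      ultimately show ?thesis by blast
    next
      case False
      then have "k \<le> n" using k by simp
      then show ?thesis using k by (auto simp: gball_def)
    qed
  qed
  moreover have "finite (\<Union>v\<in>gball G u n. \<Union>e\<in>{e \<in> edges G. v \<in> ends G e}. ends G e)"
  proof (intro finite_UN_I Suc.IH)
    fix v assume "v \<in> gball G u n"
    then have "v \<in> verts G" using gball_subset assms network_multigraph by blast
    then show "finite {e \<in> edges G. v \<in> ends G e}"
      using assms by (auto simp: network_def locally_finite_def)
  next
    fix v e assume "e \<in> {e \<in> edges G. v \<in> ends G e}"
    then have "ends G e \<noteq> {}" "card (ends G e) \<in> {1, 2}"
      using assms(1) by (auto simp: network_def multigraph_def)
    then show "finite (ends G e)" using card.infinite[of "ends G e"] by force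
  qed
  ultimately show ?case using Suc.IH finite_subset finite_UnI by blast
qed

section \<open>Products and row sums of kernels are measurable\<close>

text \<open>
  A Dynkin class argument: finiteness of the total mass allows passing to complements.
\<close>
lemma borel_measurable_sum_of_open:
  fixes F :: "'z \<Rightarrow> nat \<Rightarrow> 'b::topological_space" and g :: "'z \<Rightarrow> nat \<Rightarrow> ennreal"
  assumes op: "\<And>U. open U \<Longrightarrow> (\<lambda>z. \<integral>\<^sup>+w. indicator U (F z w) * g z w \<partial>count_space (W z)) \<in> borel_measurable M"
    and fin: "\<And>z. (\<integral>\<^sup>+w. g z w \<partial>count_space (W z)) < \<infinity>"
    and f: "f \<in> borel_measurable borel"
  shows "(\<lambda>z. \<integral>\<^sup>+w. f (F z w) * g z w \<partial>count_space (W z)) \<in> borel_measurable M"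
proof -
  let ?K = "\<lambda>f z. \<integral>\<^sup>+w. f (F z w) * g z w \<partial>count_space (W z)"
  have ind: "?K (indicator A) \<in> borel_measurable M" if "A \<in> sets borel" for A
  proof -
    have "Int_stable {S :: 'b set. open S}" "{S :: 'b set. open S} \<subseteq> Pow UNIV"
      by (auto simp: Int_stable_def)
    moreover have "A \<in> sigma_sets UNIV {S. open S}"
      using that by (simp add: borel_def)
    ultimately show ?thesis
    proof (induction rule: sigma_sets_induct_disjoint)
      case (basic A)
      then show ?case using op by simp
    next
      case empty
      then show ?case by simp
    next
      case (compl A)
      have "?K (indicator (UNIV - A)) = (\<lambda>z. ?K (indicator UNIV) z - ?K (indicator A) z)"
      proof
        fix z
        have "?K (indicator UNIV) z = ?K (indicator (UNIV - A)) z + ?K (indicator A) z"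
          by (subst nn_integral_add[symmetric])
             (auto intro!: nn_integral_cong split: split_indicator)
        moreover have "?K (indicator A) z < \<infinity>"
          using fin[of z] by (rule le_less_trans[rotated])
            (auto intro!: nn_integral_mono split: split_indicator)
        ultimately show "?K (indicator (UNIV - A)) z = ?K (indicator UNIV) z - ?K (indicator A) z"
          by (simp add: ennreal_add_diff_cancel_right)
      qed
      then show ?case using op[of UNIV] compl by simp
    next
      case (union A)
      have "?K (indicator (\<Union>i. A i)) = (\<lambda>z. \<Sum>i. ?K (indicator (A i)) z)"
        using union(1)
        by (subst nn_integral_suminf[symmetric])
           (auto simp: suminf_indicator intro!: nn_integral_cong)
      then show ?case using union by simp
    qed
  qed
  show ?thesis using f
  proof (induction rule: borel_measurable_induct)
    case (cong f g)
    then show ?case by simp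
  next
    case (set A)
    then show ?case using ind by simp
  next
    case (mult u c)
    then show ?case by (simp add: mult.assoc nn_integral_cmult)
  next
    case (add u v)
    then show ?case by (simp add: distrib_right nn_integral_add)
  next
    case (seq U)
    have "?K (Sup (range U)) = (\<lambda>z. SUP i. ?K (U i) z)"
    proof
      fix z
      have "incseq (\<lambda>i w. U i (F z w) * g z w)"
        using seq(3) by (auto simp: incseq_def le_fun_def intro!: mult_right_mono)
      then show "?K (Sup (range U)) z = (SUP i. ?K (U i) z)"
        by (subst nn_integral_monotone_convergence_SUP[symmetric])
           (auto simp: Sup_apply image_image SUP_mult_right_ennreal intro!: nn_integral_cong)
    qed
    then show ?case using seq by simp
  qed
qed

lemma kernel_product_indicator:
  fixes A B :: "'x birooted_net set"
  assumes nw: "network G" "u \<in> verts G" "v \<in> verts G" and A: "A \<subseteq> near_pairs r"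
  defines "W \<equiv> {w \<in> verts G. bnet G u w \<in> A \<and> bnet G w v \<in> B}"
  shows "kernel_product (indicator A) (indicator B) (bnet G u v) = of_nat (card W)" "finite W"
proof -
  have "W \<subseteq> gball G u r"
    using A near_pairs_bnet[OF nw(1,2), of _ r] by (auto simp: W_def)
  then show fin: "finite W" using finite_gball nw finite_subset by blast
  have "kernel_product (indicator A) (indicator B) (bnet G u v) = (\<integral>\<^sup>+w. indicator W w \<partial>count_space (verts G))"
    unfolding kernel_product_bnet[OF nw]
    by (rule nn_integral_cong) (auto simp: W_def split: split_indicator)
  also have "\<dots> = emeasure (count_space (verts G)) W"
    by (rule nn_integral_indicator) (auto simp: W_def)
  also have "\<dots> = of_nat (card W)"
    using fin by (subst emeasure_count_space) (auto simp: W_def)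
  finally show "kernel_product (indicator A) (indicator B) (bnet G u v) = of_nat (card W)" .
qed

text \<open>
  For open sets the product counts the vertices \<open>w\<close> for which two open conditions hold.  Each of the finitely
  many such \<open>w\<close> persists, injectively, in all networks that match a large enough ball; so the count is
  lower semicontinuous.
\<close>
lemma measurable_kernel_product_open:
  fixes U V :: "'x::metric_space birooted_net set"
  assumes U: "open U" "U \<subseteq> near_pairs r" and V: "open V"
  shows "kernel_product (indicator U) (indicator V) \<in> borel_measurable borel"
proof (rule borel_measurableI_greater)
  fix a
  let ?c = "kernel_product (indicator U) (indicator V)"
  have "open {z. a < ?c z}"
  proof (rule open_birooted_netI)
    fix G :: "'x network" and u v
    assume G: "network G" "u \<in> verts G" "v \<in> verts G" and a: "bnet G u v \<in> {z. a < ?c z}"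
    let ?W = "{w \<in> verts G. bnet G u w \<in> U \<and> bnet G w v \<in> V}"
    have fin: "finite ?W" and c: "?c (bnet G u v) = of_nat (card ?W)"
      using kernel_product_indicator[OF G U(2)] by auto
    have "\<forall>\<^sub>F m in sequentially. \<forall>w\<in>?W. (\<forall>H f. matches m G u H f \<longrightarrow> f w \<in> verts H) \<and>
        (\<forall>H f. matches m G u H f \<longrightarrow> bnet H (f u) (f w) \<in> U) \<and>
        (\<forall>H f. matches m G u H f \<longrightarrow> bnet H (f w) (f v) \<in> V)"
      using G U V by (intro eventually_ball_finite fin ballI eventually_conj
        eventually_matches_verts eventually_matches_bnet) auto
    then show "\<forall>\<^sub>F m in sequentially. \<forall>H f. matches m G u H f \<longrightarrow> f v \<in> verts H \<longrightarrow>
        bnet H (f u) (f v) \<in> {z. a < ?c z}"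
      using eventually_ge_at_top[of r]
    proof eventually_elim
      case (elim m)
      show ?case
      proof (intro allI impI)
        fix H f assume m: "matches m G u H f" and v: "f v \<in> verts H"
        let ?W' = "{w \<in> verts H. bnet H (f u) w \<in> U \<and> bnet H w (f v) \<in> V}"
        have H: "network H" "f u \<in> verts H" using m by (auto simp: matches_def)
        obtain h where h: "iso_via (\<lambda>a b. dist a b < 1 / real (Suc m)) f h
            (ball_network G u m) (ball_network H (f u) m)"
          using m by (auto simp: matches_def)
        have inj: "inj_on f (gball G u m)"
          using h verts_ball_network[OF G(1,2)] by (auto simp: iso_via_def bij_betw_def)
        have sub: "?W \<subseteq> gball G u m"
          using U(2) near_pairs_bnet[OF G(1,2), of _ r] gball_mono[OF elim(2), of G u] by auto
        have "card ?W = card (f ` ?W)"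
          using card_image[OF inj_on_subset[OF inj sub]] by simp
        also have "\<dots> \<le> card ?W'"
          using kernel_product_indicator(2)[OF H v U(2), of V] elim(1) m by (intro card_mono) auto
        finally have "?c (bnet G u v) \<le> ?c (bnet H (f u) (f v))"
          unfolding c kernel_product_indicator(1)[OF H v U(2)] by simp
        then show "bnet H (f u) (f v) \<in> {z. a < ?c z}" using a by auto
      qed
    qed
  qed
  then show "{z \<in> space borel. a < ?c z} \<in> sets borel" by simp
qed

lemma count_near_finite:
  fixes k :: "'x birooted_net \<Rightarrow> ennreal"
  assumes k: "\<And>z. k z < \<infinity>" and nw: "network G" "u \<in> verts G"
  shows "(\<integral>\<^sup>+w. k (bnet G u w) * indicator (near_pairs r) (bnet G u w) \<partial>count_space (verts G)) < \<infinity>"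
proof -
  have "(\<integral>\<^sup>+w. k (bnet G u w) * indicator (near_pairs r) (bnet G u w) \<partial>count_space (verts G)) =
      (\<integral>\<^sup>+w. k (bnet G u w) * indicator (gball G u r) w \<partial>count_space (verts G))"
    by (rule nn_integral_cong) (simp add: near_pairs_bnet[OF nw] split: split_indicator)
  also have "\<dots> = (\<integral>\<^sup>+w. k (bnet G u w) \<partial>count_space (gball G u r))"
    using gball_subset[of G u r] nw
    by (subst nn_integral_count_space_indicator, simp)
       (auto simp: network_multigraph nn_integral_count_space_indicator split: split_indicator
         intro!: nn_integral_cong)
  also have "\<dots> = (\<Sum>w\<in>gball G u r. k (bnet G u w))"
    by (rule nn_integral_count_space_finite[OF finite_gball[OF nw]])
  also have "\<dots> < \<infinity>" using k finite_gball[OF nw] by (simp add: less_top)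
  finally show ?thesis .
qed

text \<open>
  From open sets one passes to arbitrary functions in the left factor, then in the right factor, each time with
  the left factor truncated at a finite distance; monotone convergence removes the truncation.
\<close>
lemma measurable_kernel_product [measurable]:
  fixes k l :: "'x::metric_space birooted_net \<Rightarrow> ennreal"
  assumes k [measurable]: "k \<in> borel_measurable borel" and l [measurable]: "l \<in> borel_measurable borel"
  shows "kernel_product k l \<in> borel_measurable borel"
proof -
  let ?G = bi_net_of and ?u = root1_of and ?v = root2_of
  note r = network_bi_net_of root1_of_in root2_of_in
  have 1: "kernel_product (\<lambda>z. k z * indicator (near_pairs r) z) (indicator V) \<in> borel_measurable borel"
    if "k \<in> borel_measurable borel" "open V" for k :: "'x birooted_net \<Rightarrow> ennreal" and V r
  proof -
    have "(\<lambda>z. \<integral>\<^sup>+w. k (bnet (?G z) (?u z) w) *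
        (indicator (near_pairs r) (bnet (?G z) (?u z) w) * indicator V (bnet (?G z) w (?v z)))
        \<partial>count_space (verts (?G z))) \<in> borel_measurable borel"
    proof (rule borel_measurable_sum_of_open[OF _ _ that(1)])
      fix U :: "'x birooted_net set" assume U: "open U"
      have "kernel_product (indicator (U \<inter> near_pairs r)) (indicator V) \<in> borel_measurable borel"
        using U that open_near_pairs by (intro measurable_kernel_product_open[where r = r]) auto
      then show "(\<lambda>z. \<integral>\<^sup>+w. indicator U (bnet (?G z) (?u z) w) *
        (indicator (near_pairs r) (bnet (?G z) (?u z) w) * indicator V (bnet (?G z) w (?v z)))
        \<partial>count_space (verts (?G z))) \<in> borel_measurable borel"
        by (simp add: kernel_product_def[abs_def] indicator_inter_arith mult.assoc)
    next
      fix z :: "'x birooted_net"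
      have "(\<integral>\<^sup>+w. indicator (near_pairs r) (bnet (?G z) (?u z) w) * indicator V (bnet (?G z) w (?v z))
          \<partial>count_space (verts (?G z))) \<le>
        (\<integral>\<^sup>+w. 1 * indicator (near_pairs r) (bnet (?G z) (?u z) w) \<partial>count_space (verts (?G z)))"
        by (rule nn_integral_mono) (auto split: split_indicator)
      also have "\<dots> < \<infinity>" by (rule count_near_finite[OF _ r(1,2)]) simp
      finally show "(\<integral>\<^sup>+w. indicator (near_pairs r) (bnet (?G z) (?u z) w) *
        indicator V (bnet (?G z) w (?v z)) \<partial>count_space (verts (?G z))) < \<infinity>" .
    qed
    then show ?thesis by (simp add: kernel_product_def[abs_def] mult.assoc)
  qed
  have 2: "kernel_product (\<lambda>z. k z * indicator (near_pairs r) z) l \<in> borel_measurable borel"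
    if k: "k \<in> borel_measurable borel" "\<And>z. k z < \<infinity>" for k :: "'x birooted_net \<Rightarrow> ennreal" and r
  proof -
    have "(\<lambda>z. \<integral>\<^sup>+w. l (bnet (?G z) w (?v z)) *
        (k (bnet (?G z) (?u z) w) * indicator (near_pairs r) (bnet (?G z) (?u z) w))
        \<partial>count_space (verts (?G z))) \<in> borel_measurable borel"
    proof (rule borel_measurable_sum_of_open[OF _ _ l])
      show "(\<lambda>z. \<integral>\<^sup>+w. indicator V (bnet (?G z) w (?v z)) *
        (k (bnet (?G z) (?u z) w) * indicator (near_pairs r) (bnet (?G z) (?u z) w))
        \<partial>count_space (verts (?G z))) \<in> borel_measurable borel" if "open V" for V
        using 1[OF k(1) that, of r] by (simp add: kernel_product_def[abs_def] mult.commute)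
    qed (rule count_near_finite[OF k(2) r(1,2)])
    then show ?thesis by (simp add: kernel_product_def[abs_def] mult.commute)
  qed
  let ?k = "\<lambda>n z. min (k z) (of_nat n) * indicator (near_pairs n) z"
  have inc_k: "incseq (\<lambda>n. ?k n (bnet G u w))"
    if nw: "network G" "u \<in> verts G" "w \<in> verts G" for G u w
  proof (rule incseq_SucI)
    fix n
    have "w \<in> gball G u (Suc n)" if "w \<in> gball G u n"
      using that gball_mono[of n "Suc n" G u] by auto
    then show "?k n (bnet G u w) \<le> ?k (Suc n) (bnet G u w)"
      by (auto simp: near_pairs_bnet[OF nw] min.coboundedI2 le_max_iff_disj split: split_indicator)
  qed
  have sup: "(SUP n. ?k n (bnet G u w)) = k (bnet G u w)"
    if nw: "network G" "u \<in> verts G" "w \<in> verts G" for G u w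
  proof -
    obtain r where "w \<in> gball G u r" using gball_exists nw by blast
    then have mem: "w \<in> gball G u n" if "n \<ge> r" for n using gball_mono[OF that] by blast
    have ev: "\<forall>\<^sub>F n in sequentially. min (k (bnet G u w)) (of_nat n) = ?k n (bnet G u w)"
      using eventually_ge_at_top[of r] by eventually_elim (simp add: near_pairs_bnet[OF nw] mem)
    note inc = inc_k[OF nw]
    have "(\<lambda>n. min (k (bnet G u w)) (of_nat n)) \<longlonglongrightarrow> min (k (bnet G u w)) top"
      by (intro tendsto_min tendsto_const of_nat_tendsto_top_ennreal)
    then have "(\<lambda>n. ?k n (bnet G u w)) \<longlonglongrightarrow> k (bnet G u w)"
      using ev by (auto intro: Lim_transform_eventually)
    then show ?thesis using LIMSEQ_SUP[OF inc] LIMSEQ_unique by blast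
  qed
  have "kernel_product k l = (\<lambda>z. SUP n. kernel_product (?k n) l z)"
  proof
    fix z :: "'x birooted_net"
    obtain G u v where z: "z = bnet G u v" and nw: "network G" "u \<in> verts G" "v \<in> verts G"
      by (rule birooted_net_cases)
    have inc: "incseq (\<lambda>n w. ?k n (bnet G u w) * l (bnet G w v) * indicator (verts G) w)"
    proof (intro incseq_SucI le_funI)
      fix n w
      show "?k n (bnet G u w) * l (bnet G w v) * indicator (verts G) w \<le>
          ?k (Suc n) (bnet G u w) * l (bnet G w v) * indicator (verts G) w"
        using incseq_SucD[OF inc_k[OF nw(1,2)], of w n] by (cases "w \<in> verts G") (auto intro: mult_right_mono)
    qed
    have "(SUP n. kernel_product (?k n) l z) = (\<integral>\<^sup>+w. (SUP n. ?k n (bnet G u w) * l (bnet G w v) * indicator (verts G) w) \<partial>count_space (verts G))"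
      by (subst nn_integral_monotone_convergence_SUP[OF inc])
         (auto simp: z kernel_product_bnet[OF nw] intro!: SUP_cong nn_integral_cong)
    also have "\<dots> = kernel_product k l z"
      unfolding z kernel_product_bnet[OF nw]
      by (rule nn_integral_cong) (simp add: SUP_mult_right_ennreal[symmetric] sup nw)
    finally show "kernel_product k l z = (SUP n. kernel_product (?k n) l z)" ..
  qed
  moreover have "kernel_product (?k n) l \<in> borel_measurable borel" for n
    by (rule 2) (auto simp: min_less_iff_disj of_nat_less_top)
  ultimately show ?thesis by simp
qed

lemma row_sum_eq_kernel_product: "row_sum k x = kernel_product k (\<lambda>_. 1) (double_root x)"
  by (rule rooted_net_cases[of x]) (simp add: row_sum_rnet kernel_product_bnet)

lemma measurable_row_sum [measurable]:
  fixes k :: "'x::metric_space birooted_net \<Rightarrow> ennreal"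
  assumes [measurable]: "k \<in> borel_measurable borel"
  shows "row_sum k \<in> borel_measurable borel"
  unfolding row_sum_eq_kernel_product[abs_def] by measurable

section \<open>Invariant events and balanced measures\<close>

lemma borel_near_pairs [measurable]: "near_pairs r \<in> sets (borel :: 'x::metric_space birooted_net measure)"
  by (rule borel_open[OF open_near_pairs])

lemma row_sum_first: "row_sum (\<lambda>z. \<phi> (rooted_at_first z) * k z) x = \<phi> x * row_sum k x"
proof (rule rooted_net_cases[of x])
  fix G u assume x: "x = rnet G u" and nw: "network G" "u \<in> verts G"
  show ?thesis unfolding x row_sum_rnet[OF nw]
    by (subst nn_integral_cmult[symmetric]) (auto intro!: nn_integral_cong simp: nw)
qed

lemma row_sum_mono: "(\<And>z. k z \<le> l z) \<Longrightarrow> row_sum k x \<le> row_sum l x"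
  unfolding row_sum_def by (intro nn_integral_mono) auto

lemma row_sum_cong: "(\<And>z. rooted_at_first z = x \<Longrightarrow> k z = l z) \<Longrightarrow> row_sum k x = row_sum l x"
  unfolding row_sum_def
  by (intro nn_integral_cong) (simp add: network_net_of root_of_in)

lemma row_sum_eq_0_iff:
  assumes "network G" "u \<in> verts G"
  shows "row_sum k (rnet G u) = 0 \<longleftrightarrow> (\<forall>v\<in>verts G. k (bnet G u v) = 0)"
  by (simp add: row_sum_rnet[OF assms] nn_integral_0_iff_AE AE_count_space)

lemma row_sum_add: "row_sum (\<lambda>z. k z + l z) x = row_sum k x + row_sum l x"
  unfolding row_sum_def by (rule nn_integral_add) auto

lemma row_sum_cmult: "row_sum (\<lambda>z. c * k z) x = c * row_sum k x"
  unfolding row_sum_def by (rule nn_integral_cmult) auto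

lemma row_sum_suminf: "row_sum (\<lambda>z. \<Sum>i. k i z) x = (\<Sum>i. row_sum (k i) x)"
  unfolding row_sum_def by (rule nn_integral_suminf) auto

lemma row_sum_SUP:
  assumes "incseq k"
  shows "row_sum (\<lambda>z. SUP i. k i z) x = (SUP i. row_sum (k i) x)"
  unfolding row_sum_def
  by (rule nn_integral_monotone_convergence_SUP) (use assms in \<open>auto simp: incseq_def le_fun_def\<close>)

text \<open>
  The largest invariant event contained in \<open>B\<close>.  It turns almost sure statements about the root into statements
  about all vertices, and \<open>- everywhere (- B)\<close> is the event that some vertex lies in \<open>B\<close>.
\<close>
definition everywhere :: "'x rooted_net set \<Rightarrow> 'x rooted_net set" where
  "everywhere B = {x. \<forall>v\<in>verts (net_of x). rnet (net_of x) v \<in> B}"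

lemma everywhere_eq: "everywhere B = {x. row_sum (\<lambda>z. indicator (- B) (rooted_at_second z)) x = 0}"
proof -
  have "row_sum (\<lambda>z. indicator (- B) (rooted_at_second z)) x = 0 \<longleftrightarrow> (\<forall>v\<in>verts (net_of x). rnet (net_of x) v \<in> B)" for x
    using row_sum_eq_0_iff[OF network_net_of root_of_in, of "\<lambda>z. indicator (- B) (rooted_at_second z)" x]
    by (simp add: network_net_of root_of_in indicator_eq_0_iff)
  then show ?thesis by (simp add: everywhere_def)
qed

lemma rnet_everywhere:
  assumes "network G" "u \<in> verts G"
  shows "rnet G u \<in> everywhere B \<longleftrightarrow> (\<forall>v\<in>verts G. rnet G v \<in> B)"
  by (simp add: everywhere_eq row_sum_eq_0_iff assms indicator_eq_0_iff)

lemma everywhere_subset: "everywhere B \<subseteq> B"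
proof
  fix x assume "x \<in> everywhere B"
  then have "rnet (net_of x) (root_of x) \<in> everywhere B" by simp
  then have "rnet (net_of x) (root_of x) \<in> B"
    unfolding rnet_everywhere[OF network_net_of root_of_in] using root_of_in by blast
  then show "x \<in> B" by simp
qed

lemma borel_everywhere [measurable]:
  fixes B :: "'x::metric_space rooted_net set"
  assumes [measurable]: "B \<in> sets borel"
  shows "everywhere B \<in> sets borel"
proof -
  have "Measurable.pred borel (\<lambda>x. row_sum (\<lambda>z. indicator (- B) (rooted_at_second z)) x = 0)"
    by measurable
  then show ?thesis unfolding everywhere_eq by (simp add: pred_def)
qed

lemma invariant_event_iff: "invariant_event A \<longleftrightarrow> (\<forall>z. rooted_at_first z \<in> A \<longrightarrow> rooted_at_second z \<in> A)"
proof
  assume "invariant_event A"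
  then show "\<forall>z. rooted_at_first z \<in> A \<longrightarrow> rooted_at_second z \<in> A"
    unfolding invariant_event_def by (metis birooted_net_cases first_bnet second_bnet)
next
  assume A: "\<forall>z. rooted_at_first z \<in> A \<longrightarrow> rooted_at_second z \<in> A"
  show "invariant_event A"
    unfolding invariant_event_def
  proof (intro allI impI, elim conjE)
    fix G u v assume "network G" "u \<in> verts G" "v \<in> verts G" "rnet G u \<in> A"
    then show "rnet G v \<in> A" using A[rule_format, of "bnet G u v"] by simp
  qed
qed

lemma invariant_eventD: "invariant_event A \<Longrightarrow> rooted_at_second z \<in> A \<longleftrightarrow> rooted_at_first z \<in> A"
  using invariant_event_iff[of A] first_swap_roots[of z] second_swap_roots[of z] by metis

lemma invariant_everywhere: "invariant_event (everywhere B)"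
  unfolding invariant_event_def using rnet_everywhere by blast

lemma invariant_Compl: "invariant_event A \<Longrightarrow> invariant_event (- A)"
  unfolding invariant_event_def by blast

lemma invariant_borel_function:
  assumes "f \<in> borel_measurable invariant_algebra"
  shows "f (rooted_at_second z) = (f (rooted_at_first z) :: ennreal)"
proof -
  have sp: "space invariant_algebra = UNIV"
    by (simp add: invariant_algebra_def space_measure_of_conv)
  have "f -` {f (rooted_at_first z)} \<inter> space invariant_algebra \<in> sets invariant_algebra"
    using assms by (rule measurable_sets) simp
  then have "invariant_event (f -` {f (rooted_at_first z)})"
    by (simp add: sets_invariant_algebra sp)
  from invariant_eventD[OF this, of z] show ?thesis by simp
qed

lemma invariant_indicator:
  "A \<in> sets borel \<Longrightarrow> invariant_event A \<Longrightarrow> (indicator A :: _ \<Rightarrow> ennreal) \<in> borel_measurable invariant_algebra"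
  by (rule borel_measurable_indicator) (simp add: sets_invariant_algebra)

lemma borel_measurable_invariant:
  "f \<in> borel_measurable invariant_algebra \<Longrightarrow> f \<in> borel_measurable borel"
  by (rule measurable_from_subalg[of borel])
     (auto simp: subalgebra_def sets_invariant_algebra, simp add: invariant_algebra_def space_measure_of_conv)

lemma ball_size:
  fixes x :: "'x rooted_net"
  shows "row_sum (indicator (near_pairs r)) x < \<infinity>" "0 < row_sum (indicator (near_pairs r)) x"
proof -
  obtain G u where x: "x = rnet G u" and nw: "network G" "u \<in> verts G" by (rule rooted_net_cases)
  show "row_sum (indicator (near_pairs r)) x < \<infinity>"
    using count_near_finite[of "\<lambda>_. 1" G u r] nw by (simp add: x row_sum_rnet)
  have "row_sum (indicator (near_pairs r)) x \<noteq> 0"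
    using nw gball_centre[of u G r]
    by (auto simp: x row_sum_eq_0_iff near_pairs_bnet indicator_eq_0_iff intro!: bexI[of _ u])
  then show "0 < row_sum (indicator (near_pairs r)) x" by (simp add: zero_less_iff_neq_zero)
qed

text \<open>
  Mass sent along a strictly positive kernel detects whether any vertex of a given kind exists; bounded row sums
  keep the transported mass finite.  The kernel used here picks a radius \<open>r\<close> with probability
  \<open>2\<^sup>-\<^sup>r\<^sup>-\<^sup>1\<close> and then a uniformly chosen vertex of the ball of radius \<open>r\<close>.
\<close>
lemma positive_bounded_kernel:
  obtains K :: "'x::metric_space birooted_net \<Rightarrow> ennreal"
  where "K \<in> borel_measurable borel" "\<And>z. 0 < K z" "\<And>x. row_sum K x \<le> 1"
proof
  let ?n = "\<lambda>r. row_sum (indicator (near_pairs r :: 'x birooted_net set))"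
  let ?K = "\<lambda>z :: 'x birooted_net. \<Sum>r. ((1 / 2) ^ Suc r / ?n r (rooted_at_first z)) * indicator (near_pairs r) z"
  have half: "(1 / 2 :: ennreal) ^ n = ennreal ((1 / 2) ^ n)" for n
  proof -
    have "ennreal (1 / 2) = ennreal 1 / ennreal 2" by (rule divide_ennreal[symmetric]) simp_all
    then have "(1 / 2 :: ennreal) = ennreal (1 / 2)" unfolding ennreal_1 ennreal_numeral ..
    then show ?thesis by (simp only: ennreal_power)
  qed
  show "?K \<in> borel_measurable borel" by measurable
  show "0 < ?K z" for z :: "'x birooted_net"
  proof -
    obtain r where r: "z \<in> near_pairs r" unfolding near_pairs_def using root2_in_gball by blast
    have "0 < (1 / 2 :: ennreal) ^ Suc r / ?n r (rooted_at_first z)"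
      using ball_size[of r "rooted_at_first z"] unfolding half by (simp add: ennreal_zero_less_divide)
    also have "\<dots> = (\<Sum>i\<in>{r}. ((1 / 2) ^ Suc i / ?n i (rooted_at_first z)) * indicator (near_pairs i) z)"
      using r by simp
    also have "\<dots> \<le> ?K z" by (rule sum_le_suminf) auto
    finally show ?thesis .
  qed
  show "row_sum ?K x \<le> 1" for x
  proof -
    have "row_sum ?K x = (\<Sum>r. row_sum (\<lambda>z. ((1 / 2) ^ Suc r / ?n r (rooted_at_first z)) * indicator (near_pairs r) z) x)"
      by (rule row_sum_suminf)
    also have "\<dots> = (\<Sum>r. (1 / 2) ^ Suc r / ?n r x * ?n r x)"
      by (simp only: row_sum_first[of "\<lambda>y. (1 / 2) ^ Suc _ / ?n _ y"])
    also have "\<dots> = (\<Sum>r. (1 / 2) ^ Suc r)"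
    proof (rule suminf_cong)
      have "a / ?n r x * ?n r x = a" for a r
        using ball_size[of r x] by (simp add: ennreal_divide_times ennreal_divide_self zero_less_iff_neq_zero)
      then show "(1 / 2) ^ Suc r / ?n r x * ?n r x = (1 / 2) ^ Suc r" for r .
    qed
    also have "\<dots> = ennreal 1"
      unfolding half by (rule suminf_ennreal_eq[OF _ power_half_series]) simp
    finally show ?thesis by simp
  qed
qed

text \<open>
  Mass transport among the vertices \<open>v\<close> with \<open>[G, v] \<in> A\<close>.  The constraint on the root itself is the
  almost sure statement, hence only the other end carries an indicator.
\<close>
definition balanced :: "'x::polish_space rooted_net set \<Rightarrow> 'x rooted_net measure \<Rightarrow> bool" where
  "balanced A \<mu> \<longleftrightarrow> finite_measure \<mu> \<and> sets \<mu> = sets borel \<and> (AE x in \<mu>. x \<in> A) \<and>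
     (\<forall>k\<in>borel_measurable borel.
        (\<integral>\<^sup>+x. row_sum (\<lambda>z. k z * indicator A (rooted_at_second z)) x \<partial>\<mu>) =
        (\<integral>\<^sup>+x. row_sum (\<lambda>z. k (swap_roots z) * indicator A (rooted_at_second z)) x \<partial>\<mu>))"

lemma balanced_transport:
  "balanced A \<mu> \<Longrightarrow> k \<in> borel_measurable borel \<Longrightarrow>
    (\<integral>\<^sup>+x. row_sum (\<lambda>z. k z * indicator A (rooted_at_second z)) x \<partial>\<mu>) =
    (\<integral>\<^sup>+x. row_sum (\<lambda>z. k (swap_roots z) * indicator A (rooted_at_second z)) x \<partial>\<mu>)"
  unfolding balanced_def by blast

section \<open>Comparison of balanced measures\<close>

lemma nn_integral_mono_off:
  assumes sets: "sets \<mu> = sets borel" "sets \<nu> = sets borel" and [measurable]: "Y \<in> sets borel"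
    and le: "\<And>X. X \<in> sets borel \<Longrightarrow> X \<inter> Y = {} \<Longrightarrow> emeasure \<mu> X \<le> emeasure \<nu> X"
    and f [measurable]: "f \<in> borel_measurable borel" and 0: "\<And>x. x \<in> Y \<Longrightarrow> f x = (0 :: ennreal)"
  shows "(\<integral>\<^sup>+x. f x \<partial>\<mu>) \<le> (\<integral>\<^sup>+x. f x \<partial>\<nu>)"
proof -
  note [measurable_cong] = sets
  let ?d = "\<lambda>\<mu>. density \<mu> (indicator (- Y))"
  have eq: "(\<integral>\<^sup>+x. f x \<partial>\<mu>) = (\<integral>\<^sup>+x. f x \<partial>?d \<mu>)" if [measurable_cong]: "sets \<mu> = sets borel" for \<mu>
    by (subst nn_integral_density) (auto intro!: nn_integral_cong simp: 0 split: split_indicator)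
  have "(\<integral>\<^sup>+x. f x \<partial>?d \<mu>) \<le> (\<integral>\<^sup>+x. f x \<partial>?d \<nu>)"
  proof (rule nn_integral_mono_measure)
    show s: "sets (?d \<mu>) = sets (?d \<nu>)" by (simp add: sets)
    have d: "emeasure (?d \<kappa>) X = emeasure \<kappa> (X - Y)"
      if [measurable]: "X \<in> sets borel" and [measurable_cong]: "sets \<kappa> = sets borel" for X \<kappa>
    proof -
      have "emeasure (?d \<kappa>) X = (\<integral>\<^sup>+x. indicator (- Y) x * indicator X x \<partial>\<kappa>)"
        by (rule emeasure_density) auto
      also have "\<dots> = (\<integral>\<^sup>+x. indicator (X - Y) x \<partial>\<kappa>)"
        by (rule nn_integral_cong) (auto split: split_indicator)
      also have "\<dots> = emeasure \<kappa> (X - Y)" by (rule nn_integral_indicator) (simp add: that(2))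
      finally show ?thesis .
    qed
    have "emeasure (?d \<mu>) X \<le> emeasure (?d \<nu>) X" if "X \<in> sets borel" for X
      unfolding d[OF that sets(1)] d[OF that sets(2)] using that by (intro le) auto
    then show "?d \<mu> \<le> ?d \<nu>" using le_measure[OF s] by (simp add: sets)
  qed
  then show ?thesis unfolding eq[OF sets(1)] eq[OF sets(2)] .
qed

text \<open>
  Take any Hahn decomposition with positive set \<open>Y\<close>, and let \<open>D\<close> be the event that some vertex of \<open>A\<close> lies in \<open>Y\<close>.
  Off \<open>D\<close> the root, being in \<open>A\<close>, is outside \<open>Y\<close>, so \<open>\<mu> \<le> \<nu>\<close> there.  On \<open>D\<close>, roots
  outside \<open>Y\<close> send mass to the vertices of \<open>A\<close> in \<open>Y\<close>, a positive amount \<open>\<phi>\<close>.  As \<open>\<mu> \<le> \<nu>\<close> outside \<open>Y\<close>, the mass sent is no larger under \<open>\<mu>\<close> than under \<open>\<nu>\<close>; as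
  \<open>\<nu> \<le> \<mu>\<close> in \<open>Y\<close>, the mass received is no larger under \<open>\<nu>\<close> than under \<open>\<mu>\<close>.  Sent and received masses are
  equal, so \<open>\<phi>\<close> has the same finite integral under both measures, and \<open>\<mu> = \<nu>\<close> where \<open>\<phi> > 0\<close>.
\<close>
lemma balanced_Hahn_decomposition:
  fixes \<mu> \<nu> :: "'x::polish_space rooted_net measure"
  assumes A [measurable]: "A \<in> sets borel" and mu: "balanced A \<mu>" and nu: "balanced A \<nu>"
  obtains D where "D \<in> sets borel" "invariant_event D"
    "\<And>X. X \<in> sets borel \<Longrightarrow> X \<subseteq> D \<Longrightarrow> emeasure \<nu> X \<le> emeasure \<mu> X"
    "\<And>X. X \<in> sets borel \<Longrightarrow> X \<inter> D = {} \<Longrightarrow> emeasure \<mu> X \<le> emeasure \<nu> X"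
proof -
  have sets [measurable_cong]: "sets \<mu> = sets borel" "sets \<nu> = sets borel"
    and fin: "finite_measure \<mu>" "finite_measure \<nu>"
    and AE: "AE x in \<mu>. x \<in> A"
    using mu nu by (auto simp: balanced_def)
  obtain Y where Y [measurable]: "Y \<in> sets borel"
    and pos: "\<And>X. X \<in> sets borel \<Longrightarrow> X \<subseteq> Y \<Longrightarrow> emeasure \<nu> X \<le> emeasure \<mu> X"
    and neg: "\<And>X. X \<in> sets borel \<Longrightarrow> X \<inter> Y = {} \<Longrightarrow> emeasure \<mu> X \<le> emeasure \<nu> X"
    using finite_unsigned_Hahn_decomposition[OF fin] sets by auto
  let ?D = "- everywhere (- (A \<inter> Y))"
  obtain K :: "'x birooted_net \<Rightarrow> ennreal" where K [measurable]: "K \<in> borel_measurable borel"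
    and K0: "\<And>z. 0 < K z" and K1: "\<And>x. row_sum K x \<le> 1"
    using positive_bounded_kernel[where 'x = 'x] by blast
  \<comment> \<open>Mass goes from roots outside \<open>Y\<close> to vertices in \<open>Y\<close>; \<open>\<phi>\<close> is sent and \<open>\<psi>\<close> received.\<close>
  let ?k = "\<lambda>z. indicator (- Y) (rooted_at_first z) * (indicator Y (rooted_at_second z) * K z)"
  let ?\<phi> = "row_sum (\<lambda>z. ?k z * indicator A (rooted_at_second z))"
  let ?\<psi> = "row_sum (\<lambda>z. ?k (swap_roots z) * indicator A (rooted_at_second z))"
  have [measurable]: "?\<phi> \<in> borel_measurable borel" "?\<psi> \<in> borel_measurable borel" by measurable
  have phi_Y: "?\<phi> x = 0" if "x \<in> Y" for x
  proof -
    have "?\<phi> x = row_sum (\<lambda>_. 0) x" by (rule row_sum_cong) (use that in auto)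
    then show ?thesis by (simp add: row_sum_def)
  qed
  have psi_Y: "?\<psi> x = 0" if "x \<notin> Y" for x
  proof -
    have "?\<psi> x = row_sum (\<lambda>_. 0) x" by (rule row_sum_cong) (use that in auto)
    then show ?thesis by (simp add: row_sum_def)
  qed
  have phi_1: "?\<phi> x \<le> 1" for x
  proof -
    have "?\<phi> x \<le> row_sum K x" by (rule row_sum_mono) (auto split: split_indicator)
    then show ?thesis using K1[of x] by simp
  qed
  have phi_pos: "0 < ?\<phi> x" if "x \<in> ?D - Y" for x
  proof -
    obtain G u where x: "x = rnet G u" and nw: "network G" "u \<in> verts G" by (rule rooted_net_cases)
    have "rnet G u \<notin> everywhere (- (A \<inter> Y))" using that x by simp
    then obtain v where "v \<in> verts G" "rnet G v \<in> A \<inter> Y"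
      unfolding rnet_everywhere[OF nw] by blast
    then have "?\<phi> x \<noteq> 0"
      using that nw K0[of "bnet G u v"] by (auto simp: x row_sum_eq_0_iff intro!: bexI[of _ v])
    then show ?thesis by (simp add: zero_less_iff_neq_zero)
  qed
  have transport: "(\<integral>\<^sup>+x. ?\<phi> x \<partial>\<mu>) = (\<integral>\<^sup>+x. ?\<psi> x \<partial>\<mu>)" "(\<integral>\<^sup>+x. ?\<phi> x \<partial>\<nu>) = (\<integral>\<^sup>+x. ?\<psi> x \<partial>\<nu>)"
    by (rule balanced_transport[OF mu] balanced_transport[OF nu]; measurable)+
  have le: "(\<integral>\<^sup>+x. ?\<phi> x * indicator Z x \<partial>\<mu>) \<le> (\<integral>\<^sup>+x. ?\<phi> x * indicator Z x \<partial>\<nu>)"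
    if [measurable]: "Z \<in> sets borel" for Z
    by (rule nn_integral_mono_off[OF sets Y neg]) (auto simp: phi_Y)
  have "(\<integral>\<^sup>+x. ?\<psi> x \<partial>\<nu>) \<le> (\<integral>\<^sup>+x. ?\<psi> x \<partial>\<mu>)"
    by (rule nn_integral_mono_off[OF sets(2,1) borel_comp[OF Y] pos]) (use psi_Y in auto)
  then have total: "(\<integral>\<^sup>+x. ?\<phi> x \<partial>\<nu>) \<le> (\<integral>\<^sup>+x. ?\<phi> x \<partial>\<mu>)" unfolding transport .
  have finite: "(\<integral>\<^sup>+x. ?\<phi> x * indicator Z x \<partial>\<mu>) < \<infinity>" for Z
  proof -
    have "(\<integral>\<^sup>+x. ?\<phi> x * indicator Z x \<partial>\<mu>) \<le> (\<integral>\<^sup>+x. 1 \<partial>\<mu>)"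
      using phi_1 by (intro nn_integral_mono) (auto split: split_indicator)
    also have "\<dots> < \<infinity>" using finite_measure.finite_emeasure_space[OF fin(1)] by (simp add: less_top)
    finally show ?thesis .
  qed
  have eq: "(\<integral>\<^sup>+x. ?\<phi> x * indicator Z x \<partial>\<mu>) = (\<integral>\<^sup>+x. ?\<phi> x * indicator Z x \<partial>\<nu>)"
    if [measurable]: "Z \<in> sets borel" for Z
  proof -
    have split: "(\<integral>\<^sup>+x. ?\<phi> x \<partial>\<kappa>) = (\<integral>\<^sup>+x. ?\<phi> x * indicator Z x \<partial>\<kappa>) + (\<integral>\<^sup>+x. ?\<phi> x * indicator (- Z) x \<partial>\<kappa>)"
      if [measurable_cong]: "sets \<kappa> = sets borel" for \<kappa>
      by (subst nn_integral_add[symmetric]) (auto intro!: nn_integral_cong split: split_indicator)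
    have "(\<integral>\<^sup>+x. ?\<phi> x * indicator Z x \<partial>\<nu>) + (\<integral>\<^sup>+x. ?\<phi> x * indicator (- Z) x \<partial>\<mu>) \<le>
      (\<integral>\<^sup>+x. ?\<phi> x * indicator Z x \<partial>\<nu>) + (\<integral>\<^sup>+x. ?\<phi> x * indicator (- Z) x \<partial>\<nu>)"
      by (intro add_left_mono le) simp
    also have "\<dots> \<le> (\<integral>\<^sup>+x. ?\<phi> x * indicator Z x \<partial>\<mu>) + (\<integral>\<^sup>+x. ?\<phi> x * indicator (- Z) x \<partial>\<mu>)"
      using total split sets by simp
    finally have "(\<integral>\<^sup>+x. ?\<phi> x * indicator Z x \<partial>\<nu>) \<le> (\<integral>\<^sup>+x. ?\<phi> x * indicator Z x \<partial>\<mu>)"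
      using finite[of "- Z"] by (auto simp: ennreal_add_left_cancel_le add.commute)
    then show ?thesis using le[OF that] by simp
  qed
  have dens: "density \<mu> ?\<phi> = density \<nu> ?\<phi>"
    by (rule measure_eqI) (auto simp: sets emeasure_density eq)
  have same: "emeasure \<mu> X = emeasure \<nu> X" if [measurable]: "X \<in> sets borel" and "X \<subseteq> ?D - Y" for X
  proof -
    have undo: "emeasure \<kappa> X = (\<integral>\<^sup>+x. indicator X x / ?\<phi> x \<partial>density \<kappa> ?\<phi>)"
      if [measurable_cong]: "sets \<kappa> = sets borel" for \<kappa>
    proof -
      have "(\<integral>\<^sup>+x. indicator X x / ?\<phi> x \<partial>density \<kappa> ?\<phi>) = (\<integral>\<^sup>+x. ?\<phi> x * (indicator X x / ?\<phi> x) \<partial>\<kappa>)"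
        by (rule nn_integral_density) auto
      also have "\<dots> = (\<integral>\<^sup>+x. indicator X x \<partial>\<kappa>)"
      proof (rule nn_integral_cong)
        fix x
        have "?\<phi> x < top" using phi_1[of x] by (meson ennreal_one_less_top le_less_trans)
        then show "?\<phi> x * (indicator X x / ?\<phi> x) = indicator X x"
          using phi_pos[of x] \<open>X \<subseteq> ?D - Y\<close>
          by (cases "x \<in> X") (auto simp: ennreal_times_divide ennreal_divide_self)
      qed
      finally show ?thesis by (simp add: that)
    qed
    show ?thesis unfolding undo[OF sets(1)] undo[OF sets(2)] dens ..
  qed
  show thesis
  proof (rule that)
    show "?D \<in> sets borel" by measurable
    show "invariant_event ?D" by (rule invariant_Compl[OF invariant_everywhere])
    fix X :: "'x rooted_net set" assume X [measurable]: "X \<in> sets borel"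
    show "emeasure \<nu> X \<le> emeasure \<mu> X" if "X \<subseteq> ?D"
    proof -
      have "emeasure \<kappa> X = emeasure \<kappa> (X \<inter> Y) + emeasure \<kappa> (X - Y)" if "sets \<kappa> = sets borel" for \<kappa>
        using that by (subst plus_emeasure) (auto simp: Int_Diff_Un)
      moreover have "emeasure \<nu> (X \<inter> Y) \<le> emeasure \<mu> (X \<inter> Y)" by (rule pos) auto
      moreover have "emeasure \<mu> (X - Y) = emeasure \<nu> (X - Y)" using that by (intro same) auto
      ultimately show ?thesis using sets by (simp add: add_right_mono)
    qed
    show "emeasure \<mu> X \<le> emeasure \<nu> X" if "X \<inter> ?D = {}"
    proof -
      have "X \<inter> A \<inter> Y = {}" using that everywhere_subset[of "- (A \<inter> Y)"] by blast
      then have "emeasure \<mu> (X \<inter> A) \<le> emeasure \<nu> (X \<inter> A)" by (intro neg) auto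
      also have "\<dots> \<le> emeasure \<nu> X" by (rule emeasure_mono) (auto simp: sets)
      finally have "emeasure \<mu> (X \<inter> A) \<le> emeasure \<nu> X" .
      moreover have "emeasure \<mu> X = emeasure \<mu> (X \<inter> A)"
        by (rule emeasure_eq_AE) (use AE in \<open>auto simp: sets elim!: eventually_mono\<close>)
      ultimately show ?thesis by simp
    qed
  qed
qed

section \<open>Unimodularity and extensions in terms of balance\<close>

text \<open>
  Both sides are additive and continuous along increasing sequences, so indicator functions, which are
  real-valued, decide the matter.
\<close>
lemma transport_ennreal:
  fixes \<mu> :: "'x::polish_space rooted_net measure"
  assumes [measurable_cong]: "sets \<mu> = sets borel" and [measurable]: "A \<in> sets borel"
    and real: "\<And>g :: 'x birooted_net \<Rightarrow> real. g \<in> borel_measurable borel \<Longrightarrow> (\<And>z. 0 \<le> g z) \<Longrightarrow>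
      (\<integral>\<^sup>+x. row_sum (\<lambda>z. ennreal (g z) * indicator A (rooted_at_second z)) x \<partial>\<mu>) =
      (\<integral>\<^sup>+x. row_sum (\<lambda>z. ennreal (g (swap_roots z)) * indicator A (rooted_at_second z)) x \<partial>\<mu>)"
    and k: "k \<in> borel_measurable borel"
  shows "(\<integral>\<^sup>+x. row_sum (\<lambda>z. k z * indicator A (rooted_at_second z)) x \<partial>\<mu>) =
    (\<integral>\<^sup>+x. row_sum (\<lambda>z. k (swap_roots z) * indicator A (rooted_at_second z)) x \<partial>\<mu>)"
  using k
proof (induction rule: borel_measurable_induct)
  case (cong f g)
  then show ?case by simp
next
  case (set B)
  have "(\<lambda>z. indicator B z :: real) \<in> borel_measurable borel" using set by measurable
  from real[OF this] show ?case by (simp add: ennreal_indicator)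
next
  case (mult u c)
  note [measurable] = mult(2)
  show ?case
    using mult by (simp add: mult.assoc row_sum_cmult nn_integral_cmult)
next
  case (add u v)
  note [measurable] = add(1,3)
  show ?case
    using add by (simp add: distrib_right row_sum_add nn_integral_add)
next
  case (seq U)
  note [measurable] = seq(1)
  have inc: "incseq (\<lambda>i z. U i (f z) * indicator A (rooted_at_second z))" for f
    using seq(3) by (auto simp: incseq_def le_fun_def intro!: mult_right_mono)
  have "row_sum (\<lambda>z. Sup (range U) (f z) * indicator A (rooted_at_second z)) x =
      (SUP i. row_sum (\<lambda>z. U i (f z) * indicator A (rooted_at_second z)) x)" for f x
    using row_sum_SUP[OF inc, of f x]
    by (simp add: Sup_apply image_image SUP_mult_right_ennreal)
  moreover have "incseq (\<lambda>i. row_sum (\<lambda>z. U i (f z) * indicator A (rooted_at_second z)))" for f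
    using incseqD[OF inc, of _ _ f] by (auto simp: incseq_def le_fun_def intro!: row_sum_mono)
  ultimately have lim: "(\<integral>\<^sup>+x. row_sum (\<lambda>z. Sup (range U) (f z) * indicator A (rooted_at_second z)) x \<partial>\<mu>) =
      (SUP i. \<integral>\<^sup>+x. row_sum (\<lambda>z. U i (f z) * indicator A (rooted_at_second z)) x \<partial>\<mu>)"
    if [measurable]: "f \<in> borel_measurable borel" for f
    by (simp add: nn_integral_monotone_convergence_SUP)
  have id: "(\<lambda>z. z) \<in> borel_measurable borel" by simp
  show ?case unfolding lim[OF id] lim[OF measurable_swap_roots] by (rule SUP_cong[OF refl]) (rule seq)
qed

lemma root_mass_out_eq: "root_mass_out g = row_sum (\<lambda>z. ennreal (g z))"
  by (rule ext) (simp add: root_mass_out_def mass_out_def row_sum_def)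

lemma root_mass_in_eq: "root_mass_in g = row_sum (\<lambda>z. ennreal (g (swap_roots z)))"
  unfolding root_mass_in_def[abs_def] mass_in_def row_sum_def[abs_def]
  by (intro ext nn_integral_cong) (simp add: network_net_of root_of_in)

lemma unimodular_imp_balanced:
  assumes "unimodular Q"
  shows "balanced UNIV Q"
proof -
  have Q: "prob_space Q" "sets Q = sets borel"
    using assms by (auto simp: unimodular_def random_rooted_net_def)
  have "(\<integral>\<^sup>+x. row_sum (\<lambda>z. ennreal (g z) * indicator UNIV (rooted_at_second z)) x \<partial>Q) =
      (\<integral>\<^sup>+x. row_sum (\<lambda>z. ennreal (g (swap_roots z)) * indicator UNIV (rooted_at_second z)) x \<partial>Q)"
    if "g \<in> borel_measurable borel" "\<And>z. 0 \<le> g z" for g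
    using assms[unfolded unimodular_def root_mass_out_eq root_mass_in_eq, THEN conjunct2, rule_format, OF that]
    by simp
  note transport = transport_ennreal[OF Q(2) _ this]
  show ?thesis
    unfolding balanced_def
  proof (intro conjI ballI)
    show "finite_measure Q" using Q(1) by (rule prob_space.finite_measure)
  qed (rule Q(2), simp, rule transport, simp)
qed

lemma balanced_imp_unimodular:
  assumes "random_rooted_net Q" "balanced UNIV Q"
  shows "unimodular Q"
  unfolding unimodular_def root_mass_out_eq root_mass_in_eq
proof (intro conjI ballI impI)
  fix g :: "'a birooted_net \<Rightarrow> real" assume [measurable]: "g \<in> borel_measurable borel"
  have "(\<lambda>z. ennreal (g z)) \<in> borel_measurable borel" by measurable
  from balanced_transport[OF assms(2) this]
  show "(\<integral>\<^sup>+x. row_sum (\<lambda>z. ennreal (g z)) x \<partial>Q) = (\<integral>\<^sup>+x. row_sum (\<lambda>z. ennreal (g (swap_roots z))) x \<partial>Q)"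
    by simp
qed (fact assms(1))

definition vertices_in :: "('x network \<Rightarrow> nat set) \<Rightarrow> 'x rooted_net set" where
  "vertices_in S = {x. root_of x \<in> S (net_of x)}"

lemma rnet_vertices_in:
  assumes "covariant_subset S" "network G" "u \<in> verts G"
  shows "rnet G u \<in> vertices_in S \<longleftrightarrow> u \<in> S G"
proof -
  obtain f h where "iso_via (=) f h G (net_of (rnet G u))" "f u = root_of (rnet G u)"
    using rnet_representative[OF assms(2,3)] .
  then have "rooted_iso (G, u) (net_of (rnet G u), root_of (rnet G u))"
    using assms by (auto simp: rooted_iso_def network_net_of root_of_in)
  then show ?thesis
    using assms(1) by (auto simp: covariant_subset_def vertices_in_def)
qed

lemma proper_extension_balanced:
  assumes "proper_extension p P0 P S"
  shows "balanced (vertices_in S) P"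
proof -
  have P: "prob_space P" "sets P = sets borel" and cov: "covariant_subset S"
    and AE: "AE x in P. root_of x \<in> S (net_of x)"
    using assms by (auto simp: proper_extension_def extension_def random_rooted_net_def)
  have A: "vertices_in S \<in> sets borel" using cov by (simp add: covariant_subset_def vertices_in_def)
  have sum: "(\<integral>\<^sup>+v. k v \<partial>count_space (S (net_of x))) =
      (\<integral>\<^sup>+v. k v * indicator (vertices_in S) (rnet (net_of x) v) \<partial>count_space (verts (net_of x)))"
    for k :: "nat \<Rightarrow> ennreal" and x
  proof -
    have "S (net_of x) \<subseteq> verts (net_of x)"
      using cov network_net_of by (auto simp: covariant_subset_def)
    then have "(\<integral>\<^sup>+v. k v \<partial>count_space (S (net_of x))) =
        (\<integral>\<^sup>+v. k v * indicator (S (net_of x)) v \<partial>count_space (verts (net_of x)))"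
      by (subst (1 2) nn_integral_count_space_indicator)
         (auto intro!: nn_integral_cong split: split_indicator)
    also have "\<dots> = (\<integral>\<^sup>+v. k v * indicator (vertices_in S) (rnet (net_of x) v) \<partial>count_space (verts (net_of x)))"
      by (intro nn_integral_cong)
         (simp add: rnet_vertices_in[OF cov] network_net_of split: split_indicator)
    finally show ?thesis .
  qed
  have "(\<integral>\<^sup>+x. row_sum (\<lambda>z. ennreal (g z) * indicator (vertices_in S) (rooted_at_second z)) x \<partial>P) =
      (\<integral>\<^sup>+x. row_sum (\<lambda>z. ennreal (g (swap_roots z)) * indicator (vertices_in S) (rooted_at_second z)) x \<partial>P)"
    if "g \<in> borel_measurable borel" "\<And>z. 0 \<le> g z" for g
  proof -
    have "mass_out g (net_of x) (root_of x) (S (net_of x)) =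
        row_sum (\<lambda>z. ennreal (g z) * indicator (vertices_in S) (rooted_at_second z)) x"
      and "mass_in g (net_of x) (root_of x) (S (net_of x)) =
        row_sum (\<lambda>z. ennreal (g (swap_roots z)) * indicator (vertices_in S) (rooted_at_second z)) x" for x
      unfolding mass_out_def mass_in_def row_sum_def sum
      by (intro nn_integral_cong; simp add: network_net_of root_of_in)+
    moreover have "(\<integral>\<^sup>+x. mass_out g (net_of x) (root_of x) (S (net_of x)) \<partial>P) =
        (\<integral>\<^sup>+x. mass_in g (net_of x) (root_of x) (S (net_of x)) \<partial>P)"
      by (rule assms[unfolded proper_extension_def, THEN conjunct2, rule_format, OF that])
    ultimately show ?thesis by simp
  qed
  note transport = transport_ennreal[OF P(2) A this]
  show ?thesis
    unfolding balanced_def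
  proof (intro conjI ballI)
    show "finite_measure P" using P(1) by (rule prob_space.finite_measure)
    show "AE x in P. x \<in> vertices_in S" using AE by (simp add: vertices_in_def)
  qed (rule P(2), rule transport)
qed

text \<open>
  Mass transport between all vertices, restricted to kernels supported on pairs in \<open>A\<close>.
\<close>
lemma balanced_restrict:
  fixes c :: ennreal
  assumes Q: "balanced UNIV Q" and [measurable]: "A \<in> sets borel" and c: "c < \<infinity>"
  shows "balanced A (density Q (\<lambda>x. c * indicator A x))"
  unfolding balanced_def
proof (intro conjI ballI)
  have [measurable_cong]: "sets Q = sets borel" and fin: "finite_measure Q"
    using Q by (auto simp: balanced_def)
  let ?Q = "density Q (\<lambda>x. c * indicator A x)"
  show "sets ?Q = sets borel" by (simp add: \<open>sets Q = sets borel\<close>)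
  show "AE x in ?Q. x \<in> A" by (subst AE_density) (auto split: split_indicator_asm)
  show "finite_measure ?Q"
  proof (rule finite_measureI)
    have "emeasure ?Q (space ?Q) = (\<integral>\<^sup>+x. c * indicator A x \<partial>Q)"
      by (simp add: emeasure_density cong: nn_integral_cong)
    also have "\<dots> = c * emeasure Q A" by (rule nn_integral_cmult_indicator) simp
    also have "\<dots> < \<infinity>"
      using c finite_measure.emeasure_finite[OF fin, of A] by (simp add: ennreal_mult_less_top less_top)
    finally show "emeasure ?Q (space ?Q) \<noteq> \<infinity>" by simp
  qed
  fix k :: "'a birooted_net \<Rightarrow> ennreal" assume [measurable]: "k \<in> borel_measurable borel"
  let ?k = "\<lambda>z. indicator A (rooted_at_first z) * (k z * indicator A (rooted_at_second z))"
  have red: "(\<integral>\<^sup>+x. row_sum (\<lambda>z. l z * indicator A (rooted_at_second z)) x \<partial>?Q) =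
     c * (\<integral>\<^sup>+x. row_sum (\<lambda>z. indicator A (rooted_at_first z) * (l z * indicator A (rooted_at_second z))) x \<partial>Q)"
    if [measurable]: "l \<in> borel_measurable borel" for l
  proof -
    have "(\<integral>\<^sup>+x. row_sum (\<lambda>z. indicator A (rooted_at_first z) * (l z * indicator A (rooted_at_second z))) x \<partial>Q) =
        (\<integral>\<^sup>+x. indicator A x * row_sum (\<lambda>z. l z * indicator A (rooted_at_second z)) x \<partial>Q)"
      by (rule nn_integral_cong) (rule row_sum_first)
    then show ?thesis
      by (subst nn_integral_density) (auto simp: mult.assoc nn_integral_cmult)
  qed
  have "?k \<in> borel_measurable borel" by measurable
  then have "(\<integral>\<^sup>+x. row_sum ?k x \<partial>Q) = (\<integral>\<^sup>+x. row_sum (\<lambda>z. ?k (swap_roots z)) x \<partial>Q)"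
    using balanced_transport[OF Q, of ?k] by simp
  moreover have "?k (swap_roots z) = indicator A (rooted_at_first z) * (k (swap_roots z) * indicator A (rooted_at_second z))" for z
    by (simp add: mult_ac)
  ultimately show "(\<integral>\<^sup>+x. row_sum (\<lambda>z. k z * indicator A (rooted_at_second z)) x \<partial>?Q) =
      (\<integral>\<^sup>+x. row_sum (\<lambda>z. k (swap_roots z) * indicator A (rooted_at_second z)) x \<partial>?Q)"
    by (simp add: red)
qed

text \<open>
  On an invariant Hahn set the two measures are ordered and have the same total mass, hence they agree.
\<close>
lemma unimodular_eqI:
  assumes U: "unimodular Q" "unimodular Q'"
    and eq: "\<And>X. X \<in> sets borel \<Longrightarrow> invariant_event X \<Longrightarrow> emeasure Q X = emeasure Q' X"
  shows "Q = Q'"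
proof -
  note b = unimodular_imp_balanced[OF U(1)] unimodular_imp_balanced[OF U(2)]
  have sets: "sets Q = sets borel" "sets Q' = sets borel"
    and fin: "finite_measure Q" "finite_measure Q'"
    using b by (auto simp: balanced_def)
  obtain D where D [measurable]: "D \<in> sets borel" "invariant_event D"
    and le: "\<And>X. X \<in> sets borel \<Longrightarrow> X \<subseteq> D \<Longrightarrow> emeasure Q' X \<le> emeasure Q X"
      "\<And>X. X \<in> sets borel \<Longrightarrow> X \<inter> D = {} \<Longrightarrow> emeasure Q X \<le> emeasure Q' X"
    using balanced_Hahn_decomposition[OF _ b] by auto
  have one: "emeasure \<mu> X = emeasure \<nu> X"
    if sets: "sets \<mu> = sets borel" "sets \<nu> = sets borel" and fin: "finite_measure \<nu>"
      and E [measurable]: "E \<in> sets borel" and XE: "X \<subseteq> E" and X [measurable]: "X \<in> sets borel"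
      and tot: "emeasure \<mu> E = emeasure \<nu> E"
      and le: "\<And>X. X \<in> sets borel \<Longrightarrow> X \<subseteq> E \<Longrightarrow> emeasure \<mu> X \<le> emeasure \<nu> X" for \<mu> \<nu> E X
  proof (rule antisym)
    show "emeasure \<mu> X \<le> emeasure \<nu> X" using le X XE by simp
    have split: "emeasure \<kappa> X + emeasure \<kappa> (E - X) = emeasure \<kappa> E" if "sets \<kappa> = sets borel" for \<kappa>
      using XE that by (subst plus_emeasure) (auto simp: Un_absorb1)
    have le': "emeasure \<mu> (E - X) \<le> emeasure \<nu> (E - X)" by (rule le) auto
    have "emeasure \<nu> (E - X) + emeasure \<nu> X = emeasure \<mu> (E - X) + emeasure \<mu> X"
      using split[OF sets(1)] split[OF sets(2)] tot by (simp add: add.commute)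
    also have "\<dots> \<le> emeasure \<nu> (E - X) + emeasure \<mu> X" using le' by (rule add_right_mono)
    finally show "emeasure \<nu> X \<le> emeasure \<mu> X"
      using finite_measure.emeasure_finite[OF fin, of "E - X"] by (simp add: ennreal_add_left_cancel_le)
  qed
  show ?thesis
  proof (rule measure_eqI)
    fix X assume "X \<in> sets Q"
    then have X [measurable]: "X \<in> sets borel" by (simp add: sets)
    have split: "emeasure \<kappa> X = emeasure \<kappa> (X \<inter> D) + emeasure \<kappa> (X - D)" if "sets \<kappa> = sets borel" for \<kappa>
      using that by (subst plus_emeasure) (auto simp: Int_Diff_Un)
    have "emeasure Q' (X \<inter> D) = emeasure Q (X \<inter> D)"
      by (rule one[OF sets(2,1) fin(1), of D]) (use eq D le(1) in auto)
    moreover have "emeasure Q (X - D) = emeasure Q' (X - D)"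
    proof (rule one[OF sets fin(2), of "- D"])
      show "emeasure Q (- D) = emeasure Q' (- D)"
        using eq[of "- D"] D(1) invariant_Compl[OF D(2)] by simp
      show "emeasure Q X \<le> emeasure Q' X" if "X \<in> sets borel" "X \<subseteq> - D" for X
        using that by (intro le(2)) auto
    qed (use D(1) in auto)
    ultimately show "emeasure Q X = emeasure Q' X" using split sets by simp
  qed (simp add: sets)
qed

lemma unroot_eq_iff:
  assumes "network G" "u \<in> verts G" "network H" "v \<in> verts H"
  shows "unroot (rnet G u) = unroot (rnet H v) \<longleftrightarrow> net_iso G H"
proof -
  have "net_iso G G" "net_iso H H" using assms iso_eq_refl unfolding net_iso_def by blast+
  then show ?thesis
    using Quotient3_rel[OF Quotient3_net, of G H] assms by (simp add: unroot_rnet unet_def)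
qed

lemma invariant_unroot_vimage: "invariant_event (unroot -` B)"
  unfolding invariant_event_def by (auto simp: unroot_rnet)

text \<open>
  Invariant Borel events are exactly the preimages of the measurable sets of unrooted networks; this
  translates laws of unrooted networks into values on invariant events.
\<close>
lemma invariant_event_unroot:
  assumes "invariant_event X"
  shows "unroot -` (unroot ` X) = X"
proof (intro equalityI subsetI)
  fix x assume "x \<in> unroot -` (unroot ` X)"
  then obtain y where y: "y \<in> X" "unroot x = unroot y" by auto
  obtain G u where x: "x = rnet G u" "network G" "u \<in> verts G" by (rule rooted_net_cases)
  obtain H v where H: "y = rnet H v" "network H" "v \<in> verts H" by (rule rooted_net_cases)
  have "net_iso G H" using y x H by (simp add: unroot_eq_iff)
  then obtain f h where f: "iso_via (=) f h G H" by (auto simp: net_iso_def)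
  then have fu: "f u \<in> verts H" using x by (auto simp: iso_via_def bij_betw_def)
  then have "rnet H (f u) \<in> X"
    using assms y H unfolding invariant_event_def by blast
  then show "x \<in> X" using rnet_iso[OF f] x H by simp
qed auto

lemma emeasure_unrooted_law:
  assumes "sets P = sets borel" "B \<in> sets unrooted_algebra"
  shows "emeasure (unrooted_law P) B = emeasure P (unroot -` B)"
proof -
  have sp: "space P = UNIV" using sets_eq_imp_space_eq[OF assms(1)] by simp
  have "unroot \<in> measurable P unrooted_algebra"
    by (rule measurableI)
       (use assms in \<open>auto simp: sets_unrooted_algebra sp, simp add: unrooted_algebra_def space_measure_of_conv\<close>)
  then show ?thesis unfolding unrooted_law_def using assms sp by (simp add: emeasure_distr)
qed

lemma unrooted_law_eq_iff:
  assumes "sets P = sets borel" "sets Q = sets borel"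
  shows "unrooted_law Q = unrooted_law P \<longleftrightarrow>
    (\<forall>X\<in>sets borel. invariant_event X \<longrightarrow> emeasure Q X = emeasure P X)"
proof
  assume eq: "unrooted_law Q = unrooted_law P"
  show "\<forall>X\<in>sets borel. invariant_event X \<longrightarrow> emeasure Q X = emeasure P X"
  proof (intro ballI impI)
    fix X :: "'a rooted_net set" assume X: "X \<in> sets borel" "invariant_event X"
    then have "unroot ` X \<in> sets unrooted_algebra"
      by (simp add: sets_unrooted_algebra invariant_event_unroot)
    then show "emeasure Q X = emeasure P X"
      using emeasure_unrooted_law[OF assms(1)] emeasure_unrooted_law[OF assms(2)] eq X
      by (metis invariant_event_unroot)
  qed
next
  assume eq: "\<forall>X\<in>sets borel. invariant_event X \<longrightarrow> emeasure Q X = emeasure P X"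
  have s: "sets (unrooted_law M) = sets unrooted_algebra" for M :: "'a rooted_net measure"
    by (simp add: unrooted_law_def)
  show "unrooted_law Q = unrooted_law P"
    by (rule measure_eqI)
       (use eq in \<open>auto simp: s emeasure_unrooted_law assms invariant_unroot_vimage sets_unrooted_algebra\<close>)
qed

lemma unrooted_law_absolutely_continuous_iff:
  assumes "sets P = sets borel" "sets Q = sets borel"
  shows "absolutely_continuous (unrooted_law P) (unrooted_law Q) \<longleftrightarrow>
    (\<forall>X\<in>sets borel. invariant_event X \<longrightarrow> emeasure P X = 0 \<longrightarrow> emeasure Q X = 0)"
proof
  have s: "sets (unrooted_law M) = sets unrooted_algebra" for M :: "'a rooted_net measure"
    by (simp add: unrooted_law_def)
  {
    assume ac: "absolutely_continuous (unrooted_law P) (unrooted_law Q)"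
    show "\<forall>X\<in>sets borel. invariant_event X \<longrightarrow> emeasure P X = 0 \<longrightarrow> emeasure Q X = 0"
    proof (intro ballI impI)
      fix X :: "'a rooted_net set" assume X: "X \<in> sets borel" "invariant_event X" "emeasure P X = 0"
      then have B: "unroot ` X \<in> sets unrooted_algebra"
        by (simp add: sets_unrooted_algebra invariant_event_unroot)
      then have "unroot ` X \<in> null_sets (unrooted_law P)"
        using X by (simp add: null_sets_def s emeasure_unrooted_law assms invariant_event_unroot)
      then have "unroot ` X \<in> null_sets (unrooted_law Q)"
        using ac by (auto simp: absolutely_continuous_def)
      then show "emeasure Q X = 0"
        using B X by (simp add: null_sets_def s emeasure_unrooted_law assms invariant_event_unroot)
    qed
  }
  assume "\<forall>X\<in>sets borel. invariant_event X \<longrightarrow> emeasure P X = 0 \<longrightarrow> emeasure Q X = 0"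
  then show "absolutely_continuous (unrooted_law P) (unrooted_law Q)"
    by (auto simp: absolutely_continuous_def null_sets_def s emeasure_unrooted_law assms
        invariant_unroot_vimage sets_unrooted_algebra)
qed

section \<open>Rerooting along a Markovian kernel\<close>

lemma count_sum_swap:
  fixes f :: "nat \<Rightarrow> nat \<Rightarrow> ennreal"
  shows "(\<integral>\<^sup>+a. (\<integral>\<^sup>+b. f a b \<partial>count_space V) \<partial>count_space V) =
    (\<integral>\<^sup>+b. (\<integral>\<^sup>+a. f a b \<partial>count_space V) \<partial>count_space V)"
  by (rule nn_integral_count_space_nn_integral) auto

lemma count_sum_cmult:
  fixes f :: "nat \<Rightarrow> ennreal"
  shows "(\<integral>\<^sup>+a. c * f a \<partial>count_space V) = c * (\<integral>\<^sup>+a. f a \<partial>count_space V)"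
  and "(\<integral>\<^sup>+a. f a * c \<partial>count_space V) = (\<integral>\<^sup>+a. f a \<partial>count_space V) * c"
  by (rule nn_integral_cmult nn_integral_multc; simp)+

text \<open>
  The matrix identities behind rerooting, where \<open>t\<close> is a stochastic matrix and \<open>s v = t v u\<close> is its column
  at the root \<open>u\<close>: the row of \<open>t\<^sup>t k t\<close> at \<open>u\<close> and its column at \<open>u\<close> have the stated sums.
\<close>
lemma stochastic_sums:
  fixes k t :: "nat \<Rightarrow> nat \<Rightarrow> ennreal" and s :: "nat \<Rightarrow> ennreal"
  assumes t: "\<And>w. w \<in> V \<Longrightarrow> (\<integral>\<^sup>+a. t w a \<partial>count_space V) = 1"
  shows "(\<integral>\<^sup>+a. (\<integral>\<^sup>+w. (\<integral>\<^sup>+v. s v * k v w \<partial>count_space V) * t w a \<partial>count_space V) \<partial>count_space V) =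
      (\<integral>\<^sup>+v. s v * (\<integral>\<^sup>+w. k v w \<partial>count_space V) \<partial>count_space V)" (is ?out)
    and "(\<integral>\<^sup>+a. (\<integral>\<^sup>+w. (\<integral>\<^sup>+v. t v a * k v w \<partial>count_space V) * s w \<partial>count_space V) \<partial>count_space V) =
      (\<integral>\<^sup>+w. s w * (\<integral>\<^sup>+v. k v w \<partial>count_space V) \<partial>count_space V)" (is ?in)
proof -
  have "(\<integral>\<^sup>+a. (\<integral>\<^sup>+w. (\<integral>\<^sup>+v. s v * k v w \<partial>count_space V) * t w a \<partial>count_space V) \<partial>count_space V) =
      (\<integral>\<^sup>+w. (\<integral>\<^sup>+v. s v * k v w \<partial>count_space V) * (\<integral>\<^sup>+a. t w a \<partial>count_space V) \<partial>count_space V)"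
    by (subst count_sum_swap) (simp add: count_sum_cmult)
  also have "\<dots> = (\<integral>\<^sup>+w. (\<integral>\<^sup>+v. s v * k v w \<partial>count_space V) \<partial>count_space V)"
    by (rule nn_integral_cong) (simp add: t)
  also have "\<dots> = (\<integral>\<^sup>+v. s v * (\<integral>\<^sup>+w. k v w \<partial>count_space V) \<partial>count_space V)"
    by (subst count_sum_swap) (simp add: count_sum_cmult)
  finally show ?out .
  have "(\<integral>\<^sup>+a. (\<integral>\<^sup>+w. (\<integral>\<^sup>+v. t v a * k v w \<partial>count_space V) * s w \<partial>count_space V) \<partial>count_space V) =
      (\<integral>\<^sup>+w. (\<integral>\<^sup>+a. (\<integral>\<^sup>+v. t v a * k v w \<partial>count_space V) \<partial>count_space V) * s w \<partial>count_space V)"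
    by (subst count_sum_swap) (simp add: count_sum_cmult)
  also have "\<dots> = (\<integral>\<^sup>+w. (\<integral>\<^sup>+v. (\<integral>\<^sup>+a. t v a \<partial>count_space V) * k v w \<partial>count_space V) * s w \<partial>count_space V)"
  proof -
    have "(\<integral>\<^sup>+a. (\<integral>\<^sup>+v. t v a * k v w \<partial>count_space V) \<partial>count_space V) =
        (\<integral>\<^sup>+v. (\<integral>\<^sup>+a. t v a \<partial>count_space V) * k v w \<partial>count_space V)" for w
      by (subst count_sum_swap) (simp add: count_sum_cmult)
    then show ?thesis by (simp only:)
  qed
  also have "\<dots> = (\<integral>\<^sup>+w. (\<integral>\<^sup>+v. k v w \<partial>count_space V) * s w \<partial>count_space V)"
    by (intro nn_integral_cong arg_cong2[where f = "(*)"] refl) (simp add: t)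
  finally show ?in by (simp add: mult.commute)
qed

definition markov_vertices :: "('x birooted_net \<Rightarrow> ennreal) \<Rightarrow> 'x rooted_net set \<Rightarrow> 'x rooted_net set" where
  "markov_vertices t A =
     {x. row_sum t x = 1 \<and> row_sum (\<lambda>z. t z * indicator (- A) (rooted_at_second z)) x = 0}"

definition rerooted_sum :: "('x birooted_net \<Rightarrow> ennreal) \<Rightarrow> ('x rooted_net \<Rightarrow> ennreal) \<Rightarrow> 'x rooted_net \<Rightarrow> ennreal" where
  "rerooted_sum t \<phi> x = row_sum (\<lambda>z. t (swap_roots z) * \<phi> (rooted_at_second z)) x"

text \<open>
  Move the root \<open>o\<close> to \<open>v\<close> with intensity \<open>t(v, o)\<close>, with weight \<open>h\<close>; a constant weight and the weight
  \<open>1 / E[M | I]\<close> give the two measures of the theorem.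
\<close>
definition reroot :: "'x::polish_space rooted_net measure \<Rightarrow> ('x birooted_net \<Rightarrow> ennreal) \<Rightarrow>
    ('x rooted_net \<Rightarrow> ennreal) \<Rightarrow> 'x rooted_net measure" where
  "reroot P t h = measure_of UNIV (sets borel) (\<lambda>X. \<integral>\<^sup>+x. h x * rerooted_sum t (indicator X) x \<partial>P)"

lemma sets_reroot [simp, measurable_cong]: "sets (reroot P t h) = sets borel"
proof -
  have "sigma_algebra UNIV (sets (borel :: 'a rooted_net measure))"
    using sets.sigma_algebra_axioms[of "borel :: 'a rooted_net measure"] by simp
  then show ?thesis unfolding reroot_def by (rule sigma_algebra.sets_measure_of_eq)
qed

lemma measurable_rerooted_sum [measurable]:
  fixes t :: "'x::metric_space birooted_net \<Rightarrow> ennreal"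
  assumes [measurable]: "t \<in> borel_measurable borel" "\<phi> \<in> borel_measurable borel"
  shows "rerooted_sum t \<phi> \<in> borel_measurable borel"
  unfolding rerooted_sum_def[abs_def] by measurable

lemma rerooted_sum_SUP:
  assumes "incseq \<phi>"
  shows "rerooted_sum t (\<lambda>x. SUP i. \<phi> i x) x = (SUP i. rerooted_sum t (\<phi> i) x)"
proof -
  have "incseq (\<lambda>i z. t (swap_roots z) * \<phi> i (rooted_at_second z))"
    using assms by (auto simp: incseq_def le_fun_def intro!: mult_left_mono)
  from row_sum_SUP[OF this, of x] show ?thesis
    by (simp add: rerooted_sum_def SUP_mult_left_ennreal)
qed

lemma rerooted_sum_mono: "(\<And>x. \<phi> x \<le> \<psi> x) \<Longrightarrow> rerooted_sum t \<phi> x \<le> rerooted_sum t \<psi> x"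
  unfolding rerooted_sum_def by (intro row_sum_mono mult_left_mono) auto

lemma rerooted_sum_invariant:
  assumes "\<And>z. \<phi> (rooted_at_second z) = \<phi> (rooted_at_first z)"
  shows "rerooted_sum t \<phi> x = \<phi> x * row_sum (\<lambda>z. t (swap_roots z)) x"
  using row_sum_first[of \<phi> "\<lambda>z. t (swap_roots z)" x] by (simp add: rerooted_sum_def assms mult.commute)

lemma emeasure_reroot:
  fixes P :: "'x::polish_space rooted_net measure"
  assumes [measurable_cong]: "sets P = sets borel"
    and [measurable]: "t \<in> borel_measurable borel" "h \<in> borel_measurable borel" "X \<in> sets borel"
  shows "emeasure (reroot P t h) X = (\<integral>\<^sup>+x. h x * rerooted_sum t (indicator X) x \<partial>P)"
  unfolding reroot_def
proof (rule emeasure_measure_of_sigma)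
  show "sigma_algebra UNIV (sets (borel :: 'x rooted_net measure))"
    using sets.sigma_algebra_axioms[of "borel :: 'x rooted_net measure"] by simp
  let ?m = "\<lambda>X. \<integral>\<^sup>+x. h x * rerooted_sum t (indicator X) x \<partial>P"
  show "positive (sets borel) ?m"
    by (simp add: positive_def rerooted_sum_def row_sum_def)
  show "countably_additive (sets borel) ?m"
  proof (rule countably_additiveI)
    fix B :: "nat \<Rightarrow> 'x rooted_net set"
    assume "range B \<subseteq> sets borel" and disj: "disjoint_family B"
    then have [measurable]: "B i \<in> sets borel" for i by auto
    have "h x * rerooted_sum t (indicator (\<Union>i. B i)) x = (\<Sum>i. h x * rerooted_sum t (indicator (B i)) x)" for x
    proof -
      have "rerooted_sum t (indicator (\<Union>i. B i)) x = (\<Sum>i. rerooted_sum t (indicator (B i)) x)"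
        unfolding rerooted_sum_def row_sum_suminf[symmetric]
        by (simp add: suminf_indicator[OF disj, symmetric])
      then show ?thesis by simp
    qed
    then have "?m (\<Union>i. B i) = (\<integral>\<^sup>+x. (\<Sum>i. h x * rerooted_sum t (indicator (B i)) x) \<partial>P)"
      by (simp only:)
    also have "\<dots> = (\<Sum>i. ?m (B i))" by (rule nn_integral_suminf) measurable
    finally show "(\<Sum>i. ?m (B i)) = ?m (\<Union>i. B i)" ..
  qed
qed fact

lemma nn_integral_reroot:
  fixes P :: "'x::polish_space rooted_net measure"
  assumes P [measurable_cong]: "sets P = sets borel"
    and t [measurable]: "t \<in> borel_measurable borel" and h [measurable]: "h \<in> borel_measurable borel"
    and f: "f \<in> borel_measurable borel"
  shows "(\<integral>\<^sup>+x. f x \<partial>reroot P t h) = (\<integral>\<^sup>+x. h x * rerooted_sum t f x \<partial>P)"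
  using f
proof (induction rule: borel_measurable_induct)
  case (cong f g)
  then show ?case by simp
next
  case (set X)
  then show ?case using emeasure_reroot[OF P t h] by simp
next
  case (mult u c)
  note [measurable] = mult(2)
  have "h x * rerooted_sum t (\<lambda>x. c * u x) x = c * (h x * rerooted_sum t u x)" for x
    by (simp add: rerooted_sum_def row_sum_cmult mult_ac)
  then show ?case using mult by (simp add: nn_integral_cmult)
next
  case (add u v)
  note [measurable] = add(1,3)
  have "h x * rerooted_sum t (\<lambda>x. v x + u x) x = h x * rerooted_sum t v x + h x * rerooted_sum t u x" for x
    by (simp add: rerooted_sum_def row_sum_add distrib_left)
  then show ?case using add by (simp add: nn_integral_add)
next
  case (seq U)
  note [measurable] = seq(1)
  have "h x * rerooted_sum t (Sup (range U)) x = (SUP i. h x * rerooted_sum t (U i) x)" for x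
    using rerooted_sum_SUP[OF seq(3), of t x]
    by (simp add: SUP_mult_left_ennreal Sup_apply[abs_def] image_image)
  then have "(\<integral>\<^sup>+x. h x * rerooted_sum t (Sup (range U)) x \<partial>P) =
      (\<integral>\<^sup>+x. (SUP i. h x * rerooted_sum t (U i) x) \<partial>P)"
    by (simp only:)
  also have "\<dots> = (SUP i. \<integral>\<^sup>+x. h x * rerooted_sum t (U i) x \<partial>P)"
    using seq(3)
    by (intro nn_integral_monotone_convergence_SUP)
       (auto simp: incseq_def le_fun_def intro!: mult_left_mono rerooted_sum_mono)
  also have "\<dots> = (SUP i. \<integral>\<^sup>+x. U i x \<partial>reroot P t h)"
    by (rule SUP_cong[OF refl]) (rule seq(5)[symmetric])
  also have "\<dots> = (\<integral>\<^sup>+x. (SUP i. U i x) \<partial>reroot P t h)"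
    by (rule nn_integral_monotone_convergence_SUP[symmetric, OF seq(3)]) auto
  also have "\<dots> = (\<integral>\<^sup>+x. Sup (range U) x \<partial>reroot P t h)"
    by (simp add: Sup_apply image_image)
  finally show ?case ..
qed

text \<open>
  For a proper extension, \<open>A\<close> is the event that the root is a vertex of \<open>S\<close>, balance on \<open>A\<close> is properness, and the
  last assumption says that \<open>t\<close> is almost surely Markovian at all vertices.
\<close>
locale markov_transport = prob_space P
  for P :: "'x::polish_space rooted_net measure" +
  fixes A :: "'x rooted_net set" and t :: "'x birooted_net \<Rightarrow> ennreal"
  assumes borel_A [measurable]: "A \<in> sets borel"
    and balanced_P: "balanced A P"
    and borel_t [measurable]: "t \<in> borel_measurable borel"
    and AE_markov: "AE x in P. x \<in> everywhere (markov_vertices t A)"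
begin

lemma sets_P [simp, measurable_cong]: "sets P = sets borel"
  using balanced_P by (simp add: balanced_def)

lemma space_P [simp]: "space P = UNIV"
  using sets_eq_imp_space_eq[OF sets_P] by simp

abbreviation "mass \<equiv> row_sum (\<lambda>z. t (swap_roots z))"

abbreviation "mean_mass \<equiv> nn_cond_exp P invariant_algebra mass"

sublocale finite_measure_subalgebra P invariant_algebra
proof
  show "subalgebra P invariant_algebra"
    by (rule subalgebra_invariant) (simp add: random_rooted_net_def prob_space_axioms)
qed

lemma borel_markov [measurable]: "markov_vertices t A \<in> sets borel"
proof -
  have "Measurable.pred borel (\<lambda>x. row_sum t x = 1 \<and> row_sum (\<lambda>z. t z * indicator (- A) (rooted_at_second z)) x = 0)"
    by measurable
  then show ?thesis by (simp add: markov_vertices_def pred_def)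
qed

lemma markov_rnet:
  assumes "network G" "v \<in> verts G" "rnet G v \<in> markov_vertices t A"
  shows "(\<integral>\<^sup>+w. t (bnet G v w) \<partial>count_space (verts G)) = 1"
    and "w \<in> verts G \<Longrightarrow> t (bnet G v w) * indicator A (rnet G w) = t (bnet G v w)"
proof -
  show "(\<integral>\<^sup>+w. t (bnet G v w) \<partial>count_space (verts G)) = 1"
    using assms by (simp add: markov_vertices_def row_sum_rnet)
  assume "w \<in> verts G"
  moreover have "\<forall>w\<in>verts G. t (bnet G v w) * indicator (- A) (rnet G w) = 0"
    using assms by (simp add: markov_vertices_def row_sum_eq_0_iff)
  ultimately show "t (bnet G v w) * indicator A (rnet G w) = t (bnet G v w)"
    by (cases "rnet G w \<in> A") auto
qed

text \<open>
  The mass sent from \<open>o\<close> to \<open>u\<close> is \<open>h(o)\<close> times the entry of \<open>t\<^sup>t k t\<close>.  Its row sum integrates to the left-hand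
  side.  As \<open>h\<close> is constant on each network, the column sum is \<open>h(o)\<close> times the column sum of \<open>t\<^sup>t k t\<close>, which
  gives the right-hand side.
\<close>
lemma balanced_reroot:
  assumes h: "h \<in> borel_measurable borel" and inv: "\<And>z. h (rooted_at_second z) = h (rooted_at_first z)"
    and k [measurable]: "k \<in> borel_measurable borel"
  shows "(\<integral>\<^sup>+x. row_sum k x \<partial>reroot P t h) = (\<integral>\<^sup>+x. row_sum (\<lambda>z. k (swap_roots z)) x \<partial>reroot P t h)"
proof -
  note [measurable] = h
  let ?F = "\<lambda>z. h (rooted_at_first z) * kernel_product (kernel_product (\<lambda>z. t (swap_roots z)) k) t z"
  have out: "row_sum (\<lambda>z. ?F z * indicator A (rooted_at_second z)) x = h x * rerooted_sum t (row_sum k) x"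
    and in': "row_sum (\<lambda>z. ?F (swap_roots z) * indicator A (rooted_at_second z)) x =
      h x * rerooted_sum t (row_sum (\<lambda>z. k (swap_roots z))) x"
    if "x \<in> everywhere (markov_vertices t A)" for x
  proof -
    obtain G u where x: "x = rnet G u" and nw: "network G" "u \<in> verts G" by (rule rooted_net_cases)
    let ?V = "verts G" and ?t = "\<lambda>v w. t (bnet G v w)" and ?k = "\<lambda>v w. k (bnet G v w)"
    have markov: "rnet G v \<in> markov_vertices t A" if "v \<in> ?V" for v
      using \<open>x \<in> _\<close> that unfolding x rnet_everywhere[OF nw] by blast
    note row = markov_rnet(1)[OF nw(1) _ markov] and absorb = markov_rnet(2)[OF nw(1) _ markov]
    have inv': "h (rnet G v) = h x" if "v \<in> ?V" for v
      using inv[of "bnet G u v"] nw that by (simp add: x)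
    have "row_sum (\<lambda>z. ?F z * indicator A (rooted_at_second z)) x =
        (\<integral>\<^sup>+a. h x * (\<integral>\<^sup>+w. (\<integral>\<^sup>+v. ?t v u * ?k v w \<partial>count_space ?V) * ?t w a \<partial>count_space ?V) \<partial>count_space ?V)"
      unfolding x row_sum_rnet[OF nw]
    proof (intro nn_integral_cong)
      fix a assume "a \<in> space (count_space ?V)"
      then have a: "a \<in> ?V" by simp
      have "?F (bnet G u a) * indicator A (rooted_at_second (bnet G u a)) =
          h (rnet G u) * ((\<integral>\<^sup>+w. (\<integral>\<^sup>+v. ?t v u * ?k v w \<partial>count_space ?V) * ?t w a \<partial>count_space ?V) *
          indicator A (rnet G a))"
        using nw a by (simp add: kernel_product_bnet mult.assoc cong: nn_integral_cong_simp)
      also have "\<dots> = h (rnet G u) * (\<integral>\<^sup>+w. (\<integral>\<^sup>+v. ?t v u * ?k v w \<partial>count_space ?V) *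
          (?t w a * indicator A (rnet G a)) \<partial>count_space ?V)"
        by (simp add: count_sum_cmult(2)[symmetric] mult.assoc)
      also have "\<dots> = h (rnet G u) * (\<integral>\<^sup>+w. (\<integral>\<^sup>+v. ?t v u * ?k v w \<partial>count_space ?V) * ?t w a \<partial>count_space ?V)"
        using a by (intro arg_cong2[where f = "(*)"] refl nn_integral_cong) (simp add: absorb)
      finally show "?F (bnet G u a) * indicator A (rooted_at_second (bnet G u a)) =
        h (rnet G u) * (\<integral>\<^sup>+w. (\<integral>\<^sup>+v. ?t v u * ?k v w \<partial>count_space ?V) * ?t w a \<partial>count_space ?V)" .
    qed
    also have "\<dots> = h x * (\<integral>\<^sup>+v. ?t v u * (\<integral>\<^sup>+w. ?k v w \<partial>count_space ?V) \<partial>count_space ?V)"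
      by (simp add: count_sum_cmult stochastic_sums(1) row)
    also have "(\<integral>\<^sup>+v. ?t v u * (\<integral>\<^sup>+w. ?k v w \<partial>count_space ?V) \<partial>count_space ?V) = rerooted_sum t (row_sum k) x"
      unfolding x rerooted_sum_def row_sum_rnet[OF nw]
      by (rule nn_integral_cong) (simp add: nw row_sum_rnet)
    finally show "row_sum (\<lambda>z. ?F z * indicator A (rooted_at_second z)) x = h x * rerooted_sum t (row_sum k) x" .
    have "row_sum (\<lambda>z. ?F (swap_roots z) * indicator A (rooted_at_second z)) x =
        (\<integral>\<^sup>+a. h x * (\<integral>\<^sup>+w. (\<integral>\<^sup>+v. ?t v a * ?k v w \<partial>count_space ?V) * ?t w u \<partial>count_space ?V) \<partial>count_space ?V)"
      unfolding x row_sum_rnet[OF nw]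
    proof (intro nn_integral_cong)
      fix a assume "a \<in> space (count_space ?V)"
      then have a: "a \<in> ?V" by simp
      have "?F (swap_roots (bnet G u a)) * indicator A (rooted_at_second (bnet G u a)) =
          h (rnet G u) * ((\<integral>\<^sup>+w. (\<integral>\<^sup>+v. ?t v a * ?k v w \<partial>count_space ?V) * ?t w u \<partial>count_space ?V) *
          indicator A (rnet G a))"
        using nw a inv'[OF a] by (simp add: x kernel_product_bnet mult.assoc cong: nn_integral_cong_simp)
      also have "\<dots> = h (rnet G u) * (\<integral>\<^sup>+w. (\<integral>\<^sup>+v. (?t v a * indicator A (rnet G a)) * ?k v w \<partial>count_space ?V) *
          ?t w u \<partial>count_space ?V)"
        by (simp add: count_sum_cmult[symmetric] mult_ac)
      also have "\<dots> = h (rnet G u) * (\<integral>\<^sup>+w. (\<integral>\<^sup>+v. ?t v a * ?k v w \<partial>count_space ?V) * ?t w u \<partial>count_space ?V)"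
        using a by (intro arg_cong2[where f = "(*)"] refl nn_integral_cong) (simp add: absorb)
      finally show "?F (swap_roots (bnet G u a)) * indicator A (rooted_at_second (bnet G u a)) =
        h (rnet G u) * (\<integral>\<^sup>+w. (\<integral>\<^sup>+v. ?t v a * ?k v w \<partial>count_space ?V) * ?t w u \<partial>count_space ?V)" .
    qed
    also have "\<dots> = h x * (\<integral>\<^sup>+w. ?t w u * (\<integral>\<^sup>+v. ?k v w \<partial>count_space ?V) \<partial>count_space ?V)"
      by (simp add: count_sum_cmult stochastic_sums(2) row)
    also have "(\<integral>\<^sup>+w. ?t w u * (\<integral>\<^sup>+v. ?k v w \<partial>count_space ?V) \<partial>count_space ?V) =
        rerooted_sum t (row_sum (\<lambda>z. k (swap_roots z))) x"
      unfolding x rerooted_sum_def row_sum_rnet[OF nw]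
      by (rule nn_integral_cong) (simp add: nw row_sum_rnet cong: nn_integral_cong_simp)
    finally show "row_sum (\<lambda>z. ?F (swap_roots z) * indicator A (rooted_at_second z)) x =
      h x * rerooted_sum t (row_sum (\<lambda>z. k (swap_roots z))) x" .
  qed
  have "(\<integral>\<^sup>+x. row_sum k x \<partial>reroot P t h) = (\<integral>\<^sup>+x. h x * rerooted_sum t (row_sum k) x \<partial>P)"
    by (rule nn_integral_reroot) auto
  also have "\<dots> = (\<integral>\<^sup>+x. row_sum (\<lambda>z. ?F z * indicator A (rooted_at_second z)) x \<partial>P)"
    by (rule nn_integral_cong_AE) (use AE_markov out in \<open>auto elim!: eventually_mono\<close>)
  also have "\<dots> = (\<integral>\<^sup>+x. row_sum (\<lambda>z. ?F (swap_roots z) * indicator A (rooted_at_second z)) x \<partial>P)"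
    by (rule balanced_transport[OF balanced_P]) measurable
  also have "\<dots> = (\<integral>\<^sup>+x. h x * rerooted_sum t (row_sum (\<lambda>z. k (swap_roots z))) x \<partial>P)"
    by (rule nn_integral_cong_AE) (use AE_markov in' in \<open>auto elim!: eventually_mono\<close>)
  also have "\<dots> = (\<integral>\<^sup>+x. row_sum (\<lambda>z. k (swap_roots z)) x \<partial>reroot P t h)"
    by (rule nn_integral_reroot[symmetric]) auto
  finally show ?thesis .
qed

lemma emeasure_reroot_invariant:
  assumes h: "h \<in> borel_measurable invariant_algebra"
    and X: "X \<in> sets borel" "invariant_event X"
  shows "emeasure (reroot P t h) X = (\<integral>\<^sup>+x. h x * indicator X x * mean_mass x \<partial>P)"
proof -
  note hb [measurable] = borel_measurable_invariant[OF h] and [measurable] = X(1)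
  have "emeasure (reroot P t h) X = (\<integral>\<^sup>+x. h x * indicator X x * mass x \<partial>P)"
    using rerooted_sum_invariant[of "indicator X" t] invariant_eventD[OF X(2)]
    by (simp add: emeasure_reroot mult.assoc indicator_def)
  also have "\<dots> = (\<integral>\<^sup>+x. h x * indicator X x * mean_mass x \<partial>P)"
    by (rule nn_cond_exp_intg[symmetric])
       (use h invariant_indicator[OF X] in \<open>auto intro!: borel_measurable_times_ennreal\<close>)
  finally show ?thesis .
qed

lemma unimodular_reroot:
  assumes h: "h \<in> borel_measurable invariant_algebra"
    and one: "(\<integral>\<^sup>+x. h x * mean_mass x \<partial>P) = 1"
  shows "unimodular (reroot P t h)"
proof (rule balanced_imp_unimodular)
  have "emeasure (reroot P t h) UNIV = 1"
    using emeasure_reroot_invariant[OF h, of UNIV] one by (simp add: invariant_event_def)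
  moreover have "space (reroot P t h) = UNIV"
    using sets_eq_imp_space_eq[OF sets_reroot] by simp
  ultimately have prob: "prob_space (reroot P t h)" by (intro prob_spaceI) simp
  then show "random_rooted_net (reroot P t h)" by (simp add: random_rooted_net_def)
  show "balanced UNIV (reroot P t h)"
    unfolding balanced_def
  proof (intro conjI ballI)
    fix k :: "'x birooted_net \<Rightarrow> ennreal" assume "k \<in> borel_measurable borel"
    from balanced_reroot[OF borel_measurable_invariant[OF h] invariant_borel_function[OF h] this]
    show "(\<integral>\<^sup>+x. row_sum (\<lambda>z. k z * indicator UNIV (rooted_at_second z)) x \<partial>reroot P t h) =
        (\<integral>\<^sup>+x. row_sum (\<lambda>z. k (swap_roots z) * indicator UNIV (rooted_at_second z)) x \<partial>reroot P t h)"
      by simp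
  qed (simp_all add: prob_space.finite_measure[OF prob])
qed

text \<open>
  On the invariant event \<open>Z\<close> where the conditional mean vanishes, the root receives no mass almost surely;
  but it sends mass 1 into \<open>A\<close>, and by balance the expected mass sent into \<open>A\<close> on \<open>Z\<close> is the one received from \<open>A\<close>.
\<close>
lemma mean_mass_positive: "AE x in P. 0 < mean_mass x"
proof -
  let ?Z = "{x. mean_mass x = 0}"
  have sp: "space invariant_algebra = UNIV"
    by (simp add: invariant_algebra_def space_measure_of_conv)
  have "{x \<in> space invariant_algebra. mean_mass x = 0} \<in> sets invariant_algebra" by measurable
  then have Z: "?Z \<in> sets borel" "invariant_event ?Z"
    by (auto simp: sp sets_invariant_algebra)
  note [measurable] = Z(1)
  have "(\<integral>\<^sup>+x. indicator ?Z x * mass x \<partial>P) = (\<integral>\<^sup>+x. indicator ?Z x * mean_mass x \<partial>P)"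
    by (rule nn_cond_exp_intg[symmetric]) (use invariant_indicator[OF Z] in auto)
  also have "\<dots> = (\<integral>\<^sup>+x. 0 \<partial>P)" by (rule nn_integral_cong) (auto split: split_indicator)
  finally have 0: "(\<integral>\<^sup>+x. indicator ?Z x * mass x \<partial>P) = 0" by simp
  let ?k = "\<lambda>z. indicator ?Z (rooted_at_first z) * t z"
  have "emeasure P ?Z = (\<integral>\<^sup>+x. indicator ?Z x \<partial>P)" by simp
  also have "\<dots> = (\<integral>\<^sup>+x. row_sum (\<lambda>z. ?k z * indicator A (rooted_at_second z)) x \<partial>P)"
  proof (rule nn_integral_cong_AE, use AE_markov in eventually_elim)
    fix x assume "x \<in> everywhere (markov_vertices t A)"
    then have x: "x \<in> markov_vertices t A" using everywhere_subset by blast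
    obtain G u where xu: "x = rnet G u" and nw: "network G" "u \<in> verts G" by (rule rooted_net_cases)
    have "row_sum (\<lambda>z. t z * indicator A (rooted_at_second z)) x = 1"
      using markov_rnet[OF nw] x nw unfolding xu
      by (simp add: row_sum_rnet cong: nn_integral_cong_simp)
    then show "indicator ?Z x = row_sum (\<lambda>z. ?k z * indicator A (rooted_at_second z)) x"
      using row_sum_first[of "indicator ?Z" "\<lambda>z. t z * indicator A (rooted_at_second z)" x]
      by (simp add: mult.assoc)
  qed
  also have "\<dots> = (\<integral>\<^sup>+x. row_sum (\<lambda>z. ?k (swap_roots z) * indicator A (rooted_at_second z)) x \<partial>P)"
    by (rule balanced_transport[OF balanced_P]) measurable
  also have "\<dots> \<le> (\<integral>\<^sup>+x. indicator ?Z x * mass x \<partial>P)"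
  proof (rule nn_integral_mono)
    fix x
    have "row_sum (\<lambda>z. ?k (swap_roots z) * indicator A (rooted_at_second z)) x \<le>
        row_sum (\<lambda>z. indicator ?Z (rooted_at_first z) * t (swap_roots z)) x"
      using invariant_eventD[OF Z(2)] by (intro row_sum_mono) (auto split: split_indicator)
    then show "row_sum (\<lambda>z. ?k (swap_roots z) * indicator A (rooted_at_second z)) x \<le> indicator ?Z x * mass x"
      using row_sum_first[of "indicator ?Z" "\<lambda>z. t (swap_roots z)" x] by simp
  qed
  finally have "emeasure P ?Z = 0" using 0 by simp
  then show ?thesis
    by (intro AE_I[of _ _ ?Z]) (auto simp: zero_less_iff_neq_zero)
qed

lemma strong_unimodularization_reroot:
  assumes finite: "AE x in P. mean_mass x < \<infinity>"
  shows "strong_unimodularization P (reroot P t (\<lambda>x. 1 / mean_mass x))"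
proof -
  have h: "(\<lambda>x. 1 / mean_mass x) \<in> borel_measurable invariant_algebra" by measurable
  have cancel: "(\<integral>\<^sup>+x. 1 / mean_mass x * indicator X x * mean_mass x \<partial>P) = (\<integral>\<^sup>+x. indicator X x \<partial>P)" for X
  proof (rule nn_integral_cong_AE, use finite mean_mass_positive in eventually_elim)
    fix x assume "mean_mass x < \<infinity>" "0 < mean_mass x"
    then show "1 / mean_mass x * indicator X x * mean_mass x = indicator X x"
      by (auto simp: ennreal_divide_times less_top split: split_indicator)
  qed
  have "emeasure (reroot P t (\<lambda>x. 1 / mean_mass x)) X = emeasure P X"
    if "X \<in> sets borel" "invariant_event X" for X
    unfolding emeasure_reroot_invariant[OF h that] cancel using that by simp
  then have "unrooted_law (reroot P t (\<lambda>x. 1 / mean_mass x)) = unrooted_law P"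
    by (subst unrooted_law_eq_iff) auto
  moreover have "unimodular (reroot P t (\<lambda>x. 1 / mean_mass x))"
    using cancel[of UNIV] emeasure_space_1 by (intro unimodular_reroot h) simp
  ultimately show ?thesis by (simp add: strong_unimodularization_def)
qed

lemma strong_unimodularization_unique:
  assumes "strong_unimodularization P Q" "strong_unimodularization P Q'"
  shows "Q = Q'"
proof (rule unimodular_eqI)
  show "unimodular Q" "unimodular Q'" using assms by (auto simp: strong_unimodularization_def)
  then have "sets Q = sets borel" "sets Q' = sets borel"
    by (auto simp: unimodular_def random_rooted_net_def)
  then show "emeasure Q X = emeasure Q' X" if "X \<in> sets borel" "invariant_event X" for X
    using assms that by (simp add: strong_unimodularization_def unrooted_law_eq_iff)
qed

lemma weak_unimodularization_reroot:
  assumes finite: "(\<integral>\<^sup>+x. mass x \<partial>P) < \<infinity>"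
  shows "weak_unimodularization P (reroot P t (\<lambda>_. 1 / (\<integral>\<^sup>+x. mass x \<partial>P)))"
proof -
  let ?E = "\<integral>\<^sup>+x. mass x \<partial>P"
  let ?Q = "reroot P t (\<lambda>_. 1 / ?E)"
  have h: "(\<lambda>_. 1 / ?E) \<in> borel_measurable invariant_algebra" by simp
  have E: "(\<integral>\<^sup>+x. mean_mass x \<partial>P) = ?E"
    using nn_cond_exp_intg[of "\<lambda>_. 1" mass] by simp
  have null: "(\<integral>\<^sup>+x. indicator X x * mean_mass x \<partial>P) = 0 \<longleftrightarrow> emeasure P X = 0"
    if [measurable]: "X \<in> sets borel" for X
  proof -
    have "(\<integral>\<^sup>+x. indicator X x * mean_mass x \<partial>P) = 0 \<longleftrightarrow> (AE x in P. indicator X x * mean_mass x = 0)"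
      by (rule nn_integral_0_iff_AE) measurable
    also have "\<dots> \<longleftrightarrow> (AE x in P. x \<notin> X)"
      using mean_mass_positive by (intro eventually_cong[OF mean_mass_positive]) (auto split: split_indicator)
    also have "\<dots> \<longleftrightarrow> emeasure P X = 0"
      by (subst AE_iff_null_sets[symmetric]) (auto simp: null_sets_def)
    finally show ?thesis .
  qed
  have "?E \<noteq> 0" using null[of UNIV] emeasure_space_1 E by auto
  then have pos: "1 / ?E * ?E = 1"
    using finite by (simp add: ennreal_divide_times)
  then have "1 / ?E \<noteq> 0" by auto
  have Q: "emeasure ?Q X = 1 / ?E * (\<integral>\<^sup>+x. indicator X x * mean_mass x \<partial>P)"
    if [measurable]: "X \<in> sets borel" and "invariant_event X" for X
    unfolding emeasure_reroot_invariant[OF h that] mult.assoc by (rule nn_integral_cmult) measurable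
  have "unimodular ?Q"
    by (rule unimodular_reroot[OF h]) (simp add: nn_integral_cmult E pos)
  moreover have "emeasure ?Q X = 0 \<longleftrightarrow> emeasure P X = 0" if "X \<in> sets borel" "invariant_event X" for X
    using Q[OF that] null[OF that(1)] \<open>1 / ?E \<noteq> 0\<close> by simp
  ultimately show ?thesis
    by (auto simp: weak_unimodularization_def unrooted_law_absolutely_continuous_iff)
qed

section \<open>Finiteness of the conditional mean\<close>

text \<open>
  \<open>Q\<close> is compared with \<open>P\<close> through its restrictions to \<open>A\<close>, scaled by \<open>n\<close>.  Under \<open>Q\<close> the mass received has
  mean 1, because \<open>t\<close> is Markovian \<open>Q\<close>-almost surely as well.
\<close>
lemma mean_mass_finite:
  assumes Q: "weak_unimodularization P Q"
  shows "AE x in P. mean_mass x < \<infinity>"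
proof -
  have uQ: "balanced UNIV Q" using Q by (simp add: weak_unimodularization_def unimodular_imp_balanced)
  have sQ [simp, measurable_cong]: "sets Q = sets borel" and pQ: "prob_space Q"
    using Q by (auto simp: weak_unimodularization_def unimodular_def random_rooted_net_def)
  have PQ: "emeasure P X = 0 \<longleftrightarrow> emeasure Q X = 0" if "X \<in> sets borel" "invariant_event X" for X
    using Q that by (auto simp: weak_unimodularization_def unrooted_law_absolutely_continuous_iff)
  have transfer: "AE x in Q. x \<in> X" if X [measurable]: "X \<in> sets borel" "invariant_event X" "AE x in P. x \<in> X" for X
  proof -
    have "emeasure P (- X) = 0"
      using that(3) by (subst (asm) AE_iff_measurable[of "- X"]) (auto simp: sets_eq_imp_space_eq[OF sets_P])
    then have "emeasure Q (- X) = 0" using PQ[of "- X"] invariant_Compl[OF X(2)] by simp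
    then show ?thesis
      by (subst AE_iff_measurable[of "- X"]) (auto simp: sets_eq_imp_space_eq[OF sQ])
  qed
  have markov_Q: "AE x in Q. x \<in> everywhere (markov_vertices t A)"
    by (rule transfer[OF _ invariant_everywhere AE_markov]) measurable
  have mass_Q: "(\<integral>\<^sup>+x. mass x \<partial>Q) = 1"
  proof -
    have "(\<integral>\<^sup>+x. mass x \<partial>Q) = (\<integral>\<^sup>+x. row_sum t x \<partial>Q)"
      using balanced_transport[OF uQ borel_t] by simp
    also have "\<dots> = (\<integral>\<^sup>+x. 1 \<partial>Q)"
      by (rule nn_integral_cong_AE, use markov_Q in eventually_elim)
         (use everywhere_subset[of "markov_vertices t A"] in \<open>auto simp: markov_vertices_def\<close>)
    also have "\<dots> = 1" using prob_space.emeasure_space_1[OF pQ] by simp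
    finally show ?thesis .
  qed
  let ?Q = "\<lambda>n :: nat. density Q (\<lambda>x. of_nat n * indicator A x)"
  have "\<exists>D. D \<in> sets borel \<and> invariant_event D \<and>
      (\<forall>X\<in>sets borel. X \<subseteq> D \<longrightarrow> emeasure (?Q n) X \<le> emeasure P X) \<and>
      (\<forall>X\<in>sets borel. X \<inter> D = {} \<longrightarrow> emeasure P X \<le> emeasure (?Q n) X)" for n
    using balanced_Hahn_decomposition[OF borel_A balanced_P
      balanced_restrict[OF uQ borel_A, of "of_nat n"]] by (simp add: of_nat_less_top) metis
  then obtain D where D [measurable]: "\<And>n. D n \<in> sets borel" and invD: "\<And>n. invariant_event (D n)"
    and geD: "\<And>n X. X \<in> sets borel \<Longrightarrow> X \<subseteq> D n \<Longrightarrow> emeasure (?Q n) X \<le> emeasure P X"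
    and leD: "\<And>n X. X \<in> sets borel \<Longrightarrow> X \<inter> D n = {} \<Longrightarrow> emeasure P X \<le> emeasure (?Q n) X"
    by metis
  have off: "AE x in P. x \<notin> D n \<longrightarrow> mean_mass x < \<infinity>" for n
  proof -
    have inv: "invariant_event (- D n)" by (rule invariant_Compl[OF invD])
    have "(\<integral>\<^sup>+x. indicator (- D n) x * mean_mass x \<partial>P) = (\<integral>\<^sup>+x. indicator (- D n) x * mass x \<partial>P)"
      by (rule nn_cond_exp_intg) (use invariant_indicator[OF _ inv] in auto)
    also have "\<dots> \<le> (\<integral>\<^sup>+x. indicator (- D n) x * mass x \<partial>?Q n)"
      by (rule nn_integral_mono_off[of _ _ "D n"]) (use leD in auto)
    also have "\<dots> = (\<integral>\<^sup>+x. of_nat n * indicator A x * (indicator (- D n) x * mass x) \<partial>Q)"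
      by (rule nn_integral_density) measurable
    also have "\<dots> \<le> (\<integral>\<^sup>+x. of_nat n * mass x \<partial>Q)"
      by (rule nn_integral_mono) (auto split: split_indicator)
    also have "\<dots> = of_nat n" by (simp add: nn_integral_cmult mass_Q)
    also have "\<dots> < \<infinity>" by (simp add: of_nat_less_top)
    finally have "(\<integral>\<^sup>+x. indicator (- D n) x * mean_mass x \<partial>P) \<noteq> \<infinity>" by simp
    then have "AE x in P. indicator (- D n) x * mean_mass x \<noteq> \<infinity>"
      by (intro nn_integral_noteq_infinite) measurable
    then show ?thesis by eventually_elim (auto simp: less_top split: split_indicator_asm)
  qed
  define X where "X = (\<Inter>n. D n)"
  have invX: "invariant_event X" using invD unfolding X_def invariant_event_def by blast
  have X [measurable]: "X \<in> sets borel" unfolding X_def by measurable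
  \<comment> \<open>On \<open>X\<close> the restriction of \<open>Q\<close> to \<open>A\<close> is at most \<open>P / n\<close> for every \<open>n\<close>.\<close>
  have AX: "emeasure Q (A \<inter> X) = 0"
  proof (rule ccontr)
    assume "emeasure Q (A \<inter> X) \<noteq> 0"
    then have "(SUP n. of_nat n * emeasure Q (A \<inter> X)) = top"
      by (simp add: SUP_mult_right_ennreal[symmetric] ennreal_SUP_of_nat_eq_top ennreal_top_mult)
    moreover have "of_nat n * emeasure Q (A \<inter> X) \<le> 1" for n
    proof -
      have "of_nat n * emeasure Q (A \<inter> X) = (\<integral>\<^sup>+x. of_nat n * indicator (A \<inter> X) x \<partial>Q)"
        by (subst nn_integral_cmult_indicator) auto
      also have "\<dots> = (\<integral>\<^sup>+x. of_nat n * indicator A x * indicator X x \<partial>Q)"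
        by (simp add: indicator_inter_arith mult.assoc)
      also have "\<dots> = emeasure (?Q n) X" by (rule emeasure_density[symmetric]) auto
      also have "\<dots> \<le> emeasure P X" by (rule geD) (auto simp: X_def)
      also have "\<dots> \<le> 1" by (rule emeasure_le_1)
      finally show ?thesis .
    qed
    ultimately have "top \<le> (1 :: ennreal)" by (metis SUP_least)
    then show False by (simp add: top_unique)
  qed
  have "AE x in P. x \<in> A" using balanced_P by (simp add: balanced_def)
  then have "AE x in P. x \<in> - everywhere (- A)"
    by eventually_elim (use everywhere_subset[of "- A"] in blast)
  then have some: "AE x in Q. x \<in> - everywhere (- A)"
    by (intro transfer invariant_Compl invariant_everywhere) auto
  \<comment> \<open>Every vertex of a network in \<open>X\<close> sends mass 1 to each vertex of \<open>A\<close>.  Almost surely no root in \<open>A\<close>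
    receives any, so a root in \<open>X\<close> sees no vertex of \<open>A\<close>; but such vertices exist almost surely.\<close>
  let ?k = "\<lambda>z. indicator X (rooted_at_first z) * indicator A (rooted_at_second z) :: ennreal"
  have "(\<integral>\<^sup>+x. row_sum ?k x \<partial>Q) = (\<integral>\<^sup>+x. row_sum (\<lambda>z. ?k (swap_roots z)) x \<partial>Q)"
  proof -
    have "?k \<in> borel_measurable borel" by measurable
    from balanced_transport[OF uQ this] show ?thesis by simp
  qed
  also have "\<dots> = (\<integral>\<^sup>+x. indicator (A \<inter> X) x * row_sum (\<lambda>_. 1) x \<partial>Q)"
  proof (rule nn_integral_cong)
    fix x
    have "?k (swap_roots z) = indicator (A \<inter> X) (rooted_at_first z) * 1" for z
      using invariant_eventD[OF invX, of z] by (auto simp: split: split_indicator)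
    then show "row_sum (\<lambda>z. ?k (swap_roots z)) x = indicator (A \<inter> X) x * row_sum (\<lambda>_. 1) x"
      by (simp only: row_sum_first[of "indicator (A \<inter> X)" "\<lambda>_. 1" x])
  qed
  also have "\<dots> = 0"
  proof -
    have "AE x in Q. x \<notin> A \<inter> X"
      using AX by (intro AE_not_in) (simp add: null_sets_def)
    then have "AE x in Q. indicator (A \<inter> X) x * row_sum (\<lambda>_. 1) x = 0"
      by eventually_elim simp
    then show ?thesis by (subst nn_integral_0_iff_AE) auto
  qed
  finally have "AE x in Q. row_sum ?k x = 0"
    by (subst (asm) nn_integral_0_iff_AE) auto
  then have "AE x in Q. x \<notin> X"
    using some
  proof eventually_elim
    fix x assume 0: "row_sum ?k x = 0" and x: "x \<in> - everywhere (- A)"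
    have "row_sum (\<lambda>z. indicator A (rooted_at_second z)) x \<noteq> (0 :: ennreal)"
      using x unfolding everywhere_eq[of "- A"] by simp
    then show "x \<notin> X" using 0 row_sum_first[of "indicator X" "\<lambda>z. indicator A (rooted_at_second z)" x]
      by (auto split: split_indicator_asm)
  qed
  then have "emeasure Q X = 0"
    by (subst (asm) AE_iff_null_sets[symmetric]) (auto simp: null_sets_def)
  then have "emeasure P X = 0" using PQ[OF X invX] by simp
  then have "AE x in P. x \<notin> X" by (intro AE_not_in) (simp add: null_sets_def)
  moreover have "AE x in P. \<forall>n. x \<notin> D n \<longrightarrow> mean_mass x < \<infinity>"
    unfolding AE_all_countable using off by blast
  ultimately show ?thesis by eventually_elim (auto simp: X_def)
qed

end

section \<open>Unimodularization of proper extensions\<close>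

lemma strong_imp_weak_unimodularization:
  assumes "strong_unimodularization P Q"
  shows "weak_unimodularization P Q"
  using assms by (simp add: strong_unimodularization_def weak_unimodularization_def absolutely_continuous_def)

lemma markovian_to_everywhere:
  assumes cov: "covariant_subset S" and m: "markovian_to T S (net_of x)"
  shows "x \<in> everywhere (markov_vertices (\<lambda>z. ennreal (T z)) (vertices_in S))"
  unfolding everywhere_def markov_vertices_def
proof (intro CollectI ballI conjI)
  let ?G = "net_of x"
  fix v assume v: "v \<in> verts ?G"
  note nw = network_net_of v
  show "row_sum (\<lambda>z. ennreal (T z)) (rnet ?G v) = 1"
    using m v by (simp add: row_sum_rnet[OF nw] markovian_to_def mass_out_def)
  have "ennreal (T (bnet ?G v w)) * indicator (- vertices_in S) (rnet ?G w) = 0" if "w \<in> verts ?G" for w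
    using m v that rnet_vertices_in[OF cov network_net_of that]
    by (cases "w \<in> S ?G") (auto simp: markovian_to_def)
  then show "row_sum (\<lambda>z. ennreal (T z) * indicator (- vertices_in S) (rooted_at_second z)) (rnet ?G v) = 0"
    by (simp add: row_sum_eq_0_iff[OF nw] v network_net_of)
qed

theorem theorem5:
  fixes P :: "'x::polish_space rooted_net measure"
    and P0 :: "'y::polish_space rooted_net measure"
    and p :: "'x \<Rightarrow> 'y"
    and S :: "'x network \<Rightarrow> nat set"
    and T :: "'x birooted_net \<Rightarrow> real"
  assumes "proper_extension p P0 P S"
    and "T \<in> borel_measurable borel"
    and "\<And>z. 0 \<le> T z"
    and "AE x in P. markovian_to T S (net_of x)"
  shows "(can_be_unimodularized P \<longleftrightarrow> (AE x in P. nn_cond_exp P invariant_algebra (root_mass_in T) x < \<infinity>)) \<and>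
    ((\<integral>\<^sup>+x. root_mass_in T x \<partial>P) < \<infinity> \<longrightarrow> weak_unimodularization P (weak_reroot T P)) \<and>
    ((AE x in P. nn_cond_exp P invariant_algebra (root_mass_in T) x < \<infinity>) \<longrightarrow>
       strong_unimodularization P (strong_reroot T P) \<and>
       (\<forall>Q. strong_unimodularization P Q \<longrightarrow> Q = strong_reroot T P))"
proof -
  let ?t = "\<lambda>z. ennreal (T z)"
  have cov: "covariant_subset S" and P: "random_rooted_net P"
    using assms(1) by (auto simp: proper_extension_def extension_def)
  note [measurable] = assms(2)
  interpret prob_space P using P by (simp add: random_rooted_net_def)
  interpret markov_transport P "vertices_in S" ?t
  proof
    show "vertices_in S \<in> sets borel" using cov by (simp add: covariant_subset_def vertices_in_def)
    show "balanced (vertices_in S) P" by (rule proper_extension_balanced[OF assms(1)])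
    show "?t \<in> borel_measurable borel" by measurable
    show "AE x in P. x \<in> everywhere (markov_vertices ?t (vertices_in S))"
      using assms(4) by eventually_elim (rule markovian_to_everywhere[OF cov])
  qed
  have mass: "root_mass_in T = mass"
    by (rule root_mass_in_eq)
  have from_eq: "mass_in_from T X = rerooted_sum ?t (indicator X)" for X
    unfolding mass_in_from_def[abs_def] rerooted_sum_def[abs_def] row_sum_def
    by (intro ext nn_integral_cong) (simp add: network_net_of root_of_in)
  have strong: "strong_reroot T P = reroot P ?t (\<lambda>x. 1 / mean_mass x)"
    by (simp add: strong_reroot_def reroot_def mass from_eq)
  have weak: "weak_reroot T P = reroot P ?t (\<lambda>_. 1 / (\<integral>\<^sup>+x. mass x \<partial>P))"
    unfolding weak_reroot_def reroot_def mass from_eq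
  proof (rule measure_of_eq)
    fix X :: "'x rooted_net set" assume "X \<in> sigma_sets UNIV (sets borel)"
    then have [measurable]: "X \<in> sets borel"
      using sets.sigma_sets_eq[of "borel :: 'x rooted_net measure"] by simp
    show "1 / (\<integral>\<^sup>+x. mass x \<partial>P) * (\<integral>\<^sup>+x. rerooted_sum ?t (indicator X) x \<partial>P) =
        (\<integral>\<^sup>+x. 1 / (\<integral>\<^sup>+x. mass x \<partial>P) * rerooted_sum ?t (indicator X) x \<partial>P)"
      by (rule nn_integral_cmult[symmetric]) measurable
  qed simp
  have "can_be_unimodularized P \<longleftrightarrow> (AE x in P. mean_mass x < \<infinity>)"
    unfolding can_be_unimodularized_def
    using mean_mass_finite strong_imp_weak_unimodularization strong_unimodularization_reroot by blast
  then show ?thesis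
    unfolding mass strong weak
    using weak_unimodularization_reroot strong_unimodularization_reroot
      strong_unimodularization_unique by blast
qed

end
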